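(* Fix a positive integer $k$ and let $N\to\infty$ through multiples of $k$. The limiting expected $2m$-th moment $M_{2m}$ of $\{\mathrm{GOE},k\text{-}\mathrm{BCE}\}$ is given by $$M_{2m}=\sum_{C\in\mathcal{C}_{2,4m}}\ \sum_{\pi_C\in NCF_{2,C}(4m)}k^{\#(\gamma_{4m}\pi_C)-(2m+1)},$$ and the limiting expected $2m$-th moment $M'_{2m}$ of $\{k\text{-}\mathrm{BCE},k\text{-}\mathrm{BCE}\}$ is given by $$M'_{2m}=\sum_{C\in\mathcal{C}_{2,4m}}\ \sum_{\pi_C\in\mathcal{P}_{2,C}(4m)}k^{\#(\gamma_{4m}\pi_C)-(2m+1)}.$$
   Context: Matrix ensembles. The $N\times N$ Gaussian Orthogonal Ensemble (GOE) consists of real symmetric matrices $(a_{ij})$ whose entries $a_{ij}$, $i\le j$, are independent with $a_{ij}=a_{ji}\sim N(0,1)$ for $i\ne j$ and $a_{ii}\sim N(0,2)$. For $k\mid N$, the $N\times N$ real symmetric $k$-block circulant ensemble ($k$-BCE) consists of block matrices whose $(p,q)$ block ($0\le p,q\le N/k-1$) is the $k\times k$ real matrix $B_{q-p}$, where the index of $B$ is read modulo $N/k$, $B_{-i}=B_i^T$ for all $i$ (in particular $B_0$ is symmetric), and apart from these constraints the entries of the blocks are i.i.d. with mean $0$, variance $1$ and finite higher moments. Moments. For $N\times N$ matrices $A_N,B_N$ sampled independently from the first and the second ensemble respectively, put $\{A_N,B_N\}=A_NB_N+B_NA_N$; the limiting expected $2m$-th moment of the anticommutator ensemble is $\lim_{N\to\infty}N^{-(2m+1)}\,\mathbb{E}\left[\mathrm{Tr}\left(\{A_N,B_N\}^{2m}\right)\right]$.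 Combinatorics. $\mathcal{C}_{2,4m}$ is the set of configurations $C=c_1c_2\cdots c_{4m}$ such that $(c_{2s-1},c_{2s})\in\{(a_{2s-1},b_{2s}),(b_{2s-1},a_{2s})\}$ for all $1\le s\le 2m$ (a word in letters $a,b$ in which each consecutive pair of positions $(2s-1,2s)$ carries $ab$ or $ba$). In the first formula letter $a$ stands for the GOE matrix and $b$ for the $k$-BCE matrix. $\mathcal{P}_{2,C}(4m)$ is the set of pairings of $[4m]=\{1,\dots,4m\}$ (partitions into blocks of size $2$) in which each block consists of two positions carrying the same letter in $C$. Two blocks $V,W$ cross if there are $i,l'\in V$ and $j,l\in W$ with $i<j<l'<l$ (or the same with $V,W$ exchanged). $NCF_{2,C}(4m)\subseteq\mathcal{P}_{2,C}(4m)$ is the set of pairings in which no two blocks of $a$'s (GOE terms) cross each other and no block of $b$'s (block circulant terms) crosses a block of $a$'s (blocks of $b$'s may cross each other). A pairing is identified with the permutation that is the product of the transpositions given by its blocks, $\gamma_{4m}$ is the cycle $(1,2,\dots,4m)$, and $\#(\sigma)$ is the number of cycles of a permutation $\sigma$. *)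

theory Defs
  imports
    "HOL-Probability.Probability"
    "HOL-Combinatorics.Combinatorics"
    "Jordan_Normal_Form.Matrix"
begin

section \<open>Matrix ensembles\<close>

text \<open>
  A random \<open>N \<times> N\<close> matrix is a matrix-valued function on a probability space \<open>M\<close>; rows and
  columns are numbered from \<open>0\<close>.  The second parameter of \<^const>\<open>normal_density\<close> is the standard
  deviation, so \<open>sqrt 2\<close> stands for variance \<open>2\<close>.
\<close>

definition is_GOE :: "'w measure \<Rightarrow> nat \<Rightarrow> ('w \<Rightarrow> real mat) \<Rightarrow> bool" where
  "is_GOE M N A \<longleftrightarrow>
     (\<forall>\<omega>\<in>space M. A \<omega> \<in> carrier_mat N N \<and> transpose_mat (A \<omega>) = A \<omega>) \<and>
     prob_space.indep_vars M (\<lambda>_. borel) (\<lambda>(i, j) \<omega>. A \<omega> $$ (i, j)) {(i, j). i \<le> j \<and> j < N} \<and>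
     (\<forall>i j. i < j \<and> j < N \<longrightarrow>
        distributed M lborel (\<lambda>\<omega>. A \<omega> $$ (i, j)) (normal_density 0 1)) \<and>
     (\<forall>i<N. distributed M lborel (\<lambda>\<omega>. A \<omega> $$ (i, i)) (normal_density 0 (sqrt 2)))"

definition admissible_entry_law :: "real measure \<Rightarrow> bool" where
  "admissible_entry_law \<mu> \<longleftrightarrow>
     real_distribution \<mu> \<and>
     (\<forall>j. integrable \<mu> (\<lambda>x. x ^ j)) \<and>
     prob_space.expectation \<mu> (\<lambda>x. x) = 0 \<and>
     prob_space.variance \<mu> (\<lambda>x. x) = 1"

text \<open>
  The constraints \<open>B\<^sub>-\<^sub>r = B\<^sub>r\<^sup>T\<close> and \<open>B\<^sub>r\<^sub>+\<^sub>n = B\<^sub>r\<close> identify entry \<open>(u, v)\<close> of block \<open>r\<close> with entry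
  \<open>(v, u)\<close> of block \<open>n - r\<close>.  The set below contains exactly one representative of each class of
  identified entries.  If \<open>r = 0\<close> or \<open>2 r = n\<close>, then the block itself is symmetric and only
  its upper triangle is free.
\<close>

definition kBCE_free_entries :: "nat \<Rightarrow> nat \<Rightarrow> (int \<times> nat \<times> nat) set" where
  "kBCE_free_entries k n =
     {(r, u, v). 0 \<le> r \<and> 2 * r \<le> int n \<and> u < k \<and> v < k \<and> (r = 0 \<or> 2 * r = int n \<longrightarrow> u \<le> v)}"

definition is_kBCE ::
    "'w measure \<Rightarrow> real measure \<Rightarrow> nat \<Rightarrow> nat \<Rightarrow> ('w \<Rightarrow> real mat) \<Rightarrow> bool" where
  "is_kBCE M \<mu> k N B \<longleftrightarrow>
     k dvd N \<and> admissible_entry_law \<mu> \<and>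
     (\<forall>\<omega>\<in>space M. B \<omega> \<in> carrier_mat N N) \<and>
     (\<exists>b :: int \<Rightarrow> 'w \<Rightarrow> real mat.
        (\<forall>\<omega>\<in>space M. \<forall>r. b r \<omega> \<in> carrier_mat k k \<and>
           b (r + int (N div k)) \<omega> = b r \<omega> \<and>
           b (- r) \<omega> = transpose_mat (b r \<omega>)) \<and>
        (\<forall>\<omega>\<in>space M. \<forall>p < N div k. \<forall>q < N div k. \<forall>u<k. \<forall>v<k.
           B \<omega> $$ (p * k + u, q * k + v) = b (int q - int p) \<omega> $$ (u, v)) \<and>
        prob_space.indep_vars M (\<lambda>_. borel) (\<lambda>(r, u, v) \<omega>. b r \<omega> $$ (u, v))
          (kBCE_free_entries k (N div k)) \<and>
        (\<forall>(r, u, v) \<in> kBCE_free_entries k (N div k).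
           distr M borel (\<lambda>\<omega>. b r \<omega> $$ (u, v)) = \<mu>))"

definition mat_entries :: "nat \<Rightarrow> real mat \<Rightarrow> nat \<times> nat \<Rightarrow> real" where
  "mat_entries N A = restrict (\<lambda>ij. A $$ ij) ({..<N} \<times> {..<N})"

definition indep_matrices ::
    "'w measure \<Rightarrow> nat \<Rightarrow> ('w \<Rightarrow> real mat) \<Rightarrow> ('w \<Rightarrow> real mat) \<Rightarrow> bool" where
  "indep_matrices M N A B \<longleftrightarrow>
     prob_space.indep_var M
       (Pi\<^sub>M ({..<N} \<times> {..<N}) (\<lambda>_. borel)) (\<lambda>\<omega>. mat_entries N (A \<omega>))
       (Pi\<^sub>M ({..<N} \<times> {..<N}) (\<lambda>_. borel)) (\<lambda>\<omega>. mat_entries N (B \<omega>))"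

definition anticommutator :: "real mat \<Rightarrow> real mat \<Rightarrow> real mat" where
  "anticommutator A B = A * B + B * A"

definition mat_trace :: "real mat \<Rightarrow> real" where
  "mat_trace A = (\<Sum>i<dim_row A. A $$ (i, i))"

definition anticomm_moment ::
    "'w measure \<Rightarrow> nat \<Rightarrow> nat \<Rightarrow> ('w \<Rightarrow> real mat) \<Rightarrow> ('w \<Rightarrow> real mat) \<Rightarrow> real" where
  "anticomm_moment M N j A B =
     prob_space.expectation M (\<lambda>\<omega>. mat_trace (anticommutator (A \<omega>) (B \<omega>) ^\<^sub>m j)) / real N ^ (j + 1)"


section \<open>Configurations and pairings\<close>

datatype letter = La | Lb

definition configs :: "nat \<Rightarrow> (nat \<Rightarrow> letter) set" where
  "configs m = {C \<in> {1..4 * m} \<rightarrow>\<^sub>E UNIV.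
     \<forall>s\<in>{1..2 * m}. (C (2 * s - 1), C (2 * s)) \<in> {(La, Lb), (Lb, La)}}"

definition pairings :: "nat \<Rightarrow> nat set set set" where
  "pairings n = {P. partition_on {1..n} P \<and> (\<forall>V\<in>P. card V = 2)}"

definition monochromatic :: "(nat \<Rightarrow> letter) \<Rightarrow> letter \<Rightarrow> nat set \<Rightarrow> bool" where
  "monochromatic C l V \<longleftrightarrow> (\<forall>x\<in>V. C x = l)"

definition config_pairings :: "nat \<Rightarrow> (nat \<Rightarrow> letter) \<Rightarrow> nat set set set" where
  "config_pairings m C =
     {P \<in> pairings (4 * m). \<forall>V\<in>P. monochromatic C La V \<or> monochromatic C Lb V}"

definition crosses :: "nat set \<Rightarrow> nat set \<Rightarrow> bool" where
  "crosses V W \<longleftrightarrow>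
     (\<exists>i\<in>V. \<exists>j\<in>W. \<exists>l'\<in>V. \<exists>l\<in>W. i < j \<and> j < l' \<and> l' < l) \<or>
     (\<exists>i\<in>W. \<exists>j\<in>V. \<exists>l'\<in>W. \<exists>l\<in>V. i < j \<and> j < l' \<and> l' < l)"

definition nc_config_pairings :: "nat \<Rightarrow> (nat \<Rightarrow> letter) \<Rightarrow> nat set set set" where
  "nc_config_pairings m C =
     {P \<in> config_pairings m C.
        (\<forall>V\<in>P. \<forall>W\<in>P. monochromatic C La V \<and> monochromatic C La W \<longrightarrow> \<not> crosses V W) \<and>
        (\<forall>V\<in>P. \<forall>W\<in>P. monochromatic C Lb V \<and> monochromatic C La W \<longrightarrow> \<not> crosses V W)}"

text \<open>
  The blocks of a pairing are disjoint, so the product of the corresponding transpositions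
  sends each point to the other element of its block.
\<close>

definition pairing_perm :: "nat set set \<Rightarrow> nat \<Rightarrow> nat" where
  "pairing_perm P i =
     (if \<exists>j. j \<noteq> i \<and> {i, j} \<in> P then THE j. j \<noteq> i \<and> {i, j} \<in> P else i)"

definition full_cycle :: "nat \<Rightarrow> nat \<Rightarrow> nat" where
  "full_cycle n = cycle_of_list [1..<n + 1]"

text \<open>Number of cycles of a permutation of \<open>{1..n}\<close>, where fixed points count as cycles.\<close>

definition num_cycles :: "nat \<Rightarrow> (nat \<Rightarrow> nat) \<Rightarrow> nat" where
  "num_cycles n \<sigma> = card (orbit \<sigma> ` {1..n})"

definition pairing_weight :: "nat \<Rightarrow> nat \<Rightarrow> nat set set \<Rightarrow> real" where
  "pairing_weight k m P =
     real k powi (int (num_cycles (4 * m) (full_cycle (4 * m) \<circ> pairing_perm P)) - (2 * int m + 1))"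

end

theory Submission
  imports Defs "HOL-Number_Theory.Cong"
begin

text \<open>
  The proof is the moment method.  Put \<open>N = k n\<close> and \<open>L = 4 m\<close>.  Expanding the trace of the
  \<open>2m\<close>-th power of \<open>A B + B A\<close> gives a sum over the words \<open>C\<close> and over the closed index walks
  \<open>i 1, i 2, \<dots>, i L, i 1\<close>, of the expectations of products of entries
  (\<open>trace_anticommutator_power\<close>).  Write each index as \<open>i s = k p s + u s\<close>; the step
  \<open>d s = p (s + 1) - p s\<close>, read modulo \<open>n\<close>, says which block the \<open>s\<close>-th factor comes from.

  About an ensemble only three facts are used, collected in the predicate \<open>wick\<close>: mixed moments
  are bounded independently of \<open>n\<close>; a product in which some entry occurs only once has mean \<open>0\<close>; a
  product in which the entries coincide exactly in pairs, away from the self-transposed blocks,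
  has mean \<open>1\<close>.  Two entries coincide only if their steps agree modulo \<open>n\<close> up to sign.  Hence the
  walks in which some step is not, up to sign, congruent to another step contribute nothing.

  Among the remaining walks, call a walk generic if each step \<open>d s\<close> is congruent, up to sign, to
  precisely one other step, and that one is congruent to \<open>- d s\<close> but not to \<open>d s\<close>.  The steps sum to
  zero.  A walk is determined up to boundedly many choices by \<open>i 1 div k\<close> and one representative of
  each class of steps (\<open>card_walks_le\<close>).  If a walk is not generic, then either there are fewer than
  \<open>2m\<close> classes, or there are \<open>2m\<close> classes of size two and one of them consists of two congruent
  steps; in the latter case the vanishing of the total sum fixes the double of that step.  So there
  are only \<open>O(n^(2m))\<close> non-generic walks (\<open>card_degenerate_le\<close>), which is negligible after the
  division by \<open>N^(2m + 1)\<close>.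

  For a generic walk the expectation is the number of pairings \<open>P\<close>, which is \<open>0\<close> or \<open>1\<close>, such that the
  entries at the two positions of every block of \<open>P\<close> coincide in opposite orientation
  (\<open>walk_value_generic\<close>).  Therefore the moment is, up to \<open>O(1/n)\<close>, the sum over \<open>C\<close> and \<open>P\<close> of
  the number of walks matched by \<open>P\<close>, divided by \<open>N^(2m + 1)\<close>.

  If all matrices are block circulant, then matching means \<open>d (\<pi> s) = - d s\<close>, which leaves \<open>2m\<close> free
  steps and a free starting point, and \<open>u s = u (\<pi> s + 1)\<close>, which leaves one free residue for each
  cycle of \<open>\<gamma> \<pi>\<close>.  This gives \<open>n^(2m + 1) k^#(\<gamma> \<pi>)\<close> walks (\<open>full_matched_count\<close>).
  For a GOE block \<open>{s, t}\<close> with \<open>s < t\<close> the indices themselves must agree, which amounts to the extra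
  condition that \<open>d s + \<dots> + d t\<close> is zero.  It holds automatically if no block crosses
  \<open>{s, t}\<close>, because then the steps between \<open>s\<close> and \<open>t\<close> cancel in pairs (\<open>matched_goe_nc\<close>); and
  if a block crosses \<open>{s, t}\<close>, then it is a new linear equation that costs a factor \<open>n\<close>
  (\<open>card_matched_crossing\<close>).
\<close>

section \<open>Closed walks and their steps modulo the number of blocks\<close>

text \<open>
  The cyclic successor on \<open>{1..L}\<close>.
\<close>

definition cnext :: "nat \<Rightarrow> nat \<Rightarrow> nat" where
  "cnext L s = (if s = L then 1 else Suc s)"

text \<open>
  Closed walks of length \<open>L\<close> on \<open>{..<N}\<close>, given by their vertices \<open>i 1, \<dots>, i L\<close>; the last edge returns
  from \<open>i L\<close> to \<open>i 1\<close>.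
\<close>

definition walks :: "nat \<Rightarrow> nat \<Rightarrow> (nat \<Rightarrow> nat) set" where
  "walks L N = {1..L} \<rightarrow>\<^sub>E {..<N}"

text \<open>
  The pair of indices of the \<open>s\<close>-th factor along the walk.
\<close>

definition edge :: "nat \<Rightarrow> (nat \<Rightarrow> nat) \<Rightarrow> nat \<Rightarrow> nat \<times> nat" where
  "edge L i s = (i s, i (cnext L s))"

text \<open>
  For an index pair \<open>x\<close> the column block minus the row block.  It is an integer; the block of a block
  circulant matrix that contains the entry depends on it only modulo the number of blocks.
\<close>

definition bdiff :: "nat \<Rightarrow> nat \<times> nat \<Rightarrow> int" where
  "bdiff k x = int (snd x div k) - int (fst x div k)"

text \<open>
  The block displacement of the \<open>s\<close>-th edge of a walk.
\<close>

definition bstep :: "nat \<Rightarrow> nat \<Rightarrow> (nat \<Rightarrow> nat) \<Rightarrow> nat \<Rightarrow> int" where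
  "bstep k L i s = bdiff k (edge L i s)"

lemma cnext_in: "s \<in> {1..L} \<Longrightarrow> cnext L s \<in> {1..L}"
  by (auto simp: cnext_def)

lemma finite_walks [simp]: "finite (walks L N)"
  by (simp add: walks_def finite_PiE)

lemma walks_less: "i \<in> walks L N \<Longrightarrow> s \<in> {1..L} \<Longrightarrow> i s < N"
  by (auto simp: walks_def PiE_iff)

lemma bstep_alt: "bstep k L i s = int (i (cnext L s) div k) - int (i s div k)"
  by (simp add: bstep_def bdiff_def edge_def)

lemma sum_step_interval:
  assumes "s \<le> t" "t \<le> L"
  shows "(\<Sum>r\<in>{s..t}. bstep k L i r) = int (i (cnext L t) div k) - int (i s div k)"
  using assms
proof (induction t rule: dec_induct)
  case base
  then show ?case by (simp add: bstep_alt)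
next
  case (step t)
  have *: "{s..Suc t} = insert (Suc t) {s..t}" using step by auto
  from step show ?case
    unfolding * by (simp add: bstep_alt cnext_def)
qed

lemma sum_step: "1 \<le> L \<Longrightarrow> (\<Sum>r\<in>{1..L}. bstep k L i r) = 0"
  by (simp add: sum_step_interval cnext_def)

lemma nat_eq_if_cong:
  assumes "[int a = int b] (mod int n)" "a < n" "b < n"
  shows "a = b"
  using assms by (simp add: cong_int_iff cong_less_modulus_unique_nat)

lemma div_less_blocks: "a < k * n \<Longrightarrow> a div k < (n::nat)"
  by (simp add: less_mult_imp_div_less mult.commute)

lemma walk_eqI:
  assumes i: "i \<in> walks L (k * n)" and j: "j \<in> walks L (k * n)"
    and one: "i 1 div k = j 1 div k"
    and m: "\<And>s. s \<in> {1..L} \<Longrightarrow> i s mod k = j s mod k"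
    and d: "\<And>s. s \<in> {1..L} \<Longrightarrow> [bstep k L i s = bstep k L j s] (mod int n)"
  shows "i = j"
proof -
  have p: "i s div k = j s div k" if "s \<in> {1..L}" for s
    using that
  proof (induction s)
    case (Suc s)
    show ?case
    proof (cases "s = 0")
      case True
      then show ?thesis using one by simp
    next
      case False
      then have s: "s \<in> {1..L}" "cnext L s = Suc s" using Suc.prems by (auto simp: cnext_def)
      have "[bstep k L i s + int (i s div k) = bstep k L j s + int (j s div k)] (mod int n)"
        using d[OF s(1)] Suc.IH[OF s(1)] by (simp add: cong_add)
      then have "[int (i (Suc s) div k) = int (j (Suc s) div k)] (mod int n)"
        by (simp add: bstep_alt s(2))
      then show ?thesis
        using Suc.prems by (intro nat_eq_if_cong[of _ _ n] div_less_blocks walks_less[OF i] walks_less[OF j])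
    qed
  qed simp
  show ?thesis
  proof (rule PiE_ext[of i "{1..L}" "\<lambda>_. {..<k * n}" j])
    fix s assume "s \<in> {1..L}"
    with p m show "i s = j s" by (metis div_mult_mod_eq)
  qed (use i j in \<open>auto simp: walks_def\<close>)
qed

text \<open>
  The basic upper bound.  A walk is determined by the residues \<open>i s mod k\<close>, the starting block
  \<open>i 1 div k\<close> and its steps modulo \<open>n\<close>.  If within \<open>Q\<close> the steps at the positions in \<open>R\<close>, together with
  one bit of information \<open>g\<close>, determine all steps, then \<open>Q\<close> injects into a set of the stated size.
\<close>

lemma card_walks_le:
  fixes g :: "(nat \<Rightarrow> nat) \<Rightarrow> bool"
  assumes Q: "Q \<subseteq> walks L (k * n)" and "0 < k" "0 < n" "1 \<le> L" and fin: "finite R"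
    and det: "\<And>i j. i \<in> Q \<Longrightarrow> j \<in> Q \<Longrightarrow> (\<And>s. s \<in> R \<Longrightarrow> [bstep k L i s = bstep k L j s] (mod int n))
       \<Longrightarrow> g i = g j \<Longrightarrow> (\<And>s. s \<in> {1..L} \<Longrightarrow> [bstep k L i s = bstep k L j s] (mod int n))"
  shows "card Q \<le> 2 * k ^ L * n ^ Suc (card R)"
proof -
  define F where "F = (\<lambda>i. (g i :: bool, restrict (\<lambda>s. i s mod k) {1..L}, i 1 div k,
    restrict (\<lambda>s. bstep k L i s mod int n) R))"
  define T where "T = (UNIV :: bool set) \<times> ({1..L} \<rightarrow>\<^sub>E {..<k}) \<times> {..<n} \<times> (R \<rightarrow>\<^sub>E {0..<int n})"
  have inj: "inj_on F Q"
  proof (rule inj_onI)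
    fix i j assume ij: "i \<in> Q" "j \<in> Q" and eq: "F i = F j"
    have m: "i s mod k = j s mod k" if "s \<in> {1..L}" for s
    proof -
      have "restrict (\<lambda>s. i s mod k) {1..L} s = restrict (\<lambda>s. j s mod k) {1..L} s"
        using eq by (simp add: F_def)
      then show ?thesis using that by simp
    qed
    have r: "[bstep k L i s = bstep k L j s] (mod int n)" if "s \<in> R" for s
    proof -
      have "restrict (\<lambda>s. bstep k L i s mod int n) R s = restrict (\<lambda>s. bstep k L j s mod int n) R s"
        using eq by (simp add: F_def)
      then show ?thesis using that by (simp add: cong_def)
    qed
    show "i = j"
    proof (rule walk_eqI[of i L k n])
      show "i 1 div k = j 1 div k" using eq by (simp add: F_def)
      show "[bstep k L i s = bstep k L j s] (mod int n)" if "s \<in> {1..L}" for s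
        using det[OF ij r _ that] eq by (simp add: F_def)
    qed (use ij Q m in auto)
  qed
  have sub: "F ` Q \<subseteq> T"
  proof
    fix y assume "y \<in> F ` Q"
    then obtain i where i: "i \<in> Q" "y = F i" by auto
    have "i 1 div k < n"
      using i(1) Q \<open>1 \<le> L\<close> by (intro div_less_blocks walks_less[of i L]) auto
    then show "y \<in> T"
      using i assms(2-4) by (auto simp: F_def T_def)
  qed
  have "finite T"
    unfolding T_def using fin by (intro finite_cartesian_product finite_PiE) auto
  then have "card Q \<le> card T"
    using card_inj_on_le[OF inj sub] by simp
  also have "card T = 2 * k ^ L * n ^ Suc (card R)"
    using fin by (simp add: T_def card_cartesian_product card_PiE)
  finally show ?thesis .
qed

section \<open>Moments of matrices with independent centred entries\<close>

text \<open>
  Entries \<open>x\<close> and \<open>y\<close> that a block circulant ensemble identifies in opposite orientation: \<open>y\<close> lies in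
  the transpose of the block of \<open>x\<close>, at the transposed place.  The identification in the same
  orientation is expressed as \<open>opp_block k n x (prod.swap y)\<close>.
\<close>

definition opp_block :: "nat \<Rightarrow> nat \<Rightarrow> nat \<times> nat \<Rightarrow> nat \<times> nat \<Rightarrow> bool" where
  "opp_block k n x y \<longleftrightarrow> [bdiff k y = - bdiff k x] (mod int n) \<and>
     fst x mod k = snd y mod k \<and> snd x mod k = fst y mod k"

text \<open>
  The same relation for a symmetric matrix without further identifications, such as the GOE.
\<close>

definition opp_entry :: "nat \<times> nat \<Rightarrow> nat \<times> nat \<Rightarrow> bool" where
  "opp_entry x y \<longleftrightarrow> y = prod.swap x"

text \<open>
  The properties of the ensemble that the moment method needs, for products of at most \<open>L\<close> entries
  \<open>A (f s)\<close>, \<open>s \<in> S\<close>, of a random \<open>k n \<times> k n\<close> matrix, where \<open>mt\<close> is the relation of being identified in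
  opposite orientation.  Such products are integrable with expectation bounded by \<open>K\<close>; the expectation
  is \<open>0\<close> if some factor is identified with no other factor; and it is \<open>1\<close> if \<open>\<tau>\<close> sends each factor
  to another one identified with it in opposite orientation and there are no further identifications.
  In the last case blocks \<open>r\<close> with \<open>2 r\<close>
  congruent to \<open>0\<close> are excluded, which in particular excludes the diagonal of the GOE, where the
  variance is \<open>2\<close>.
\<close>

definition wick :: "'w measure \<Rightarrow> nat \<Rightarrow> nat \<Rightarrow> nat \<Rightarrow> real \<Rightarrow>
    (nat \<times> nat \<Rightarrow> nat \<times> nat \<Rightarrow> bool) \<Rightarrow> ('w \<Rightarrow> real mat) \<Rightarrow> bool" where
  "wick M k n L K mt A \<longleftrightarrow>
     (\<forall>S :: nat set. \<forall>f. finite S \<and> card S \<le> L \<and> (\<forall>s\<in>S. f s \<in> {..<k * n} \<times> {..<k * n}) \<longrightarrow>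
        integrable M (\<lambda>\<omega>. \<Prod>s\<in>S. A \<omega> $$ f s) \<and>
        \<bar>\<integral>\<omega>. (\<Prod>s\<in>S. A \<omega> $$ f s) \<partial>M\<bar> \<le> K \<and>
        ((\<exists>s\<in>S. \<forall>t\<in>S. t \<noteq> s \<longrightarrow> \<not> mt (f s) (f t) \<and> \<not> mt (f s) (prod.swap (f t))) \<longrightarrow>
           (\<integral>\<omega>. (\<Prod>s\<in>S. A \<omega> $$ f s) \<partial>M) = 0) \<and>
        (\<forall>\<tau>. (\<forall>s\<in>S. \<tau> s \<in> S \<and> \<tau> s \<noteq> s \<and> mt (f s) (f (\<tau> s)) \<and>
               \<not> [2 * bdiff k (f s) = 0] (mod int n) \<and>
               (\<forall>t\<in>S. t \<noteq> s \<and> t \<noteq> \<tau> s \<longrightarrow> \<not> mt (f s) (f t) \<and> \<not> mt (f s) (prod.swap (f t)))) \<longrightarrow>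
           (\<integral>\<omega>. (\<Prod>s\<in>S. A \<omega> $$ f s) \<partial>M) = 1))"

text \<open>
  Laws on the real line with mean zero and moments of all orders.
\<close>

definition centred_law :: "real measure \<Rightarrow> bool" where
  "centred_law \<mu> \<longleftrightarrow> real_distribution \<mu> \<and> (\<forall>j. integrable \<mu> (\<lambda>x. x ^ j)) \<and> (\<integral>x. x \<partial>\<mu>) = 0"

text \<open>
  Independence turns the expectation of a product of variables, in which the variable \<open>X e\<close> may occur
  several times, into a product of moments.
\<close>

lemma (in prob_space) expectation_prod_keyed:
  fixes X :: "'e \<Rightarrow> 'a \<Rightarrow> real"
  assumes ind: "indep_vars (\<lambda>_. borel) X E"
    and law: "\<And>e. e \<in> E \<Longrightarrow> distr M borel (X e) = law e"
    and cen: "\<And>e. e \<in> E \<Longrightarrow> centred_law (law e)"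
    and S: "finite S" "\<And>s. s \<in> S \<Longrightarrow> \<kappa> s \<in> E"
  shows "integrable M (\<lambda>\<omega>. \<Prod>s\<in>S. X (\<kappa> s) \<omega>)"
    and "expectation (\<lambda>\<omega>. \<Prod>s\<in>S. X (\<kappa> s) \<omega>) =
      (\<Prod>e\<in>\<kappa> ` S. \<integral>x. x ^ card {s\<in>S. \<kappa> s = e} \<partial>law e)"
proof -
  define c where "c e = card {s\<in>S. \<kappa> s = e}" for e
  have eq: "(\<Prod>s\<in>S. X (\<kappa> s) \<omega>) = (\<Prod>e\<in>\<kappa> ` S. X e \<omega> ^ c e)" for \<omega>
  proof -
    have "(\<Prod>s\<in>S. X (\<kappa> s) \<omega>) = (\<Prod>e\<in>\<kappa> ` S. \<Prod>s\<in>{s\<in>S. \<kappa> s = e}. X (\<kappa> s) \<omega>)"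
      using S(1) by (rule prod.image_gen)
    also have "\<dots> = (\<Prod>e\<in>\<kappa> ` S. X e \<omega> ^ c e)"
      by (intro prod.cong refl) (simp add: c_def)
    finally show ?thesis .
  qed
  have rv: "random_variable borel (X e)" if "e \<in> E" for e
    using ind that by (auto simp: indep_vars_def)
  have ind': "indep_vars (\<lambda>_. borel) (\<lambda>e \<omega>. X e \<omega> ^ c e) (\<kappa> ` S)"
    using S by (intro indep_vars_compose2[OF indep_vars_subset[OF ind]]) auto
  have int: "integrable M (\<lambda>\<omega>. X e \<omega> ^ c e)" if "e \<in> \<kappa> ` S" for e
  proof -
    have e: "e \<in> E" using that S by auto
    have "integrable (distr M borel (X e)) (\<lambda>x. x ^ c e)"
      using law[OF e] cen[OF e] by (simp add: centred_law_def)
    then show ?thesis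
      using rv[OF e] by (subst (asm) integrable_distr_eq) auto
  qed
  have mom: "expectation (\<lambda>\<omega>. X e \<omega> ^ c e) = (\<integral>x. x ^ c e \<partial>law e)" if "e \<in> \<kappa> ` S" for e
  proof -
    have e: "e \<in> E" using that S by auto
    show ?thesis
      unfolding law[OF e, symmetric] using rv[OF e] by (subst integral_distr) auto
  qed
  show "integrable M (\<lambda>\<omega>. \<Prod>s\<in>S. X (\<kappa> s) \<omega>)"
    unfolding eq using S(1) by (intro indep_vars_integrable ind' int) auto
  have "expectation (\<lambda>\<omega>. \<Prod>s\<in>S. X (\<kappa> s) \<omega>) = (\<Prod>e\<in>\<kappa> ` S. expectation (\<lambda>\<omega>. X e \<omega> ^ c e))"
    unfolding eq using S(1) by (intro indep_vars_lebesgue_integral ind' int) auto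
  also have "\<dots> = (\<Prod>e\<in>\<kappa> ` S. \<integral>x. x ^ c e \<partial>law e)"
    by (intro prod.cong refl mom)
  finally show "expectation (\<lambda>\<omega>. \<Prod>s\<in>S. X (\<kappa> s) \<omega>) =
      (\<Prod>e\<in>\<kappa> ` S. \<integral>x. x ^ card {s\<in>S. \<kappa> s = e} \<partial>law e)"
    by (simp add: c_def)
qed

text \<open>
  A bound for the expectation of a product of at most \<open>L\<close> factors from a family of independent
  variables, repetitions allowed, with laws \<open>\<mu>\<close> and \<open>\<mu>'\<close>.
\<close>

definition moment_bound :: "nat \<Rightarrow> real measure \<Rightarrow> real measure \<Rightarrow> real" where
  "moment_bound L \<mu> \<mu>' = (1 + (\<Sum>j\<le>L. \<bar>\<integral>x. x ^ j \<partial>\<mu>\<bar>) + (\<Sum>j\<le>L. \<bar>\<integral>x. x ^ j \<partial>\<mu>'\<bar>)) ^ L"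

text \<open>
  The key \<open>\<kappa>\<close> maps an index pair to the independent variable that stands at this entry.  Entries with
  equal keys are identified in one of the two orientations, and entries identified in opposite
  orientation have equal keys.
\<close>

lemma wickI:
  fixes X :: "'e \<Rightarrow> 'w \<Rightarrow> real" and \<kappa> :: "nat \<times> nat \<Rightarrow> 'e" and mt :: "nat \<times> nat \<Rightarrow> nat \<times> nat \<Rightarrow> bool"
  assumes "prob_space M"
    and ind: "prob_space.indep_vars M (\<lambda>_. borel) X E"
    and law: "\<And>e. e \<in> E \<Longrightarrow> distr M borel (X e) = law e"
    and laws: "\<And>e. e \<in> E \<Longrightarrow> law e = \<mu> \<or> law e = \<mu>'"
    and cen: "centred_law \<mu>" "centred_law \<mu>'"
    and key: "\<And>x. x \<in> {..<k * n} \<times> {..<k * n} \<Longrightarrow> \<kappa> x \<in> E"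
    and ent: "\<And>x \<omega>. x \<in> {..<k * n} \<times> {..<k * n} \<Longrightarrow> \<omega> \<in> space M \<Longrightarrow> A \<omega> $$ x = X (\<kappa> x) \<omega>"
    and key_mt: "\<And>x y. x \<in> {..<k * n} \<times> {..<k * n} \<Longrightarrow> y \<in> {..<k * n} \<times> {..<k * n} \<Longrightarrow>
        \<kappa> x = \<kappa> y \<Longrightarrow> mt x y \<or> mt x (prod.swap y)"
    and mt_key: "\<And>x y. x \<in> {..<k * n} \<times> {..<k * n} \<Longrightarrow> y \<in> {..<k * n} \<times> {..<k * n} \<Longrightarrow>
        mt x y \<Longrightarrow> \<kappa> x = \<kappa> y"
    and var: "\<And>x. x \<in> {..<k * n} \<times> {..<k * n} \<Longrightarrow> \<not> [2 * bdiff k x = 0] (mod int n) \<Longrightarrow>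
        (\<integral>y. y ^ 2 \<partial>law (\<kappa> x)) = 1"
  shows "wick M k n L (moment_bound L \<mu> \<mu>') mt A"
  unfolding wick_def
proof (intro allI impI, elim conjE)
  fix S :: "nat set" and f :: "nat \<Rightarrow> nat \<times> nat"
  assume S: "finite S" "card S \<le> L" and f: "\<forall>s\<in>S. f s \<in> {..<k * n} \<times> {..<k * n}"
  interpret prob_space M by fact
  have cl: "centred_law (law e)" if "e \<in> E" for e
    using laws[OF that] cen by auto
  define c where "c e = card {s\<in>S. \<kappa> (f s) = e}" for e
  let ?I = "\<integral>\<omega>. (\<Prod>s\<in>S. A \<omega> $$ f s) \<partial>M"
  have AX: "(\<Prod>s\<in>S. A \<omega> $$ f s) = (\<Prod>s\<in>S. X (\<kappa> (f s)) \<omega>)" if "\<omega> \<in> space M" for \<omega>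
    using f that by (intro prod.cong refl ent) auto
  have \<kappa>E: "\<kappa> (f s) \<in> E" if "s \<in> S" for s using f that key by auto
  note keyed = expectation_prod_keyed[OF ind law cl S(1) \<kappa>E]
  have int: "integrable M (\<lambda>\<omega>. \<Prod>s\<in>S. A \<omega> $$ f s)"
    using keyed(1) by (subst Bochner_Integration.integrable_cong[OF refl AX]) auto
  have I: "?I = (\<Prod>e\<in>(\<lambda>s. \<kappa> (f s)) ` S. \<integral>x. x ^ c e \<partial>law e)"
    using keyed(2) by (subst Bochner_Integration.integral_cong[OF refl AX]) (auto simp: c_def)
  have bound: "\<bar>?I\<bar> \<le> moment_bound L \<mu> \<mu>'"
  proof -
    let ?B = "1 + (\<Sum>j\<le>L. \<bar>\<integral>x. x ^ j \<partial>\<mu>\<bar>) + (\<Sum>j\<le>L. \<bar>\<integral>x. x ^ j \<partial>\<mu>'\<bar>)"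
    have B1: "1 \<le> ?B" by (simp add: sum_nonneg)
    have "\<bar>?I\<bar> = (\<Prod>e\<in>(\<lambda>s. \<kappa> (f s)) ` S. \<bar>\<integral>x. x ^ c e \<partial>law e\<bar>)"
      unfolding I by (simp add: abs_prod)
    also have "\<dots> \<le> (\<Prod>e\<in>(\<lambda>s. \<kappa> (f s)) ` S. ?B)"
    proof (intro prod_mono conjI)
      fix e assume "e \<in> (\<lambda>s. \<kappa> (f s)) ` S"
      then have e: "e \<in> E" using \<kappa>E by auto
      have "c e \<le> card S" unfolding c_def using S(1) by (intro card_mono) auto
      then have j: "c e \<in> {..L}" using S(2) by simp
      have m1: "\<bar>\<integral>x. x ^ c e \<partial>\<mu>\<bar> \<le> (\<Sum>j\<le>L. \<bar>\<integral>x. x ^ j \<partial>\<mu>\<bar>)"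
        using j by (intro member_le_sum[of "c e" "{..L}" "\<lambda>j. \<bar>\<integral>x. x ^ j \<partial>\<mu>\<bar>"]) auto
      have m2: "\<bar>\<integral>x. x ^ c e \<partial>\<mu>'\<bar> \<le> (\<Sum>j\<le>L. \<bar>\<integral>x. x ^ j \<partial>\<mu>'\<bar>)"
        using j by (intro member_le_sum[of "c e" "{..L}" "\<lambda>j. \<bar>\<integral>x. x ^ j \<partial>\<mu>'\<bar>"]) auto
      have nn: "0 \<le> (\<Sum>j\<le>L. \<bar>\<integral>x. x ^ j \<partial>\<mu>\<bar>)" "0 \<le> (\<Sum>j\<le>L. \<bar>\<integral>x. x ^ j \<partial>\<mu>'\<bar>)"
        by (simp_all add: sum_nonneg)
      have le: "a \<le> 1 + p + q" "a' \<le> 1 + p + q" if "a \<le> p" "a' \<le> q" "0 \<le> p" "0 \<le> q" for a a' p q :: real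
        using that by linarith+
      from laws[OF e] show "\<bar>\<integral>x. x ^ c e \<partial>law e\<bar> \<le> ?B"
        using le(1)[OF m1 m2 nn] le(2)[OF m1 m2 nn] by (elim disjE) simp_all
    qed simp
    also have "\<dots> = ?B ^ card ((\<lambda>s. \<kappa> (f s)) ` S)" by simp
    also have "\<dots> \<le> ?B ^ L"
      using B1 order_trans[OF card_image_le[OF S(1)] S(2)] by (intro power_increasing) auto
    finally show ?thesis unfolding moment_bound_def .
  qed
  have zero: "?I = 0" if ex: "\<exists>s\<in>S. \<forall>t\<in>S. t \<noteq> s \<longrightarrow> \<not> mt (f s) (f t) \<and> \<not> mt (f s) (prod.swap (f t))"
  proof -
    obtain s where s: "s \<in> S"
      "\<And>t. t \<in> S \<Longrightarrow> t \<noteq> s \<Longrightarrow> \<not> mt (f s) (f t) \<and> \<not> mt (f s) (prod.swap (f t))"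
      using ex by blast
    have "t = s" if "t \<in> S" "\<kappa> (f t) = \<kappa> (f s)" for t
      using s f key_mt[of "f s" "f t"] that by metis
    then have "{t\<in>S. \<kappa> (f t) = \<kappa> (f s)} = {s}" using s(1) by blast
    then have "c (\<kappa> (f s)) = 1" by (simp add: c_def)
    then have "(\<integral>x. x ^ c (\<kappa> (f s)) \<partial>law (\<kappa> (f s))) = 0"
      using cl[OF \<kappa>E[OF s(1)]] by (simp add: centred_law_def)
    then show ?thesis
      unfolding I using s(1) S(1) by (intro prod_zero) auto
  qed
  have one: "?I = 1" if \<tau>: "\<forall>s\<in>S. \<tau> s \<in> S \<and> \<tau> s \<noteq> s \<and> mt (f s) (f (\<tau> s)) \<and>
               \<not> [2 * bdiff k (f s) = 0] (mod int n) \<and>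
               (\<forall>t\<in>S. t \<noteq> s \<and> t \<noteq> \<tau> s \<longrightarrow> \<not> mt (f s) (f t) \<and> \<not> mt (f s) (prod.swap (f t)))" for \<tau>
  proof -
    have "(\<integral>x. x ^ c (\<kappa> (f s)) \<partial>law (\<kappa> (f s))) = 1" if s: "s \<in> S" for s
    proof -
      have t: "\<tau> s \<in> S" "\<tau> s \<noteq> s" "mt (f s) (f (\<tau> s))" "\<not> [2 * bdiff k (f s) = 0] (mod int n)"
        using \<tau> s by auto
      have "{t\<in>S. \<kappa> (f t) = \<kappa> (f s)} = {s, \<tau> s}"
      proof (intro equalityI subsetI)
        fix t assume "t \<in> {t\<in>S. \<kappa> (f t) = \<kappa> (f s)}"
        then have "t \<in> S" "\<kappa> (f s) = \<kappa> (f t)" by auto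
        then have "mt (f s) (f t) \<or> mt (f s) (prod.swap (f t))"
          using f s by (intro key_mt) auto
        then show "t \<in> {s, \<tau> s}" using \<tau> s \<open>t \<in> S\<close> by auto
      next
        fix t assume "t \<in> {s, \<tau> s}"
        then show "t \<in> {t\<in>S. \<kappa> (f t) = \<kappa> (f s)}"
          using s t f mt_key[of "f s" "f (\<tau> s)"] by auto
      qed
      then have "c (\<kappa> (f s)) = 2" using t(2) by (simp add: c_def)
      then show ?thesis using var[of "f s"] f s t(4) by simp
    qed
    then show ?thesis unfolding I by (intro prod.neutral) auto
  qed
  show "integrable M (\<lambda>\<omega>. \<Prod>s\<in>S. A \<omega> $$ f s) \<and>
        \<bar>?I\<bar> \<le> moment_bound L \<mu> \<mu>' \<and>
        ((\<exists>s\<in>S. \<forall>t\<in>S. t \<noteq> s \<longrightarrow> \<not> mt (f s) (f t) \<and> \<not> mt (f s) (prod.swap (f t))) \<longrightarrow> ?I = 0) \<and>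
        (\<forall>\<tau>. (\<forall>s\<in>S. \<tau> s \<in> S \<and> \<tau> s \<noteq> s \<and> mt (f s) (f (\<tau> s)) \<and>
               \<not> [2 * bdiff k (f s) = 0] (mod int n) \<and>
               (\<forall>t\<in>S. t \<noteq> s \<and> t \<noteq> \<tau> s \<longrightarrow> \<not> mt (f s) (f t) \<and> \<not> mt (f s) (prod.swap (f t)))) \<longrightarrow> ?I = 1)"
    by (intro conjI impI allI int bound zero one)
qed

section \<open>The two ensembles\<close>

text \<open>
  The centred normal law with standard deviation \<open>\<sigma>\<close>.
\<close>

abbreviation normal_law :: "real \<Rightarrow> real measure" where
  "normal_law \<sigma> \<equiv> density lborel (\<lambda>x. ennreal (normal_density 0 \<sigma> x))"

lemma integral_normal_law:
  "0 < \<sigma> \<Longrightarrow> (\<integral>x. x ^ j \<partial>normal_law \<sigma>) = (\<integral>x. normal_density 0 \<sigma> x * x ^ j \<partial>lborel)"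
  by (subst integral_density) (auto simp: less_imp_le)

lemma centred_law_normal:
  assumes "0 < \<sigma>"
  shows "centred_law (normal_law \<sigma>)"
proof -
  interpret prob_space "normal_law \<sigma>"
    using assms by (rule prob_space_normal_density)
  have "real_distribution (normal_law \<sigma>)"
    by unfold_locales simp_all
  moreover have "integrable (normal_law \<sigma>) (\<lambda>x. x ^ j)" for j
    using integrable_normal_moment[OF assms, of 0 j] assms
    by (subst integrable_density) (auto simp: less_imp_le)
  moreover have "(\<integral>x. x \<partial>normal_law \<sigma>) = 0"
    using integral_normal_law[OF assms, of 1] integral_normal_moment_nz_1[OF assms, of 0] by simp
  ultimately show ?thesis by (simp add: centred_law_def)
qed

lemma normal_law_variance: "(\<integral>x. x ^ 2 \<partial>normal_law 1) = 1"
  using integral_normal_law[of 1 2] integral_normal_moment_even[of 1 0 1] by simp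

lemma admissible_imp_centred: "admissible_entry_law \<mu> \<Longrightarrow> centred_law \<mu>"
  by (simp add: admissible_entry_law_def centred_law_def)

lemma admissible_variance:
  assumes "admissible_entry_law \<mu>"
  shows "(\<integral>x. x ^ 2 \<partial>\<mu>) = 1"
proof -
  have "(\<integral>x. x \<partial>\<mu>) = 0" "(\<integral>x. (x - (\<integral>x. x \<partial>\<mu>)) ^ 2 \<partial>\<mu>) = 1"
    using assms unfolding admissible_entry_law_def by blast+
  then show ?thesis by simp
qed

lemma wick_GOE:
  assumes "prob_space M" and goe: "is_GOE M (k * n) A"
  shows "wick M k n L (moment_bound L (normal_law 1) (normal_law (sqrt 2))) opp_entry A"
proof -
  define E where "E = {(i, j). i \<le> j \<and> j < k * n}"
  define law where "law = (\<lambda>(i :: nat, j). if i = j then normal_law (sqrt 2) else normal_law 1)"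
  define \<kappa> where "\<kappa> = (\<lambda>(i :: nat, j). (min i j, max i j))"
  show ?thesis
  proof (rule wickI[where X = "\<lambda>(i, j) \<omega>. A \<omega> $$ (i, j)" and E = E and law = law and \<kappa> = \<kappa>])
    show "prob_space M" by fact
    show "prob_space.indep_vars M (\<lambda>_. borel) (\<lambda>(i, j) \<omega>. A \<omega> $$ (i, j)) E"
      using goe by (simp add: is_GOE_def E_def)
    show "distr M borel ((\<lambda>(i, j) \<omega>. A \<omega> $$ (i, j)) e) = law e" if eE: "e \<in> E" for e
    proof -
      obtain i j where e: "e = (i, j)" "i \<le> j" "j < k * n" using eE by (auto simp: E_def)
      have "distr M lborel (\<lambda>\<omega>. A \<omega> $$ (i, j)) = law (i, j)"
        using goe e by (cases "i = j") (auto simp: is_GOE_def distributed_def law_def)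
      moreover have "distr M borel (\<lambda>\<omega>. A \<omega> $$ (i, j)) = distr M lborel (\<lambda>\<omega>. A \<omega> $$ (i, j))"
        by (intro distr_cong) auto
      ultimately show ?thesis by (simp add: e)
    qed
    show "law e = normal_law 1 \<or> law e = normal_law (sqrt 2)" for e
      by (auto simp: law_def split: prod.split)
    show "centred_law (normal_law 1)" "centred_law (normal_law (sqrt 2))"
      by (simp_all add: centred_law_normal)
    show "\<kappa> x \<in> E" if "x \<in> {..<k * n} \<times> {..<k * n}" for x
      using that by (auto simp: \<kappa>_def E_def)
    show "A \<omega> $$ x = (\<lambda>(i, j) \<omega>. A \<omega> $$ (i, j)) (\<kappa> x) \<omega>"
      if x: "x \<in> {..<k * n} \<times> {..<k * n}" and "\<omega> \<in> space M" for x \<omega>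
    proof -
      obtain i j where ij: "x = (i, j)" "i < k * n" "j < k * n" using x by auto
      have c: "A \<omega> \<in> carrier_mat (k * n) (k * n)" "transpose_mat (A \<omega>) = A \<omega>"
        using goe that by (auto simp: is_GOE_def)
      have "A \<omega> $$ (i, j) = A \<omega> $$ (j, i)"
        using c ij by (metis carrier_matD index_transpose_mat(1))
      then show ?thesis by (simp add: ij \<kappa>_def min_def max_def)
    qed
    show "opp_entry x y \<or> opp_entry x (prod.swap y)" if "\<kappa> x = \<kappa> y" for x y
      using that by (cases x; cases y) (auto simp: opp_entry_def \<kappa>_def min_def max_def split: if_splits)
    show "\<kappa> x = \<kappa> y" if "opp_entry x y" for x y
      using that by (cases x; cases y) (auto simp: opp_entry_def \<kappa>_def min_def max_def)
    show "(\<integral>y. y ^ 2 \<partial>law (\<kappa> x)) = 1" if "\<not> [2 * bdiff k x = 0] (mod int n)" for x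
    proof -
      obtain i j where ij: "x = (i, j)" by (cases x)
      then have "i \<noteq> j" using that by (auto simp: bdiff_def)
      then have "law (\<kappa> x) = normal_law 1" by (auto simp: law_def \<kappa>_def ij min_def max_def)
      then show ?thesis using normal_law_variance by simp
    qed
  qed
qed

text \<open>
  The representative in \<open>kBCE_free_entries k n\<close> of the entry \<open>x\<close> of a block circulant matrix.  The block
  index is reduced modulo \<open>n\<close> and replaced by \<open>n - r\<close>, with a transposition, if it exceeds \<open>n/2\<close>.
\<close>

definition kBCE_key :: "nat \<Rightarrow> nat \<Rightarrow> nat \<times> nat \<Rightarrow> int \<times> nat \<times> nat" where
  "kBCE_key k n x = (let r = bdiff k x mod int n; u = fst x mod k; v = snd x mod k in
     if r = 0 \<or> 2 * r = int n then (r, min u v, max u v)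
     else if 2 * r < int n then (r, u, v) else (int n - r, v, u))"

lemma kBCE_key_in:
  assumes "0 < k" "0 < n"
  shows "kBCE_key k n x \<in> kBCE_free_entries k n"
proof -
  define r where "r = bdiff k x mod int n"
  have "0 \<le> r" "r < int n" using assms by (simp_all add: r_def)
  then show ?thesis
    using assms by (auto simp: kBCE_key_def kBCE_free_entries_def Let_def min_def max_def simp flip: r_def)
qed

text \<open>
  An entry has the orientation of its representative or the opposite one.  For the symmetric blocks,
  where the key is sorted, both descriptions of the block index are available.
\<close>

lemma kBCE_key_cases:
  assumes "0 < n"
  obtains r u v where "kBCE_key k n x = (r, u, v)"
    and "([bdiff k x = r] (mod int n) \<and> fst x mod k = u \<and> snd x mod k = v) \<or>
         ([bdiff k x = - r] (mod int n) \<and> fst x mod k = v \<and> snd x mod k = u)"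
proof -
  define r where "r = bdiff k x mod int n"
  have r: "[bdiff k x = r] (mod int n)" by (simp add: r_def cong_def)
  have "[bdiff k x = - (int n - r)] (mod int n)"
    using r by (simp add: cong_def)
  moreover have "[bdiff k x = - r] (mod int n)" if "r = 0 \<or> 2 * r = int n"
  proof -
    have "[r = - r] (mod int n)" using that by (auto simp: cong_iff_dvd_diff)
    then show ?thesis using r cong_trans by blast
  qed
  moreover define u where "u = fst x mod k"
  moreover define v where "v = snd x mod k"
  ultimately have nr: "[bdiff k x = - (int n - r)] (mod int n)"
    and sym: "r = 0 \<or> 2 * r = int n \<Longrightarrow> [bdiff k x = - r] (mod int n)"
    and u: "u = fst x mod k" and v: "v = snd x mod k" by blast+
  consider "r = 0 \<or> 2 * r = int n" | "\<not> (r = 0 \<or> 2 * r = int n)" "2 * r < int n"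
    | "\<not> (r = 0 \<or> 2 * r = int n)" "\<not> 2 * r < int n" by blast
  then show ?thesis
  proof cases
    case 1
    then have "kBCE_key k n x = (r, min u v, max u v)" by (simp add: kBCE_key_def Let_def r_def u v)
    then show ?thesis
    proof (rule that)
      show "([bdiff k x = r] (mod int n) \<and> fst x mod k = min u v \<and> snd x mod k = max u v) \<or>
         ([bdiff k x = - r] (mod int n) \<and> fst x mod k = max u v \<and> snd x mod k = min u v)"
        using r sym[OF 1] u v by (cases "u \<le> v") (simp_all add: min_def max_def)
    qed
  next
    case 2
    then have "kBCE_key k n x = (r, u, v)" by (simp add: kBCE_key_def Let_def r_def u v)
    then show ?thesis using r u v by (intro that[of r u v]) auto
  next
    case 3
    then have "kBCE_key k n x = (int n - r, v, u)" by (simp add: kBCE_key_def Let_def r_def u v)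
    then show ?thesis using nr u v by (intro that[of "int n - r" v u]) auto
  qed
qed

lemma kBCE_key_opp:
  assumes "0 < n" and opp: "opp_block k n x y"
  shows "kBCE_key k n x = kBCE_key k n y"
proof -
  define r where "r = bdiff k x mod int n"
  have r: "0 \<le> r" "r < int n" using assms by (simp_all add: r_def)
  have "bdiff k y mod int n = (- bdiff k x) mod int n" using opp by (simp add: opp_block_def cong_def)
  also have "\<dots> = (if r = 0 then 0 else int n - r)"
    by (simp add: zmod_zminus1_eq_if r_def)
  finally show ?thesis
    using r opp unfolding opp_block_def
    by (auto simp: kBCE_key_def Let_def min_def max_def simp flip: r_def)
qed

lemma wick_kBCE:
  assumes "prob_space M" and "0 < k" "0 < n" and bce: "is_kBCE M \<mu> k (k * n) B"
  shows "wick M k n L (moment_bound L \<mu> \<mu>) (opp_block k n) B"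
proof -
  have n: "k * n div k = n" using \<open>0 < k\<close> by simp
  obtain b :: "int \<Rightarrow> 'a \<Rightarrow> real mat" where
    b0: "\<forall>\<omega>\<in>space M. \<forall>r. b r \<omega> \<in> carrier_mat k k \<and> b (r + int n) \<omega> = b r \<omega> \<and>
           b (- r) \<omega> = transpose_mat (b r \<omega>)"
    and B0: "\<forall>\<omega>\<in>space M. \<forall>p<n. \<forall>q<n. \<forall>u<k. \<forall>v<k.
           B \<omega> $$ (p * k + u, q * k + v) = b (int q - int p) \<omega> $$ (u, v)"
    and ind: "prob_space.indep_vars M (\<lambda>_. borel) (\<lambda>(r, u, v) \<omega>. b r \<omega> $$ (u, v)) (kBCE_free_entries k n)"
    and law0: "\<forall>(r, u, v)\<in>kBCE_free_entries k n. distr M borel (\<lambda>\<omega>. b r \<omega> $$ (u, v)) = \<mu>"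
    using bce unfolding is_kBCE_def n by (elim conjE exE) (rule that)
  have b: "b r \<omega> \<in> carrier_mat k k" "b (r + int n) \<omega> = b r \<omega>"
    "b (- r) \<omega> = transpose_mat (b r \<omega>)" if "\<omega> \<in> space M" for \<omega> r
    using b0 that by simp_all
  have B: "B \<omega> $$ (p * k + u, q * k + v) = b (int q - int p) \<omega> $$ (u, v)"
    if "\<omega> \<in> space M" "p < n" "q < n" "u < k" "v < k" for \<omega> p q u v
    using B0 that by simp
  have law: "distr M borel (\<lambda>\<omega>. b r \<omega> $$ (u, v)) = \<mu>" if "(r, u, v) \<in> kBCE_free_entries k n" for r u v
    using law0 that by (auto dest!: bspec)
  have adm: "admissible_entry_law \<mu>" using bce by (simp add: is_kBCE_def)
  have per: "b r \<omega> = b s \<omega>" if \<omega>: "\<omega> \<in> space M" and "[r = s] (mod int n)" for r s \<omega>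
  proof -
    have add: "b (r + int n * int l) \<omega> = b r \<omega>" for r l
    proof (induction l)
      case (Suc l)
      have "b (r + int n * int (Suc l)) \<omega> = b (r + int n * int l + int n) \<omega>"
        by (simp add: algebra_simps)
      then show ?case using Suc b(2)[OF \<omega>] by simp
    qed simp
    obtain l where "s = r + int n * l"
      using \<open>[r = s] (mod int n)\<close> by (auto simp: cong_iff_lin)
    then show ?thesis
    proof (cases l)
      case (nonneg l')
      then show ?thesis using add[of r l'] \<open>s = _\<close> by simp
    next
      case (neg l')
      then have "l = - int (Suc l')" by simp
      then have "r = s + int n * int (Suc l')" using \<open>s = _\<close> by (simp only: algebra_simps)
      then show ?thesis using add[of s "Suc l'"] by simp
    qed
  qed
  have tr: "b (- r) \<omega> $$ (u, v) = b r \<omega> $$ (v, u)"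
    if "\<omega> \<in> space M" "u < k" "v < k" for \<omega> r u v
    using b(1)[OF that(1), of r] b(3)[OF that(1), of r] that by auto
  show ?thesis
  proof (rule wickI[where X = "\<lambda>(r, u, v) \<omega>. b r \<omega> $$ (u, v)" and E = "kBCE_free_entries k n"
        and law = "\<lambda>_. \<mu>" and \<kappa> = "kBCE_key k n"])
    show "distr M borel ((\<lambda>(r, u, v) \<omega>. b r \<omega> $$ (u, v)) e) = \<mu>" if "e \<in> kBCE_free_entries k n" for e
      using that law by (cases e) auto
    show "centred_law \<mu>" "centred_law \<mu>" using adm by (simp_all add: admissible_imp_centred)
    show "kBCE_key k n x \<in> kBCE_free_entries k n" for x
      using assms by (intro kBCE_key_in)
    show "B \<omega> $$ x = (\<lambda>(r, u, v) \<omega>. b r \<omega> $$ (u, v)) (kBCE_key k n x) \<omega>"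
      if x: "x \<in> {..<k * n} \<times> {..<k * n}" and \<omega>: "\<omega> \<in> space M" for x \<omega>
    proof -
      have lt: "fst x div k < n" "snd x div k < n" "fst x mod k < k" "snd x mod k < k"
        using x \<open>0 < k\<close> by (auto intro: div_less_blocks)
      have "B \<omega> $$ (fst x div k * k + fst x mod k, snd x div k * k + snd x mod k) =
          b (bdiff k x) \<omega> $$ (fst x mod k, snd x mod k)"
        using B[OF \<omega> lt] by (simp add: bdiff_def)
      then have Bx: "B \<omega> $$ x = b (bdiff k x) \<omega> $$ (fst x mod k, snd x mod k)" by simp
      obtain r u v where key: "kBCE_key k n x = (r, u, v)"
        and or: "([bdiff k x = r] (mod int n) \<and> fst x mod k = u \<and> snd x mod k = v) \<or>
         ([bdiff k x = - r] (mod int n) \<and> fst x mod k = v \<and> snd x mod k = u)"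
        using kBCE_key_cases[OF \<open>0 < n\<close>] .
      from or have "B \<omega> $$ x = b r \<omega> $$ (u, v)"
      proof
        assume "[bdiff k x = r] (mod int n) \<and> fst x mod k = u \<and> snd x mod k = v"
        then show ?thesis using per[OF \<omega>] Bx by metis
      next
        assume *: "[bdiff k x = - r] (mod int n) \<and> fst x mod k = v \<and> snd x mod k = u"
        then have "B \<omega> $$ x = b (- r) \<omega> $$ (v, u)" using per[OF \<omega>] Bx by metis
        then show ?thesis using tr[OF \<omega>] * lt by auto
      qed
      then show ?thesis by (simp add: key)
    qed
    show "opp_block k n x y \<or> opp_block k n x (prod.swap y)" if eq: "kBCE_key k n x = kBCE_key k n y" for x y
    proof -
      obtain r u v where key: "kBCE_key k n x = (r, u, v)"
        and or: "([bdiff k x = r] (mod int n) \<and> fst x mod k = u \<and> snd x mod k = v) \<or>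
         ([bdiff k x = - r] (mod int n) \<and> fst x mod k = v \<and> snd x mod k = u)"
        using kBCE_key_cases[OF \<open>0 < n\<close>] .
      have ory: "([bdiff k y = r] (mod int n) \<and> fst y mod k = u \<and> snd y mod k = v) \<or>
         ([bdiff k y = - r] (mod int n) \<and> fst y mod k = v \<and> snd y mod k = u)"
        using kBCE_key_cases[OF \<open>0 < n\<close>, of k y] key eq by (metis prod.inject)
      have sw: "bdiff k (prod.swap y) = - bdiff k y" by (simp add: bdiff_def)
      have 1: "[b = - a] (mod int n)" if "[a = r] (mod int n)" "[b = - r] (mod int n)" for a b
        using that by (meson cong_minus_minus_iff cong_sym cong_trans)
      have 2: "[b = - a] (mod int n)" if "[a = - r] (mod int n)" "[b = r] (mod int n)" for a b
        using that by (metis cong_minus_minus_iff cong_sym cong_trans minus_minus)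
      have 3: "[- b = - a] (mod int n)" if "[a = c] (mod int n)" "[b = c] (mod int n)" for a b c
        using that by (meson cong_minus_minus_iff cong_sym cong_trans)
      from or ory show ?thesis
      proof (elim disjE conjE)
        assume "[bdiff k x = r] (mod int n)" "[bdiff k y = r] (mod int n)"
          "fst x mod k = u" "snd x mod k = v" "fst y mod k = u" "snd y mod k = v"
        then show ?thesis using 3 by (simp add: opp_block_def sw)
      next
        assume "[bdiff k x = r] (mod int n)" "[bdiff k y = - r] (mod int n)"
          "fst x mod k = u" "snd x mod k = v" "fst y mod k = v" "snd y mod k = u"
        then show ?thesis using 1 by (simp add: opp_block_def)
      next
        assume "[bdiff k x = - r] (mod int n)" "[bdiff k y = r] (mod int n)"
          "fst x mod k = v" "snd x mod k = u" "fst y mod k = u" "snd y mod k = v"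
        then show ?thesis using 2 by (simp add: opp_block_def)
      next
        assume "[bdiff k x = - r] (mod int n)" "[bdiff k y = - r] (mod int n)"
          "fst x mod k = v" "snd x mod k = u" "fst y mod k = v" "snd y mod k = u"
        then show ?thesis using 3 by (simp add: opp_block_def sw)
      qed
    qed
    show "kBCE_key k n x = kBCE_key k n y" if "opp_block k n x y" for x y
      using that \<open>0 < n\<close> by (rule kBCE_key_opp[rotated])
    show "prob_space M" by fact
    show "(\<integral>y. y ^ 2 \<partial>\<mu>) = 1" by (rule admissible_variance[OF adm])
    show "prob_space.indep_vars M (\<lambda>_. borel) (\<lambda>(r, u, v) \<omega>. b r \<omega> $$ (u, v)) (kBCE_free_entries k n)"
      by (rule ind)
  qed simp
qed

section \<open>Expansion of the trace into closed walks\<close>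

text \<open>
  The product \<open>Ms 1 * \<dots> * Ms l\<close> of \<open>N \<times> N\<close> matrices.
\<close>

primrec mat_chain :: "nat \<Rightarrow> (nat \<Rightarrow> real mat) \<Rightarrow> nat \<Rightarrow> real mat" where
  "mat_chain N Ms 0 = 1\<^sub>m N"
| "mat_chain N Ms (Suc l) = mat_chain N Ms l * Ms (Suc l)"

lemma mat_chain_carrier:
  "(\<And>s. s \<in> {1..l} \<Longrightarrow> Ms s \<in> carrier_mat N N) \<Longrightarrow> mat_chain N Ms l \<in> carrier_mat N N"
proof (induction l)
  case (Suc l)
  have "mat_chain N Ms l \<in> carrier_mat N N" using Suc by auto
  moreover have "Ms (Suc l) \<in> carrier_mat N N" using Suc by auto
  ultimately show ?case by simp
qed simp

lemma mat_chain_cong: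
  "(\<And>s. s \<in> {1..l} \<Longrightarrow> Ms s = Ms' s) \<Longrightarrow> mat_chain N Ms l = mat_chain N Ms' l"
  by (induction l) auto

lemma mult_mat_entry:
  assumes "A \<in> carrier_mat N N" "B \<in> carrier_mat N N" "x < N" "y < N"
  shows "(A * B :: real mat) $$ (x, y) = (\<Sum>w<N. A $$ (x, w) * B $$ (w, y))"
  using assms by (auto simp: scalar_prod_def lessThan_atLeast0 intro!: sum.cong)

lemma mat_chain_entry:
  assumes "1 \<le> L" "\<And>s. s \<in> {1..L} \<Longrightarrow> Ms s \<in> carrier_mat N N" "x < N" "y < N"
  shows "mat_chain N Ms L $$ (x, y) =
    (\<Sum>f\<in>{f \<in> walks L N. f 1 = x}. \<Prod>s\<in>{1..L}. Ms s $$ (f s, if s = L then y else f (Suc s)))"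
  using assms
proof (induction L arbitrary: y rule: dec_induct)
  case base
  have "{f \<in> walks 1 N. f 1 = x} = {\<lambda>s\<in>{1}. x}"
  proof (intro equalityI subsetI)
    fix f assume "f \<in> {f \<in> walks 1 N. f 1 = x}"
    then have "f \<in> {1} \<rightarrow>\<^sub>E {..<N}" "f 1 = x" by (auto simp: walks_def)
    then have "f = (\<lambda>s\<in>{1}. x)" by (intro ext) (auto simp: PiE_iff extensional_def)
    then show "f \<in> {\<lambda>s\<in>{1}. x}" by simp
  qed (use base in \<open>auto simp: walks_def\<close>)
  moreover have "mat_chain N Ms 1 = Ms 1" using base by simp
  ultimately show ?case by simp
next
  case (step L)
  let ?W = "\<lambda>L. {f \<in> walks L N. f 1 = x}"
  let ?h = "\<lambda>L y f. \<Prod>s\<in>{1..L}. Ms s $$ (f s, if s = L then y else f (Suc s))"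
  have "mat_chain N Ms (Suc L) $$ (x, y) = (\<Sum>w<N. mat_chain N Ms L $$ (x, w) * Ms (Suc L) $$ (w, y))"
    using step mat_chain_carrier[of L Ms N] by (simp add: mult_mat_entry)
  also have "\<dots> = (\<Sum>w<N. \<Sum>f\<in>?W L. ?h L w f * Ms (Suc L) $$ (w, y))"
    using step by (simp add: sum_distrib_right)
  also have "\<dots> = (\<Sum>(w, f)\<in>{..<N} \<times> ?W L. ?h L w f * Ms (Suc L) $$ (w, y))"
    by (rule sum.cartesian_product)
  also have "\<dots> = (\<Sum>f\<in>?W (Suc L). ?h (Suc L) y f)"
  proof (rule sum.reindex_bij_witness[where j = "\<lambda>(w, f). f(Suc L := w)"
        and i = "\<lambda>f. (f (Suc L), f(Suc L := undefined))"])
    fix a assume a: "a \<in> {..<N} \<times> ?W L"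
    obtain w f where wf: "a = (w, f)" by (cases a)
    have f: "f \<in> walks L N" "f 1 = x" "w < N" using a wf by auto
    have und: "f (Suc L) = undefined" using f(1) by (auto simp: walks_def PiE_iff extensional_def)
    show "(case case a of (w, f) \<Rightarrow> f(Suc L := w) of f \<Rightarrow> (f (Suc L), f(Suc L := undefined))) = a"
      using und by (auto simp: wf fun_eq_iff)
    show "(case a of (w, f) \<Rightarrow> f(Suc L := w)) \<in> ?W (Suc L)"
      using f \<open>1 \<le> L\<close> by (auto simp: wf walks_def PiE_iff extensional_def)
    have "?h (Suc L) y (f(Suc L := w)) = ?h L w f * Ms (Suc L) $$ (w, y)"
    proof -
      have "{1..Suc L} = insert (Suc L) {1..L}" by auto
      then have "?h (Suc L) y (f(Suc L := w)) =
        Ms (Suc L) $$ (w, y) * (\<Prod>s\<in>{1..L}. Ms s $$ ((f(Suc L := w)) s, (f(Suc L := w)) (Suc s)))"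
        by (auto intro!: prod.cong)
      also have "(\<Prod>s\<in>{1..L}. Ms s $$ ((f(Suc L := w)) s, (f(Suc L := w)) (Suc s))) = ?h L w f"
        by (intro prod.cong) auto
      finally show ?thesis by (simp add: mult.commute)
    qed
    then show "?h (Suc L) y (case a of (w, f) \<Rightarrow> f(Suc L := w)) =
        (case a of (w, f) \<Rightarrow> ?h L w f * Ms (Suc L) $$ (w, y))" by (simp add: wf)
  next
    fix f assume f: "f \<in> ?W (Suc L)"
    show "(case (f (Suc L), f(Suc L := undefined)) of (w, f) \<Rightarrow> f(Suc L := w)) = f"
      by simp
    show "(f (Suc L), f(Suc L := undefined)) \<in> {..<N} \<times> ?W L"
      using f \<open>1 \<le> L\<close> by (auto simp: walks_def PiE_iff extensional_def)
  qed
  finally show ?case .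
qed

lemma mat_trace_chain:
  assumes "1 \<le> L" "\<And>s. s \<in> {1..L} \<Longrightarrow> Ms s \<in> carrier_mat N N"
  shows "mat_trace (mat_chain N Ms L) = (\<Sum>f\<in>walks L N. \<Prod>s\<in>{1..L}. Ms s $$ edge L f s)"
proof -
  have "mat_trace (mat_chain N Ms L) = (\<Sum>x<N. mat_chain N Ms L $$ (x, x))"
    using mat_chain_carrier[of L Ms N] assms by (simp add: mat_trace_def)
  also have "\<dots> = (\<Sum>x<N. \<Sum>f\<in>{f \<in> walks L N. f 1 = x}. \<Prod>s\<in>{1..L}. Ms s $$ edge L f s)"
  proof (intro sum.cong refl)
    fix x assume "x \<in> {..<N}"
    then have "mat_chain N Ms L $$ (x, x) =
        (\<Sum>f\<in>{f \<in> walks L N. f 1 = x}. \<Prod>s\<in>{1..L}. Ms s $$ (f s, if s = L then x else f (Suc s)))"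
      using assms by (intro mat_chain_entry) auto
    also have "\<dots> = (\<Sum>f\<in>{f \<in> walks L N. f 1 = x}. \<Prod>s\<in>{1..L}. Ms s $$ edge L f s)"
      by (intro sum.cong prod.cong refl) (auto simp: edge_def cnext_def)
    finally show "mat_chain N Ms L $$ (x, x) =
        (\<Sum>f\<in>{f \<in> walks L N. f 1 = x}. \<Prod>s\<in>{1..L}. Ms s $$ edge L f s)" .
  qed
  also have "\<dots> = (\<Sum>f\<in>walks L N. \<Prod>s\<in>{1..L}. Ms s $$ edge L f s)"
    using assms(1) by (intro sum.group) (auto intro: walks_less)
  finally show ?thesis .
qed

text \<open>
  Words of \<open>2 j\<close> letters that carry \<open>ab\<close> or \<open>ba\<close> at positions \<open>2 s - 1\<close>, \<open>2 s\<close> for each \<open>s\<close>.  The number \<open>j\<close> of pairs is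
  arbitrary here, so that induction on the exponent is possible.
\<close>

definition words :: "nat \<Rightarrow> (nat \<Rightarrow> letter) set" where
  "words j = {C \<in> {1..2 * j} \<rightarrow>\<^sub>E UNIV. \<forall>s\<in>{1..j}. (C (2 * s - 1), C (2 * s)) \<in> {(La, Lb), (Lb, La)}}"

lemma configs_words: "configs m = words (2 * m)"
  by (simp add: configs_def words_def)

lemma UNIV_letter: "(UNIV :: letter set) = {La, Lb}"
  using letter.exhaust by auto

lemma finite_words [simp]: "finite (words j)"
  by (rule finite_subset[of _ "{1..2 * j} \<rightarrow>\<^sub>E UNIV"]) (auto simp: words_def UNIV_letter intro!: finite_PiE)

text \<open>
  The letter different from the given one.
\<close>

definition other :: "letter \<Rightarrow> letter" where
  "other l = (case l of La \<Rightarrow> Lb | Lb \<Rightarrow> La)"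

lemma sum_words_Suc:
  "(\<Sum>C\<in>words (Suc j). F C) =
    (\<Sum>C\<in>words j. \<Sum>l\<in>UNIV. F (C(2 * j + 1 := l, 2 * j + 2 := other l)))"
proof -
  have "(\<Sum>C\<in>words j. \<Sum>l\<in>UNIV. F (C(2 * j + 1 := l, 2 * j + 2 := other l))) =
     (\<Sum>(C, l)\<in>words j \<times> UNIV. F (C(2 * j + 1 := l, 2 * j + 2 := other l)))"
    by (rule sum.cartesian_product)
  also have "\<dots> = (\<Sum>C\<in>words (Suc j). F C)"
  proof (rule sum.reindex_bij_witness[where
        j = "\<lambda>(C, l). C(2 * j + 1 := l, 2 * j + 2 := other l)"
        and i = "\<lambda>C. (C(2 * j + 1 := undefined, 2 * j + 2 := undefined), C (2 * j + 1))"])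
    fix a :: "(nat \<Rightarrow> letter) \<times> letter" assume a: "a \<in> words j \<times> UNIV"
    obtain C l where Cl: "a = (C, l)" by (cases a)
    have C: "C \<in> words j" using a Cl by auto
    have und: "C (2 * j + 1) = undefined" "C (2 * j + 2) = undefined"
      using C by (auto simp: words_def PiE_iff extensional_def)
    show "(case case a of (C, l) \<Rightarrow> C(2 * j + 1 := l, 2 * j + 2 := other l) of
        C \<Rightarrow> (C(2 * j + 1 := undefined, 2 * j + 2 := undefined), C (2 * j + 1))) = a"
      using und by (auto simp: Cl fun_eq_iff)
    show "(case a of (C, l) \<Rightarrow> C(2 * j + 1 := l, 2 * j + 2 := other l)) \<in> words (Suc j)"
    proof -
      let ?D = "C(2 * j + 1 := l, 2 * j + 2 := other l)"
      have "(?D (2 * s - 1), ?D (2 * s)) \<in> {(La, Lb), (Lb, La)}" if "s \<in> {1..Suc j}" for s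
      proof (cases "s = Suc j")
        case True
        then show ?thesis by (auto simp: other_def split: letter.splits)
      next
        case False
        then have s: "s \<in> {1..j}" using that by auto
        then have "2 * s - 1 \<noteq> 2 * j + 1" "2 * s - 1 \<noteq> 2 * j + 2" "2 * s \<noteq> 2 * j + 1" "2 * s \<noteq> 2 * j + 2"
          by auto
        then have "?D (2 * s - 1) = C (2 * s - 1)" "?D (2 * s) = C (2 * s)" by simp_all
        then show ?thesis using C s unfolding words_def by simp
      qed
      moreover have "?D \<in> {1..2 * Suc j} \<rightarrow>\<^sub>E UNIV"
        using C by (auto simp: words_def PiE_iff extensional_def)
      ultimately show ?thesis unfolding Cl words_def by simp
    qed
    show "F (case a of (C, l) \<Rightarrow> C(2 * j + 1 := l, 2 * j + 2 := other l)) =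
      (case a of (C, l) \<Rightarrow> F (C(2 * j + 1 := l, 2 * j + 2 := other l)))"
      by (simp add: Cl)
  next
    fix C assume C: "C \<in> words (Suc j)"
    have "(C (2 * Suc j - 1), C (2 * Suc j)) \<in> {(La, Lb), (Lb, La)}"
      using C unfolding words_def mem_Collect_eq by (elim conjE bspec) simp
    then have "C (2 * j + 2) = other (C (2 * j + 1))" by (auto simp: other_def)
    then show "(case (C(2 * j + 1 := undefined, 2 * j + 2 := undefined), C (2 * j + 1)) of
        (C, l) \<Rightarrow> C(2 * j + 1 := l, 2 * j + 2 := other l)) = C"
      by (auto simp: fun_eq_iff)
    show "(C(2 * j + 1 := undefined, 2 * j + 2 := undefined), C (2 * j + 1)) \<in> words j \<times> UNIV"
      using C by (auto simp: words_def PiE_iff extensional_def)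
  qed
  finally show ?thesis by simp
qed

lemma anticommutator_power_entry:
  assumes A: "A \<in> carrier_mat N N" and B: "B \<in> carrier_mat N N" and "x < N" "y < N"
  shows "(anticommutator A B ^\<^sub>m j) $$ (x, y) =
    (\<Sum>C\<in>words j. mat_chain N (\<lambda>s. case_letter A B (C s)) (2 * j) $$ (x, y))"
  using \<open>y < N\<close>
proof (induction j arbitrary: y)
  case 0
  have "words 0 = {\<lambda>_. undefined}" by (auto simp: words_def)
  then show ?case using A B by (simp add: anticommutator_def)
next
  case (Suc j)
  let ?X = "anticommutator A B" and ?c = "case_letter A B"
  have c: "?c l \<in> carrier_mat N N" for l using A B by (cases l) auto
  have X: "?X \<in> carrier_mat N N" using A B by (simp add: anticommutator_def)
  have ent: "?X $$ (w, y) = (\<Sum>l\<in>UNIV. (?c l * ?c (other l)) $$ (w, y))" if "w < N" for w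
    using A B that Suc.prems by (simp add: UNIV_letter anticommutator_def other_def)
  have ch: "mat_chain N (\<lambda>s. ?c ((C(2 * j + 1 := l, 2 * j + 2 := other l)) s)) (2 * Suc j) $$ (x, y) =
      (\<Sum>w<N. mat_chain N (\<lambda>s. ?c (C s)) (2 * j) $$ (x, w) * (?c l * ?c (other l)) $$ (w, y))" for C l
  proof -
    let ?M = "mat_chain N (\<lambda>s. ?c (C s)) (2 * j)"
    have M: "?M \<in> carrier_mat N N" by (intro mat_chain_carrier c)
    have "mat_chain N (\<lambda>s. ?c ((C(2 * j + 1 := l, 2 * j + 2 := other l)) s)) (2 * j) = ?M"
      by (intro mat_chain_cong) auto
    then have "mat_chain N (\<lambda>s. ?c ((C(2 * j + 1 := l, 2 * j + 2 := other l)) s)) (2 * Suc j) =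
        ?M * ?c l * ?c (other l)"
      by simp
    also have "\<dots> = ?M * (?c l * ?c (other l))"
      using M c by (intro assoc_mult_mat)
    finally show ?thesis
      using mult_mat_entry[OF M mult_carrier_mat[OF c[of l] c[of "other l"]] \<open>x < N\<close> Suc.prems]
      by (simp only:)
  qed
  have "(?X ^\<^sub>m Suc j) $$ (x, y) = (\<Sum>w<N. (?X ^\<^sub>m j) $$ (x, w) * ?X $$ (w, y))"
    using mult_mat_entry[OF pow_carrier_mat[OF X] X \<open>x < N\<close> Suc.prems] by simp
  also have "\<dots> = (\<Sum>w<N. \<Sum>C\<in>words j. \<Sum>l\<in>UNIV.
      mat_chain N (\<lambda>s. ?c (C s)) (2 * j) $$ (x, w) * (?c l * ?c (other l)) $$ (w, y))"
  proof (intro sum.cong refl)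
    fix w assume "w \<in> {..<N}"
    then have w: "w < N" by simp
    show "(?X ^\<^sub>m j) $$ (x, w) * ?X $$ (w, y) = (\<Sum>C\<in>words j. \<Sum>l\<in>UNIV.
        mat_chain N (\<lambda>s. ?c (C s)) (2 * j) $$ (x, w) * (?c l * ?c (other l)) $$ (w, y))"
      unfolding Suc.IH[OF w] ent[OF w] by (rule sum_product)
  qed
  also have "\<dots> = (\<Sum>C\<in>words j. \<Sum>l\<in>UNIV. \<Sum>w<N.
      mat_chain N (\<lambda>s. ?c (C s)) (2 * j) $$ (x, w) * (?c l * ?c (other l)) $$ (w, y))"
    by (subst sum.swap, intro sum.cong refl sum.swap)
  also have "\<dots> = (\<Sum>C\<in>words (Suc j). mat_chain N (\<lambda>s. ?c (C s)) (2 * Suc j) $$ (x, y))"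
    unfolding sum_words_Suc ch ..
  finally show ?case .
qed

lemma trace_anticommutator_power:
  assumes A: "A \<in> carrier_mat N N" and B: "B \<in> carrier_mat N N" and "1 \<le> j"
  shows "mat_trace (anticommutator A B ^\<^sub>m j) =
    (\<Sum>C\<in>words j. \<Sum>f\<in>walks (2 * j) N. \<Prod>s\<in>{1..2 * j}. case_letter A B (C s) $$ edge (2 * j) f s)"
proof -
  have X: "anticommutator A B \<in> carrier_mat N N" using A B by (simp add: anticommutator_def)
  have c: "case_letter A B l \<in> carrier_mat N N" for l using A B by (cases l) auto
  have "mat_trace (anticommutator A B ^\<^sub>m j) =
    (\<Sum>x<N. \<Sum>C\<in>words j. mat_chain N (\<lambda>s. case_letter A B (C s)) (2 * j) $$ (x, x))"
    using X A B by (simp add: mat_trace_def anticommutator_power_entry)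
  also have "\<dots> = (\<Sum>C\<in>words j. \<Sum>x<N. mat_chain N (\<lambda>s. case_letter A B (C s)) (2 * j) $$ (x, x))"
    by (rule sum.swap)
  also have "\<dots> = (\<Sum>C\<in>words j. mat_trace (mat_chain N (\<lambda>s. case_letter A B (C s)) (2 * j)))"
  proof (intro sum.cong refl)
    fix C
    have "mat_chain N (\<lambda>s. case_letter A B (C s)) (2 * j) \<in> carrier_mat N N"
      by (intro mat_chain_carrier c)
    then show "(\<Sum>x<N. mat_chain N (\<lambda>s. case_letter A B (C s)) (2 * j) $$ (x, x)) =
        mat_trace (mat_chain N (\<lambda>s. case_letter A B (C s)) (2 * j))"
      by (simp add: mat_trace_def)
  qed
  also have "\<dots> = (\<Sum>C\<in>words j. \<Sum>f\<in>walks (2 * j) N. \<Prod>s\<in>{1..2 * j}. case_letter A B (C s) $$ edge (2 * j) f s)"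
    using \<open>1 \<le> j\<close> c by (intro sum.cong refl mat_trace_chain) auto
  finally show ?thesis .
qed

text \<open>
  The expectation of the product of the entries of \<open>A\<close> at the index pairs \<open>f s\<close>, \<open>s \<in> S\<close>.
\<close>

definition walk_moment :: "'w measure \<Rightarrow> ('w \<Rightarrow> real mat) \<Rightarrow> nat set \<Rightarrow> (nat \<Rightarrow> nat \<times> nat) \<Rightarrow> real" where
  "walk_moment M A S f = (\<integral>\<omega>. (\<Prod>s\<in>S. A \<omega> $$ f s) \<partial>M)"

text \<open>
  The positions of the word \<open>C\<close> that carry the letter \<open>l\<close>.
\<close>

definition positions :: "nat \<Rightarrow> (nat \<Rightarrow> letter) \<Rightarrow> letter \<Rightarrow> nat set" where
  "positions L C l = {s\<in>{1..L}. C s = l}"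

lemma expectation_walk:
  assumes "prob_space M" and ind: "indep_matrices M N A B"
    and f: "\<And>s. s \<in> {1..L} \<Longrightarrow> f s \<in> {..<N} \<times> {..<N}"
    and int: "integrable M (\<lambda>\<omega>. \<Prod>s\<in>positions L C La. A \<omega> $$ f s)"
      "integrable M (\<lambda>\<omega>. \<Prod>s\<in>positions L C Lb. B \<omega> $$ f s)"
  shows "integrable M (\<lambda>\<omega>. \<Prod>s\<in>{1..L}. case_letter (A \<omega>) (B \<omega>) (C s) $$ f s)"
    and "(\<integral>\<omega>. (\<Prod>s\<in>{1..L}. case_letter (A \<omega>) (B \<omega>) (C s) $$ f s) \<partial>M) =
      walk_moment M A (positions L C La) f * walk_moment M B (positions L C Lb) f"
proof -
  interpret prob_space M by fact
  let ?P = "Pi\<^sub>M ({..<N} \<times> {..<N}) (\<lambda>_. borel :: real measure)"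
  define g where "g l x = (\<Prod>s\<in>positions L C l. x (f s))" for l and x :: "nat \<times> nat \<Rightarrow> real"
  have meas: "g l \<in> borel_measurable ?P" for l
    unfolding g_def using f by (intro borel_measurable_prod measurable_component_singleton) (auto simp: positions_def)
  have split: "(\<Prod>s\<in>{1..L}. case_letter (A \<omega>) (B \<omega>) (C s) $$ f s) =
      (\<Prod>s\<in>positions L C La. A \<omega> $$ f s) * (\<Prod>s\<in>positions L C Lb. B \<omega> $$ f s)" for \<omega>
  proof -
    have "C s = La \<or> C s = Lb" for s by (cases "C s") auto
    then have "{1..L} = positions L C La \<union> positions L C Lb"
      by (auto simp: positions_def)
    moreover have "positions L C La \<inter> positions L C Lb = {}" by (auto simp: positions_def)
    moreover have "finite (positions L C l)" for l by (simp add: positions_def)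
    ultimately have "(\<Prod>s\<in>{1..L}. case_letter (A \<omega>) (B \<omega>) (C s) $$ f s) =
      (\<Prod>s\<in>positions L C La. case_letter (A \<omega>) (B \<omega>) (C s) $$ f s) *
      (\<Prod>s\<in>positions L C Lb. case_letter (A \<omega>) (B \<omega>) (C s) $$ f s)"
      by (simp add: prod.union_disjoint)
    then show ?thesis by (simp add: positions_def)
  qed
  have gA: "g l (mat_entries N X) = (\<Prod>s\<in>positions L C l. X $$ f s)" for l X
    unfolding g_def mat_entries_def using f by (intro prod.cong refl) (auto simp: positions_def)
  have iv: "indep_var borel (\<lambda>\<omega>. \<Prod>s\<in>positions L C La. A \<omega> $$ f s)
      borel (\<lambda>\<omega>. \<Prod>s\<in>positions L C Lb. B \<omega> $$ f s)"
    using indep_var_compose[OF ind[unfolded indep_matrices_def] meas[of La] meas[of Lb]]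
    by (simp add: comp_def gA)
  show "integrable M (\<lambda>\<omega>. \<Prod>s\<in>{1..L}. case_letter (A \<omega>) (B \<omega>) (C s) $$ f s)"
    unfolding split by (rule indep_var_integrable[OF iv int])
  show "(\<integral>\<omega>. (\<Prod>s\<in>{1..L}. case_letter (A \<omega>) (B \<omega>) (C s) $$ f s) \<partial>M) =
      walk_moment M A (positions L C La) f * walk_moment M B (positions L C Lb) f"
    unfolding split walk_moment_def by (rule indep_var_lebesgue_integral[OF iv int])
qed

section \<open>Pairings, matchings and cycles\<close>

text \<open>
  Fixed-point-free involutions of \<open>{1..L}\<close>.  These are the pairings of \<open>{1..L}\<close>, regarded as
  permutations; values outside \<open>{1..L}\<close> are irrelevant.
\<close>

definition matching :: "nat \<Rightarrow> (nat \<Rightarrow> nat) \<Rightarrow> bool" where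
  "matching L \<tau> \<longleftrightarrow> (\<forall>s\<in>{1..L}. \<tau> s \<in> {1..L} \<and> \<tau> s \<noteq> s \<and> \<tau> (\<tau> s) = s)"

lemma matchingD:
  assumes "matching L \<tau>" "s \<in> {1..L}"
  shows "\<tau> s \<in> {1..L}" "\<tau> s \<noteq> s" "\<tau> (\<tau> s) = s"
  using bspec[OF assms(1)[unfolded matching_def] assms(2)] by simp_all

lemma pairing_disjoint:
  assumes "P \<in> pairings L" "V \<in> P" "W \<in> P" "x \<in> V" "x \<in> W"
  shows "V = W"
proof (rule ccontr)
  assume "V \<noteq> W"
  have "disjoint P" using assms(1) by (simp add: pairings_def partition_on_def)
  then have "V \<inter> W = {}" using assms(2,3) \<open>V \<noteq> W\<close> by (rule disjointD)
  then show False using assms(4,5) by blast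
qed

lemma pairing_block:
  assumes P: "P \<in> pairings L" and s: "s \<in> {1..L}"
  obtains t where "t \<noteq> s" "t \<in> {1..L}" "{s, t} \<in> P" "pairing_perm P s = t"
proof -
  have part: "partition_on {1..L} P" and two: "\<And>V. V \<in> P \<Longrightarrow> card V = 2"
    using P by (auto simp: pairings_def)
  obtain V where V: "V \<in> P" "s \<in> V" using part s unfolding partition_on_def by blast
  obtain t where t: "V = {s, t}" "t \<noteq> s" using two[OF V(1)] V(2) unfolding card_2_iff by blast
  have uniq: "j = t" if "j \<noteq> s \<and> {s, j} \<in> P" for j
  proof -
    have "{s, j} = V"
      using that V by (intro pairing_disjoint[OF P, of _ _ s]) auto
    then show ?thesis using t that by (auto simp: doubleton_eq_iff)
  qed
  have ex: "t \<noteq> s \<and> {s, t} \<in> P" using t V by simp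
  then have "(THE j. j \<noteq> s \<and> {s, j} \<in> P) = t" using uniq by (rule the_equality)
  then have "pairing_perm P s = t" unfolding pairing_perm_def using ex by auto
  moreover have "t \<in> {1..L}" using part V t unfolding partition_on_def by blast
  ultimately show ?thesis using ex that by blast
qed

lemma pairing_perm_eq:
  assumes P: "P \<in> pairings L" and st: "{s, t} \<in> P" "t \<noteq> s"
  shows "pairing_perm P s = t"
proof -
  have "s \<in> {1..L}" using P st unfolding pairings_def partition_on_def by blast
  then obtain t' where t': "t' \<noteq> s" "{s, t'} \<in> P" "pairing_perm P s = t'"
    using pairing_block[OF P] by blast
  have "{s, t} = {s, t'}"
    using st t' by (intro pairing_disjoint[OF P, of _ _ s]) auto
  then show ?thesis using t' by (auto simp: doubleton_eq_iff)
qed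

lemma matching_pairing_perm:
  assumes P: "P \<in> pairings L"
  shows "matching L (pairing_perm P)"
  unfolding matching_def
proof
  fix s assume s: "s \<in> {1..L}"
  obtain t where t: "t \<noteq> s" "t \<in> {1..L}" "{s, t} \<in> P" "pairing_perm P s = t"
    using pairing_block[OF P s] .
  have "pairing_perm P t = s"
    using t by (intro pairing_perm_eq[OF P]) (auto simp: insert_commute)
  then show "pairing_perm P s \<in> {1..L} \<and> pairing_perm P s \<noteq> s \<and> pairing_perm P (pairing_perm P s) = s"
    using t by simp
qed

lemma pairing_perm_block: "P \<in> pairings L \<Longrightarrow> s \<in> {1..L} \<Longrightarrow> {s, pairing_perm P s} \<in> P"
  using pairing_block by metis

lemma pairing_block_eq:
  assumes P: "P \<in> pairings L" and V: "V \<in> P" "s \<in> V"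
  shows "V = {s, pairing_perm P s}" "s \<in> {1..L}"
proof -
  show s: "s \<in> {1..L}" using P V unfolding pairings_def partition_on_def by blast
  have "{s, pairing_perm P s} \<in> P" using P s by (rule pairing_perm_block)
  then show "V = {s, pairing_perm P s}"
    using V by (intro pairing_disjoint[OF P, of _ _ s]) auto
qed

lemma pairing_eq_image:
  assumes P: "P \<in> pairings L"
  shows "P = (\<lambda>s. {s, pairing_perm P s}) ` {1..L}"
proof (intro equalityI subsetI)
  fix V assume V: "V \<in> P"
  then have "card V = 2" using P by (simp add: pairings_def)
  then obtain s where "s \<in> V" by fastforce
  then show "V \<in> (\<lambda>s. {s, pairing_perm P s}) ` {1..L}"
    using pairing_block_eq[OF P V] by blast
next
  fix V assume "V \<in> (\<lambda>s. {s, pairing_perm P s}) ` {1..L}"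
  then show "V \<in> P" using pairing_perm_block[OF P] by blast
qed

lemma pairing_eqI:
  assumes P: "P \<in> pairings L" and Q: "Q \<in> pairings L"
    and eq: "\<And>s. s \<in> {1..L} \<Longrightarrow> pairing_perm P s = pairing_perm Q s"
  shows "P = Q"
proof -
  have "P = (\<lambda>s. {s, pairing_perm P s}) ` {1..L}" by (rule pairing_eq_image[OF P])
  also have "\<dots> = (\<lambda>s. {s, pairing_perm Q s}) ` {1..L}" using eq by (intro image_cong refl) simp
  also have "\<dots> = Q" by (rule pairing_eq_image[OF Q, symmetric])
  finally show ?thesis .
qed

lemma pairing_of_matching:
  assumes \<tau>: "matching L \<tau>"
  defines "P \<equiv> (\<lambda>s. {s, \<tau> s}) ` {1..L}"
  shows "P \<in> pairings L" "\<And>s. s \<in> {1..L} \<Longrightarrow> pairing_perm P s = \<tau> s"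
proof -
  note m = matchingD[OF \<tau>]
  have "partition_on {1..L} P"
  proof (rule partition_onI)
    show "\<Union>P = {1..L}" using m(1) by (auto simp: P_def)
    show "disjnt p q" if pq: "p \<in> P" "q \<in> P" "p \<noteq> q" for p q
    proof -
      obtain s t where st: "s \<in> {1..L}" "t \<in> {1..L}" "p = {s, \<tau> s}" "q = {t, \<tau> t}"
        using pq(1,2) unfolding P_def by blast
      have "t \<noteq> s" using st pq(3) by auto
      moreover have "t \<noteq> \<tau> s" using st pq(3) m(3)[OF st(1)] by auto
      moreover have "\<tau> t \<noteq> s" using st pq(3) m(3)[OF st(2)] by auto
      moreover have "\<tau> t \<noteq> \<tau> s" using \<open>t \<noteq> s\<close> m(3)[OF st(1)] m(3)[OF st(2)] by metis
      ultimately show ?thesis using st by (auto simp: disjnt_def)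
    qed
    show "{} \<notin> P" by (auto simp: P_def)
  qed
  moreover have "card V = 2" if V: "V \<in> P" for V
  proof -
    obtain s where "s \<in> {1..L}" "V = {s, \<tau> s}" using V unfolding P_def by blast
    then show ?thesis using m(2)[of s] by simp
  qed
  ultimately show P: "P \<in> pairings L" by (simp add: pairings_def)
  show "pairing_perm P s = \<tau> s" if "s \<in> {1..L}" for s
    using that m(2)[OF that] by (intro pairing_perm_eq[OF P]) (auto simp: P_def)
qed

lemma finite_pairings: "finite (pairings L)"
proof (rule finite_subset)
  show "pairings L \<subseteq> Pow (Pow {1..L})" by (auto simp: pairings_def partition_on_def)
qed simp

text \<open>
  Each block of the matching contains exactly one position that precedes its partner.
\<close>

lemma card_openers:
  assumes \<tau>: "matching L \<tau>" and L: "L = 2 * h"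
  shows "card {s\<in>{1..L}. s < \<tau> s} = h"
proof -
  note m = matchingD[OF \<tau>]
  define R where "R = {s\<in>{1..L}. s < \<tau> s}"
  have R: "R \<subseteq> {1..L}" "finite R" by (auto simp: R_def)
  have inj: "inj_on \<tau> R" using R(1) m(3) by (metis inj_onI subsetD)
  have cover: "{1..L} = R \<union> \<tau> ` R"
  proof (intro equalityI subsetI)
    fix s assume s: "s \<in> {1..L}"
    show "s \<in> R \<union> \<tau> ` R"
    proof (cases "s < \<tau> s")
      case True then show ?thesis using s by (simp add: R_def)
    next
      case False
      then have "\<tau> s < \<tau> (\<tau> s)" using m(2,3)[OF s] by simp
      then have "\<tau> s \<in> R" using m(1)[OF s] unfolding R_def by blast
      then show ?thesis using m(3)[OF s] by force
    qed
  next
    fix s assume "s \<in> R \<union> \<tau> ` R"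
    then show "s \<in> {1..L}" using R(1) m(1) by blast
  qed
  have disj: "R \<inter> \<tau> ` R = {}"
  proof -
    have False if "s \<in> R" "\<tau> s \<in> R" for s
      using that m(3)[of s] by (auto simp: R_def)
    then show ?thesis by blast
  qed
  have "card {1..L} = card R + card (\<tau> ` R)"
    using R(2) disj by (subst cover, intro card_Un_disjoint) auto
  then show ?thesis using card_image[OF inj] L by (simp add: R_def)
qed

lemma sum_antisymmetric:
  fixes D :: "nat \<Rightarrow> int"
  assumes "\<And>s. s \<in> S \<Longrightarrow> \<tau> s \<in> S" "\<And>s. s \<in> S \<Longrightarrow> \<tau> (\<tau> s) = s" "\<And>s. s \<in> S \<Longrightarrow> D (\<tau> s) = - D s"
  shows "sum D S = 0"
proof -
  have "sum D S = (\<Sum>s\<in>S. D (\<tau> s))"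
    using assms(1,2) by (intro sum.reindex_bij_witness[of _ \<tau> \<tau>]) auto
  also have "\<dots> = - sum D S" using assms(3) by (simp add: sum_negf)
  finally show ?thesis by simp
qed

lemma full_cycle_eq:
  shows "s \<in> {1..L} \<Longrightarrow> full_cycle L s = cnext L s" and "s \<notin> {1..L} \<Longrightarrow> full_cycle L s = s"
proof -
  let ?cs = "[1..<L + 1]"
  show "full_cycle L s = s" if "s \<notin> {1..L}"
    unfolding full_cycle_def using that by (intro id_outside_supp) auto
  assume s: "s \<in> {1..L}"
  have "map (cycle_of_list ?cs ^^ 1) ?cs = rotate 1 ?cs"
    by (rule cyclic_rotation) simp
  then have eq: "map (cycle_of_list ?cs) ?cs = rotate1 ?cs" by simp
  have "map (cycle_of_list ?cs) ?cs ! (s - 1) = rotate1 ?cs ! (s - 1)" using eq by simp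
  moreover have "map (cycle_of_list ?cs) ?cs ! (s - 1) = cycle_of_list ?cs s"
    using s by (subst nth_map) (auto simp del: upt_Suc)
  moreover have "rotate1 ?cs ! (s - 1) = ?cs ! (Suc (s - 1) mod L)"
    using s by (subst nth_rotate1) (auto simp del: upt_Suc)
  moreover have "?cs ! (Suc (s - 1) mod L) = cnext L s"
    using s by (cases "s = L") (auto simp: cnext_def simp del: upt_Suc)
  ultimately show "full_cycle L s = cnext L s" by (simp add: full_cycle_def)
qed

lemma cnext_bij: "bij_betw (cnext L) {1..L} {1..L}"
proof (rule bij_betw_byWitness[where f' = "\<lambda>s. if s = 1 then L else s - 1"])
qed (auto simp: cnext_def)

lemma permutes_cycle_matching:
  assumes P: "P \<in> pairings L"
  shows "full_cycle L \<circ> pairing_perm P permutes {1..L}"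
proof (rule bij_imp_permutes)
  note m = matchingD[OF matching_pairing_perm[OF P]]
  have "bij_betw (pairing_perm P) {1..L} {1..L}"
    using m(1,3) by (intro bij_betw_byWitness[where f' = "pairing_perm P"]) blast+
  moreover have "bij_betw (full_cycle L) {1..L} {1..L}"
    using cnext_bij[of L] full_cycle_eq(1) by (subst bij_betw_cong[of _ _ "cnext L"]) auto
  ultimately show "bij_betw (full_cycle L \<circ> pairing_perm P) {1..L} {1..L}"
    by (rule bij_betw_trans)
  fix s assume s: "s \<notin> {1..L}"
  have "\<not> (\<exists>j. j \<noteq> s \<and> {s, j} \<in> P)"
    using s pairing_block_eq(2)[OF P] by blast
  then have "pairing_perm P s = s" unfolding pairing_perm_def by (rule if_not_P)
  then show "(full_cycle L \<circ> pairing_perm P) s = s" using s full_cycle_eq(2) by simp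
qed

text \<open>
  A function with values in \<open>{..<k}\<close> that is invariant under \<open>\<sigma>\<close> is a free choice of one value for each cycle.
\<close>

lemma card_invariant_functions:
  fixes \<sigma> :: "'a \<Rightarrow> 'a"
  assumes \<sigma>: "\<sigma> permutes S" and S: "finite S"
  shows "card {u \<in> S \<rightarrow>\<^sub>E {..<k}. \<forall>s\<in>S. u s = u (\<sigma> s)} = (k :: nat) ^ card (orbit \<sigma> ` S)"
proof -
  let ?U = "{u \<in> S \<rightarrow>\<^sub>E {..<k}. \<forall>s\<in>S. u s = u (\<sigma> s)}" and ?O = "orbit \<sigma> ` S"
  have self: "s \<in> orbit \<sigma> s" for s
    using permutation_self_in_orbit[of \<sigma> s] permutation_permutes \<sigma> S by blast
  have orb: "orbit \<sigma> y = orbit \<sigma> x" if "y \<in> orbit \<sigma> x" for x y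
  proof -
    have "x \<in> orbit \<sigma> y" using orbit_swap[OF self that] .
    then show ?thesis using that orbit_trans by fast
  qed
  have const: "y \<in> S \<and> u y = u x" if u: "\<forall>s\<in>S. u s = u (\<sigma> s)" and "x \<in> S" "y \<in> orbit \<sigma> x" for u :: "'a \<Rightarrow> nat" and x y
    using that(3)
  proof induction
    case base
    show ?case using bspec[OF u \<open>x \<in> S\<close>] permutes_in_image[OF \<sigma>, of x] \<open>x \<in> S\<close> by simp
  next
    case (step y)
    then have "y \<in> S" "u y = u x" by simp_all
    then show ?case using bspec[OF u \<open>y \<in> S\<close>] permutes_in_image[OF \<sigma>, of y] by simp
  qed
  define rep where "rep X = (SOME x. x \<in> S \<and> orbit \<sigma> x = X)" for X
  have some: "rep X \<in> S \<and> orbit \<sigma> (rep X) = X" if X: "X \<in> ?O" for X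
  proof -
    have "\<exists>x. x \<in> S \<and> orbit \<sigma> x = X" using X by blast
    then show ?thesis unfolding rep_def by (rule someI_ex)
  qed
  have "bij_betw (\<lambda>h. \<lambda>s\<in>S. h (orbit \<sigma> s)) (?O \<rightarrow>\<^sub>E {..<k}) ?U"
  proof (rule bij_betw_byWitness[where f' = "\<lambda>u. \<lambda>X\<in>?O. u (rep X)"])
    show "\<forall>h\<in>?O \<rightarrow>\<^sub>E {..<k}. (\<lambda>X\<in>?O. (\<lambda>s\<in>S. h (orbit \<sigma> s)) (rep X)) = h"
    proof
      fix h assume h: "h \<in> ?O \<rightarrow>\<^sub>E {..<k}"
      show "(\<lambda>X\<in>?O. (\<lambda>s\<in>S. h (orbit \<sigma> s)) (rep X)) = h"
      proof (rule PiE_ext[OF _ h])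
        fix X assume X: "X \<in> ?O"
        show "(\<lambda>X\<in>?O. (\<lambda>s\<in>S. h (orbit \<sigma> s)) (rep X)) X = h X"
          using some[OF X] X by simp
      qed (use h some in \<open>auto simp: PiE_iff\<close>)
    qed
    show "\<forall>u\<in>?U. (\<lambda>s\<in>S. (\<lambda>X\<in>?O. u (rep X)) (orbit \<sigma> s)) = u"
    proof
      fix u assume u: "u \<in> ?U"
      have "(\<lambda>s\<in>S. (\<lambda>X\<in>?O. u (rep X)) (orbit \<sigma> s)) s = u s" for s
      proof (cases "s \<in> S")
        case True
        define x where "x = rep (orbit \<sigma> s)"
        have x: "x \<in> S" "orbit \<sigma> x = orbit \<sigma> s" using some[of "orbit \<sigma> s"] True by (auto simp: x_def)
        have uinv: "\<forall>s\<in>S. u s = u (\<sigma> s)" using u by blast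
        have "u s = u x" using const[OF uinv x(1), of s] self[of s] x(2) by blast
        then show ?thesis using True by (simp add: x_def)
      next
        case False
        have "u \<in> S \<rightarrow>\<^sub>E {..<k}" using u by blast
        then have "u s = undefined" using False by (rule PiE_arb)
        then show ?thesis using False by simp
      qed
      then show "(\<lambda>s\<in>S. (\<lambda>X\<in>?O. u (rep X)) (orbit \<sigma> s)) = u" by (rule ext)
    qed
    show "(\<lambda>h. \<lambda>s\<in>S. h (orbit \<sigma> s)) ` (?O \<rightarrow>\<^sub>E {..<k}) \<subseteq> ?U"
    proof
      fix u assume "u \<in> (\<lambda>h. \<lambda>s\<in>S. h (orbit \<sigma> s)) ` (?O \<rightarrow>\<^sub>E {..<k})"
      then obtain h where h: "h \<in> ?O \<rightarrow>\<^sub>E {..<k}" "u = (\<lambda>s\<in>S. h (orbit \<sigma> s))" by blast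
      have "orbit \<sigma> (\<sigma> s) = orbit \<sigma> s" for s
        by (intro orb orbit.base)
      then show "u \<in> ?U" using h permutes_in_image[OF \<sigma>] by (auto simp: PiE_iff)
    qed
    show "(\<lambda>u. \<lambda>X\<in>?O. u (rep X)) ` ?U \<subseteq> ?O \<rightarrow>\<^sub>E {..<k}"
    proof
      fix h assume "h \<in> (\<lambda>u. \<lambda>X\<in>?O. u (rep X)) ` ?U"
      then obtain u where u: "u \<in> S \<rightarrow>\<^sub>E {..<k}" "h = (\<lambda>X\<in>?O. u (rep X))" by blast
      have "h X < k" if "X \<in> ?O" for X
        using some[OF that] u that by (auto simp: PiE_iff)
      then show "h \<in> ?O \<rightarrow>\<^sub>E {..<k}" using u by (auto simp: PiE_iff)
    qed
  qed
  then have "card ?U = card (?O \<rightarrow>\<^sub>E {..<k})" by (simp add: bij_betw_same_card)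
  then show ?thesis using S by (simp add: card_PiE)
qed

section \<open>Counting the walks matched by a pairing\<close>

text \<open>
  Walks in which the entries at \<open>s\<close> and \<open>\<tau> s\<close> are identified, in opposite orientation, by the block
  circulant structure.
\<close>

definition block_matched :: "nat \<Rightarrow> nat \<Rightarrow> nat \<Rightarrow> (nat \<Rightarrow> nat) \<Rightarrow> (nat \<Rightarrow> nat) set" where
  "block_matched k n L \<tau> =
     {i \<in> walks L (k * n). \<forall>s\<in>{1..L}. opp_block k n (edge L i s) (edge L i (\<tau> s))}"

lemma opp_block_edge:
  "opp_block k n (edge L i s) (edge L i t) \<longleftrightarrow>
     [bstep k L i t = - bstep k L i s] (mod int n) \<and>
     i s mod k = i (cnext L t) mod k \<and> i (cnext L s) mod k = i t mod k"
  by (simp add: opp_block_def bstep_def edge_def)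

lemma bstep_agree:
  assumes "[bstep k L i t = - bstep k L i s] (mod int n)" "[bstep k L j t = - bstep k L j s] (mod int n)"
    and "[bstep k L i s = bstep k L j s] (mod int n)"
  shows "[bstep k L i t = bstep k L j t] (mod int n)"
proof -
  have "[- bstep k L i s = - bstep k L j s] (mod int n)"
    using assms(3) by (simp add: cong_minus_minus_iff)
  then show ?thesis using assms(1,2) by (meson cong_sym cong_trans)
qed

lemma matching_opener:
  assumes "matching L \<tau>" "s \<in> {1..L}" "\<not> s < \<tau> s"
  shows "\<tau> s \<in> {s\<in>{1..L}. s < \<tau> s}"
  using matchingD[OF assms(1,2)] assms(3) by simp

text \<open>
  The free parameters are the starting block, the steps at the smaller element of each block of the
  matching, and the residues modulo \<open>k\<close>.  The steps then sum to zero automatically, so every choice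
  closes up to a walk.
\<close>

lemma card_block_matched:
  assumes \<tau>: "matching L \<tau>" and L: "L = 2 * h" "1 \<le> h" and "0 < k" "0 < n"
  shows "card (block_matched k n L \<tau>) =
    n ^ Suc h * card {u \<in> {1..L} \<rightarrow>\<^sub>E {..<k}. \<forall>s\<in>{1..L}. u s = u (cnext L (\<tau> s))}"
proof -
  note m = matchingD[OF \<tau>]
  define R where "R = {s\<in>{1..L}. s < \<tau> s}"
  have Rsub: "R \<subseteq> {1..L}" and Rfin: "finite R" by (auto simp: R_def)
  have cardR: "card R = h" unfolding R_def by (rule card_openers[OF \<tau> L(1)])
  have one: "1 \<in> {1..L}" using L by simp
  define U where "U = {u \<in> {1..L} \<rightarrow>\<^sub>E {..<k}. \<forall>s\<in>{1..L}. u s = u (cnext L (\<tau> s))}"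
  define F where "F i = (i 1 div k, \<lambda>s\<in>R. bstep k L i s mod int n, \<lambda>s\<in>{1..L}. i s mod k)"
    for i :: "nat \<Rightarrow> nat"
  define T where "T = {..<n} \<times> (R \<rightarrow>\<^sub>E {0..<int n}) \<times> U"
  have inj: "inj_on F (block_matched k n L \<tau>)"
  proof (rule inj_onI)
    fix i j assume ij: "i \<in> block_matched k n L \<tau>" "j \<in> block_matched k n L \<tau>" and eq: "F i = F j"
    have agree: "[bstep k L i s = bstep k L j s] (mod int n)" if "s \<in> R" for s
    proof -
      have "(\<lambda>s\<in>R. bstep k L i s mod int n) s = (\<lambda>s\<in>R. bstep k L j s mod int n) s"
        using eq by (simp add: F_def)
      then show ?thesis using that by (simp add: cong_def)
    qed
    show "i = j"
    proof (rule walk_eqI[of i L k n])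
      show "i \<in> walks L (k * n)" "j \<in> walks L (k * n)" using ij by (auto simp: block_matched_def)
      show "i 1 div k = j 1 div k" using eq by (simp add: F_def)
      fix s assume s: "s \<in> {1..L}"
      have "(\<lambda>s\<in>{1..L}. i s mod k) s = (\<lambda>s\<in>{1..L}. j s mod k) s" using eq by (simp add: F_def)
      then show "i s mod k = j s mod k" using s by simp
      show "[bstep k L i s = bstep k L j s] (mod int n)"
      proof (cases "s < \<tau> s")
        case True
        then show ?thesis using agree s by (simp add: R_def)
      next
        case False
        then have "\<tau> s \<in> R" unfolding R_def by (rule matching_opener[OF \<tau> s])
        have "[bstep k L i s = - bstep k L i (\<tau> s)] (mod int n)" "[bstep k L j s = - bstep k L j (\<tau> s)] (mod int n)"
          using ij m(1)[OF s] m(3)[OF s] by (auto simp: block_matched_def opp_block_edge dest!: bspec[of _ _ "\<tau> s"])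
        then show ?thesis using agree[OF \<open>\<tau> s \<in> R\<close>] by (rule bstep_agree)
      qed
    qed
  qed
  have img: "F ` block_matched k n L \<tau> = T"
  proof (intro equalityI subsetI)
    fix y assume "y \<in> F ` block_matched k n L \<tau>"
    then obtain i where i: "i \<in> block_matched k n L \<tau>" and y: "y = F i" by blast
    have w: "i \<in> walks L (k * n)" using i by (simp add: block_matched_def)
    have "i 1 div k < n" by (intro div_less_blocks walks_less[OF w one])
    moreover have "(\<lambda>s\<in>{1..L}. i s mod k) \<in> U"
    proof -
      have "(\<lambda>s\<in>{1..L}. i s mod k) s = (\<lambda>s\<in>{1..L}. i s mod k) (cnext L (\<tau> s))" if s: "s \<in> {1..L}" for s
      proof -
        have "i s mod k = i (cnext L (\<tau> s)) mod k"
          using i s by (simp add: block_matched_def opp_block_edge)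
        moreover have "cnext L (\<tau> s) \<in> {1..L}" by (intro cnext_in m(1) s)
        ultimately show ?thesis using s by (simp only: restrict_apply' if_True)
      qed
      moreover have "(\<lambda>s\<in>{1..L}. i s mod k) \<in> {1..L} \<rightarrow>\<^sub>E {..<k}"
        using \<open>0 < k\<close> by auto
      ultimately show ?thesis unfolding U_def by blast
    qed
    moreover have "(\<lambda>s\<in>R. bstep k L i s mod int n) \<in> R \<rightarrow>\<^sub>E {0..<int n}"
      using \<open>0 < n\<close> by auto
    ultimately show "y \<in> T" by (simp add: y F_def T_def)
  next
    fix y assume "y \<in> T"
    then obtain a x u where y: "y = (a, x, u)" and a: "a < n" and x: "x \<in> R \<rightarrow>\<^sub>E {0..<int n}" and u: "u \<in> U"
      by (auto simp: T_def)
    have uk: "u s < k" if "s \<in> {1..L}" for s using u that unfolding U_def by blast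
    have uU: "\<forall>s\<in>{1..L}. u s = u (cnext L (\<tau> s))" using u unfolding U_def by blast
    have uinv: "u (cnext L (\<tau> s)) = u s" if "s \<in> {1..L}" for s
      by (rule bspec[OF uU that, symmetric])
    \<comment> \<open>The walk with the prescribed parameters: steps \<open>D\<close>, block positions \<open>p\<close> as reduced partial sums.\<close>
    define D where "D s = (if s < \<tau> s then x s else - x (\<tau> s))" for s
    have D_anti: "D (\<tau> s) = - D s" if s: "s \<in> {1..L}" for s
      using m(2,3)[OF s] by (auto simp: D_def)
    have D_sum: "sum D {1..L} = 0"
      using m(1,3) D_anti by (rule sum_antisymmetric)
    define q where "q s = int a + (\<Sum>r\<in>{1..<s}. D r)" for s
    define p where "p s = nat (q s mod int n)" for s
    have p_lt: "p s < n" for s using \<open>0 < n\<close> by (simp add: p_def nat_less_iff)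
    have p_cong: "[int (p s) = q s] (mod int n)" for s
      using \<open>0 < n\<close> by (simp add: p_def cong_def)
    define i where "i = (\<lambda>s\<in>{1..L}. k * p s + u s)"
    have idiv: "i s div k = p s" and imod: "i s mod k = u s" if s: "s \<in> {1..L}" for s
      using uk[OF s] s by (simp_all add: i_def)
    have iw: "i \<in> walks L (k * n)"
    proof -
      have "k * p s + u s < k * n" if s: "s \<in> {1..L}" for s
      proof -
        have "k * p s + u s < k * p s + k" using uk[OF s] by simp
        also have "\<dots> = k * Suc (p s)" by simp
        also have "\<dots> \<le> k * n" using p_lt[of s] by (intro mult_le_mono2) simp
        finally show ?thesis .
      qed
      then show ?thesis by (auto simp: walks_def i_def)
    qed
    have qstep: "q (cnext L s) - q s = D s" if s: "s \<in> {1..L}" for s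
    proof (cases "s = L")
      case True
      have "{1..L} = insert L {1..<L}" using s True by auto
      then have "sum D {1..<L} = - D L" using D_sum by simp
      then show ?thesis using True by (simp add: q_def cnext_def)
    next
      case False
      have "{1..<Suc s} = insert s {1..<s}" using s by auto
      then show ?thesis using False by (simp add: q_def cnext_def)
    qed
    have istep: "[bstep k L i s = D s] (mod int n)" if s: "s \<in> {1..L}" for s
    proof -
      have "bstep k L i s = int (p (cnext L s)) - int (p s)"
        using idiv[OF s] idiv[OF cnext_in[OF s]] by (simp add: bstep_alt)
      then show ?thesis
        using cong_diff[OF p_cong p_cong, of "cnext L s" s] qstep[OF s] by simp
    qed
    have "i \<in> block_matched k n L \<tau>"
      unfolding block_matched_def
    proof (intro CollectI conjI ballI iw)
      fix s assume s: "s \<in> {1..L}"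
      have "[bstep k L i (\<tau> s) = - bstep k L i s] (mod int n)"
      proof -
        have "[bstep k L i (\<tau> s) = - D s] (mod int n)" using istep[OF m(1)[OF s]] D_anti[OF s] by simp
        moreover have "[- bstep k L i s = - D s] (mod int n)"
          using istep[OF s] by (simp add: cong_minus_minus_iff)
        ultimately show ?thesis by (meson cong_sym cong_trans)
      qed
      moreover have "i s mod k = i (cnext L (\<tau> s)) mod k"
        using imod[OF s] imod[OF cnext_in[OF m(1)[OF s]]] uinv[OF s] by simp
      moreover have "i (cnext L s) mod k = i (\<tau> s) mod k"
        using imod[OF m(1)[OF s]] imod[OF cnext_in[OF s]] uinv[OF m(1)[OF s]] m(3)[OF s] by simp
      ultimately show "opp_block k n (edge L i s) (edge L i (\<tau> s))" by (simp add: opp_block_edge)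
    qed
    moreover have "F i = y"
    proof -
      have "i 1 div k = a" using idiv[OF one] a by (simp add: p_def q_def)
      moreover have "(\<lambda>s\<in>R. bstep k L i s mod int n) = x"
      proof (rule PiE_ext[OF _ x])
        fix s assume s: "s \<in> R"
        then have "bstep k L i s mod int n = x s mod int n"
          using istep[of s] Rsub by (auto simp: cong_def D_def R_def)
        also have "\<dots> = x s" using x s by (auto simp: PiE_iff)
        finally show "(\<lambda>s\<in>R. bstep k L i s mod int n) s = x s" using s by simp
      qed (use \<open>0 < n\<close> in auto)
      moreover have "(\<lambda>s\<in>{1..L}. i s mod k) = u"
      proof (rule PiE_ext)
        show "u \<in> {1..L} \<rightarrow>\<^sub>E {..<k}" using u unfolding U_def by blast
        show "(\<lambda>s\<in>{1..L}. i s mod k) \<in> {1..L} \<rightarrow>\<^sub>E {..<k}" using \<open>0 < k\<close> by auto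
      qed (simp add: imod)
      ultimately show ?thesis by (simp add: F_def y)
    qed
    ultimately show "y \<in> F ` block_matched k n L \<tau>" by blast
  qed
  have "card (block_matched k n L \<tau>) = card T"
    using card_image[OF inj] img by simp
  also have "\<dots> = n ^ Suc h * card U"
    using Rfin by (simp add: T_def card_cartesian_product card_PiE cardR)
  finally show ?thesis by (simp add: U_def)
qed

text \<open>
  If \<open>\<tau>\<close> preserves the interval from \<open>s\<close> to \<open>\<tau> s\<close>, then the steps in this interval cancel in pairs, and
  the entries at \<open>s\<close> and \<open>\<tau> s\<close> are transposed to each other, not only their blocks.
\<close>

lemma block_matched_opp_entry:
  assumes \<tau>: "matching L \<tau>" and i: "i \<in> block_matched k n L \<tau>" and s: "s \<in> {1..L}" "s < \<tau> s"
    and closed: "\<And>r. r \<in> {s..\<tau> s} \<Longrightarrow> \<tau> r \<in> {s..\<tau> s}"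
  shows "i s = i (cnext L (\<tau> s))" "i (cnext L s) = i (\<tau> s)"
proof -
  note m = matchingD[OF \<tau>]
  let ?t = "\<tau> s"
  have t: "?t \<in> {1..L}" using m(1)[OF s(1)] .
  have iw: "i \<in> walks L (k * n)" using i by (simp add: block_matched_def)
  have anti: "[bstep k L i (\<tau> r) = - bstep k L i r] (mod int n)" if "r \<in> {1..L}" for r
    using i that by (simp add: block_matched_def opp_block_edge)
  have sub: "{s..?t} \<subseteq> {1..L}" using s(1) t by auto
  \<comment> \<open>The steps are antisymmetric under \<open>\<tau>\<close> only modulo \<open>n\<close>, which yields just twice their sum;
    an integer-valued antisymmetric lift has sum exactly zero.\<close>
  define D where "D r = (if r < \<tau> r then bstep k L i r else - bstep k L i (\<tau> r))" for r
  have D_cong: "[bstep k L i r = D r] (mod int n)" if r: "r \<in> {1..L}" for r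
    using anti[OF m(1)[OF r]] m(3)[OF r] by (auto simp: D_def)
  have D_sum: "sum D {s..?t} = 0"
  proof (rule sum_antisymmetric)
    fix r assume r: "r \<in> {s..?t}"
    then have rL: "r \<in> {1..L}" using sub by blast
    show "\<tau> r \<in> {s..?t}" by (rule closed[OF r])
    show "\<tau> (\<tau> r) = r" by (rule m(3)[OF rL])
    show "D (\<tau> r) = - D r" using m(2,3)[OF rL] by (auto simp: D_def)
  qed
  have "[(\<Sum>r\<in>{s..?t}. bstep k L i r) = sum D {s..?t}] (mod int n)"
    using sub D_cong by (intro cong_sum) blast
  then have e0: "[int (i (cnext L ?t) div k) = int (i s div k)] (mod int n)"
    using s(2) t D_sum by (simp add: sum_step_interval cong_iff_dvd_diff)
  have lt: "i r div k < n" if "r \<in> {1..L}" for r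
    using walks_less[OF iw that] by (rule div_less_blocks)
  have e1: "i s div k = i (cnext L ?t) div k"
    using nat_eq_if_cong[OF e0 lt[OF cnext_in[OF t]] lt[OF s(1)]] by simp
  have "[int (i (cnext L ?t) div k) - int (i ?t div k) = int (i s div k) - int (i (cnext L s) div k)] (mod int n)"
    using anti[OF s(1)] by (simp add: bstep_alt)
  then have "[int (i (cnext L s) div k) = int (i ?t div k)] (mod int n)"
    unfolding e1 by (simp add: cong_iff_dvd_diff dvd_diff_commute)
  then have e2: "i (cnext L s) div k = i ?t div k"
    by (rule nat_eq_if_cong[OF _ lt[OF cnext_in[OF s(1)]] lt[OF t]])
  have "i s mod k = i (cnext L ?t) mod k" "i (cnext L s) mod k = i ?t mod k"
    using i s(1) by (auto simp: block_matched_def opp_block_edge)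
  with e1 e2 show "i s = i (cnext L ?t)" "i (cnext L s) = i ?t"
    by (metis div_mult_mod_eq)+
qed

text \<open>
  If the block of \<open>v\<close> crosses that of \<open>s\<close>, then requiring the walk to return from its \<open>\<tau> s\<close>-th edge to \<open>i s\<close>
  expresses the step at \<open>v\<close> by the steps outside the block of \<open>v\<close>.  This removes one free parameter.
\<close>

lemma card_crossing_le:
  assumes \<tau>: "matching L \<tau>" and L: "L = 2 * h" "1 \<le> h" and "0 < k" "0 < n"
    and s: "s \<in> {1..L}" and v: "s < v" "v < \<tau> s" "\<tau> v \<notin> {s..\<tau> s}"
    and Q: "Q \<subseteq> block_matched k n L \<tau>" "\<And>i. i \<in> Q \<Longrightarrow> i s = i (cnext L (\<tau> s))"
  shows "card Q \<le> 2 * k ^ L * n ^ h"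
proof -
  note m = matchingD[OF \<tau>]
  let ?t = "\<tau> s"
  have t: "?t \<in> {1..L}" using m(1)[OF s] .
  have vL: "v \<in> {1..L}" using s t v by auto
  have sub: "{s..?t} \<subseteq> {1..L}" using s t by auto
  define R0 where "R0 = {r\<in>{1..L}. r < \<tau> r}"
  \<comment> \<open>Exactly one of \<open>v\<close> and \<open>\<tau> v\<close> lies in \<open>R0\<close>.\<close>
  define R where "R = R0 - {v, \<tau> v}"
  have cardR: "Suc (card R) = h"
  proof -
    have "R = R0 - {if v < \<tau> v then v else \<tau> v}"
      using m(3)[OF vL] by (auto simp: R_def R0_def)
    moreover have "(if v < \<tau> v then v else \<tau> v) \<in> R0"
      using m[OF vL] vL by (auto simp: R0_def)
    moreover have "finite R0" "card R0 = h"
      using card_openers[OF \<tau> L(1)] by (auto simp: R0_def)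
    ultimately show ?thesis using L(2) by simp
  qed
  have anti: "[bstep k L i (\<tau> r) = - bstep k L i r] (mod int n)" if "r \<in> {1..L}" "i \<in> Q" for i r
    using Q(1) that by (auto simp: block_matched_def opp_block_edge)
  have "card Q \<le> 2 * k ^ L * n ^ Suc (card R)"
  proof (rule card_walks_le[where g = "\<lambda>_. True"])
    show "Q \<subseteq> walks L (k * n)" using Q(1) by (auto simp: block_matched_def)
    show "finite R" by (simp add: R_def R0_def)
    fix i j r
    assume i: "i \<in> Q" and j: "j \<in> Q" and r: "r \<in> {1..L}"
      and agree: "\<And>s. s \<in> R \<Longrightarrow> [bstep k L i s = bstep k L j s] (mod int n)"
    have agree1: "[bstep k L i r = bstep k L j r] (mod int n)"
      if r: "r \<in> {1..L}" and nv: "r \<noteq> v" "r \<noteq> \<tau> v" for r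
    proof (cases "r < \<tau> r")
      case True
      then show ?thesis using agree r nv by (simp add: R_def R0_def)
    next
      case False
      then have "\<tau> r \<in> R0" unfolding R0_def by (rule matching_opener[OF \<tau> r])
      moreover have "\<tau> r \<noteq> v" "\<tau> r \<noteq> \<tau> v" using nv m(3)[OF r] m(3)[OF vL] by auto
      ultimately have "[bstep k L i (\<tau> r) = bstep k L j (\<tau> r)] (mod int n)"
        using agree by (simp add: R_def)
      then show ?thesis
        using bstep_agree[of k L i r "\<tau> r" n j] anti[OF m(1)[OF r]] i j m(3)[OF r] by simp
    qed
    have zero: "(\<Sum>r\<in>{s..?t}. bstep k L w r) = 0" if "w \<in> Q" for w
      using v t Q(2)[OF that] by (simp add: sum_step_interval)
    have split: "(\<Sum>r\<in>{s..?t}. bstep k L w r) = bstep k L w v + (\<Sum>r\<in>{s..?t} - {v}. bstep k L w r)" for w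
      using v by (intro sum.remove) auto
    have "[(\<Sum>r\<in>{s..?t} - {v}. bstep k L i r) = (\<Sum>r\<in>{s..?t} - {v}. bstep k L j r)] (mod int n)"
    proof (rule cong_sum)
      fix r assume r: "r \<in> {s..?t} - {v}"
      then have "r \<noteq> \<tau> v" using v(3) by auto
      then show "[bstep k L i r = bstep k L j r] (mod int n)" using r sub by (intro agree1) auto
    qed
    then have "[- (\<Sum>r\<in>{s..?t} - {v}. bstep k L i r) = - (\<Sum>r\<in>{s..?t} - {v}. bstep k L j r)] (mod int n)"
      by (simp add: cong_minus_minus_iff)
    moreover have "bstep k L w v = - (\<Sum>r\<in>{s..?t} - {v}. bstep k L w r)" if "w \<in> Q" for w
      using zero[OF that] split[of w] by linarith
    ultimately have av: "[bstep k L i v = bstep k L j v] (mod int n)" using i j by simp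
    have atv: "[bstep k L i (\<tau> v) = bstep k L j (\<tau> v)] (mod int n)"
      using anti[OF vL i] anti[OF vL j] av by (rule bstep_agree)
    show "[bstep k L i r = bstep k L j r] (mod int n)"
      using agree1[OF r] av atv by blast
  qed (use assms(4,5) L in auto)
  then show ?thesis using cardR by simp
qed

section \<open>Degenerate walks\<close>

text \<open>
  Congruence modulo \<open>n\<close> up to sign.
\<close>

definition pm_cong :: "nat \<Rightarrow> int \<Rightarrow> int \<Rightarrow> bool" where
  "pm_cong n a b \<longleftrightarrow> [a = b] (mod int n) \<or> [a = - b] (mod int n)"

lemma cong_neg_swap: "[a = - b] (mod int n) \<longleftrightarrow> [b = - a] (mod int n)"
proof -
  have "[a = - b] (mod int n) \<longleftrightarrow> [- a = - (- b)] (mod int n)" by (rule cong_minus_minus_iff[symmetric])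
  also have "\<dots> \<longleftrightarrow> [b = - a] (mod int n)" by (simp add: cong_sym_eq)
  finally show ?thesis .
qed

lemma pm_cong_refl: "pm_cong n a a"
  by (simp add: pm_cong_def)

lemma pm_cong_sym: "pm_cong n a b \<longleftrightarrow> pm_cong n b a"
  using cong_neg_swap[of a b n] by (auto simp: pm_cong_def cong_sym_eq)

lemma pm_cong_trans:
  assumes "pm_cong n a b" "pm_cong n b c"
  shows "pm_cong n a c"
proof -
  have "[- b = c] (mod int n)" if "[b = - c] (mod int n)"
    using that cong_neg_swap[of b c n] by (simp add: cong_sym_eq)
  moreover have "[- b = - c] (mod int n)" if "[b = c] (mod int n)"
    using that by (simp add: cong_minus_minus_iff)
  ultimately show ?thesis
    using assms unfolding pm_cong_def by (meson cong_trans)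
qed

text \<open>
  Every step agrees modulo \<open>n\<close>, up to sign, with a step at another position.
\<close>

definition no_lonely_step :: "nat \<Rightarrow> nat \<Rightarrow> nat \<Rightarrow> (nat \<Rightarrow> nat) \<Rightarrow> bool" where
  "no_lonely_step k n L i \<longleftrightarrow>
     (\<forall>s\<in>{1..L}. \<exists>t\<in>{1..L}. t \<noteq> s \<and> pm_cong n (bstep k L i s) (bstep k L i t))"

text \<open>
  The steps agree up to sign exactly in pairs, and the two steps of a pair are opposite but not equal
  modulo \<open>n\<close>.  In particular no step satisfies \<open>2 d = 0\<close> modulo \<open>n\<close>.
\<close>

definition generic :: "nat \<Rightarrow> nat \<Rightarrow> nat \<Rightarrow> (nat \<Rightarrow> nat) \<Rightarrow> bool" where
  "generic k n L i \<longleftrightarrow>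
     (\<forall>s\<in>{1..L}. \<exists>t\<in>{1..L}. t \<noteq> s \<and> pm_cong n (bstep k L i s) (bstep k L i t) \<and>
        \<not> [bstep k L i s = bstep k L i t] (mod int n) \<and>
        (\<forall>r\<in>{1..L}. r \<noteq> s \<longrightarrow> r \<noteq> t \<longrightarrow> \<not> pm_cong n (bstep k L i s) (bstep k L i r)))"

text \<open>
  The congruence \<open>2 x = c\<close> has at most two solutions modulo \<open>n\<close>, and they lie in different halves of the
  interval from \<open>0\<close> to \<open>n\<close>.
\<close>

lemma cong_halve:
  fixes a b :: int
  assumes "0 < n" and two: "[2 * a = 2 * b] (mod int n)"
    and half: "2 * (a mod int n) < int n \<longleftrightarrow> 2 * (b mod int n) < int n"
  shows "[a = b] (mod int n)"
proof -
  define a' b' where "a' = a mod int n" and "b' = b mod int n"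
  have bd: "0 \<le> a'" "a' < int n" "0 \<le> b'" "b' < int n" using \<open>0 < n\<close> by (simp_all add: a'_def b'_def)
  have "[2 * a' = 2 * b'] (mod int n)"
    using two by (simp add: a'_def b'_def cong_def mod_mult_right_eq)
  then have "int n dvd 2 * a' - 2 * b'" by (simp add: cong_iff_dvd_diff)
  then obtain c where c: "2 * a' - 2 * b' = int n * c" by (rule dvdE)
  have "c < 2"
  proof (rule ccontr)
    assume "\<not> c < 2"
    then have "int n * 2 \<le> int n * c" by (intro mult_left_mono) auto
    then show False using c bd by linarith
  qed
  moreover have "- 2 < c"
  proof (rule ccontr)
    assume "\<not> - 2 < c"
    then have "int n * c \<le> int n * (- 2)" by (intro mult_left_mono) auto
    then show False using c bd by linarith
  qed
  ultimately consider "c = - 1" | "c = 0" | "c = 1" by linarith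
  then have "a' = b'"
  proof cases
    case 1
    then have "2 * a' - 2 * b' = - int n" using c by simp
    then show ?thesis using half bd unfolding a'_def[symmetric] b'_def[symmetric] by linarith
  next
    case 2
    then show ?thesis using c by simp
  next
    case 3
    then have "2 * a' - 2 * b' = int n" using c by simp
    then show ?thesis using half bd unfolding a'_def[symmetric] b'_def[symmetric] by linarith
  qed
  then show ?thesis by (simp add: a'_def b'_def cong_def)
qed

text \<open>
  The least position whose step agrees with that at \<open>s\<close> up to sign.
\<close>

definition class_rep :: "nat \<Rightarrow> nat \<Rightarrow> nat \<Rightarrow> (nat \<Rightarrow> nat) \<Rightarrow> nat \<Rightarrow> nat" where
  "class_rep k n L i s = (LEAST t. t \<in> {1..L} \<and> pm_cong n (bstep k L i s) (bstep k L i t))"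

lemma class_rep_prop:
  assumes "s \<in> {1..L}"
  shows "class_rep k n L i s \<in> {1..L}" "pm_cong n (bstep k L i s) (bstep k L i (class_rep k n L i s))"
proof -
  have "class_rep k n L i s \<in> {1..L} \<and> pm_cong n (bstep k L i s) (bstep k L i (class_rep k n L i s))"
    unfolding class_rep_def by (rule LeastI[of _ s]) (use assms pm_cong_refl in blast)
  then show "class_rep k n L i s \<in> {1..L}" "pm_cong n (bstep k L i s) (bstep k L i (class_rep k n L i s))"
    by blast+
qed

lemma class_rep_cong:
  assumes "pm_cong n (bstep k L i s) (bstep k L i t)"
  shows "class_rep k n L i s = class_rep k n L i t"
proof -
  have "pm_cong n (bstep k L i s) x \<longleftrightarrow> pm_cong n (bstep k L i t) x" for x
    using assms pm_cong_trans pm_cong_sym by blast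
  then show ?thesis by (simp add: class_rep_def)
qed

text \<open>
  Degenerate walks with a prescribed pattern: \<open>f\<close> gives the representatives of the classes of steps and \<open>e\<close>
  tells whether a step agrees with its representative without a sign change.
\<close>

lemma card_pattern_le:
  assumes L: "L = 2 * h" "1 \<le> h" and "0 < k" "0 < n"
    and Q: "Q \<subseteq> {i \<in> walks L (k * n). no_lonely_step k n L i \<and> \<not> generic k n L i}"
    and f: "\<And>i s. i \<in> Q \<Longrightarrow> s \<in> {1..L} \<Longrightarrow> class_rep k n L i s = f s"
    and e: "\<And>i s. i \<in> Q \<Longrightarrow> s \<in> {1..L} \<Longrightarrow> [bstep k L i s = bstep k L i (f s)] (mod int n) \<longleftrightarrow> e s"
  shows "card Q \<le> 2 * k ^ L * n ^ h"
proof (cases "Q = {}")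
  case False
  then obtain w where w: "w \<in> Q" by blast
  have wp: "no_lonely_step k n L w" "\<not> generic k n L w" using Q w by blast+
  let ?d = "bstep k L"
  have f_in: "f s \<in> {1..L}" if "s \<in> {1..L}" for s
    using class_rep_prop(1)[OF that, of k n w] f[OF w that] by simp
  have f_pm: "pm_cong n (?d i s) (?d i (f s))" if "i \<in> Q" "s \<in> {1..L}" for i s
    using class_rep_prop(2)[OF that(2), of n k i] f[OF that] by simp
  have f_eq: "f s = f t" if "s \<in> {1..L}" "t \<in> {1..L}" "pm_cong n (?d w s) (?d w t)" for s t
    using class_rep_cong[OF that(3)] f[OF w that(1)] f[OF w that(2)] by simp
  have f_idem: "f (f s) = f s" if "s \<in> {1..L}" for s
    using f_eq[OF that f_in[OF that] f_pm[OF w that]] by simp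
  have f_inv: "pm_cong n (?d w s) (?d w t)" if "s \<in> {1..L}" "t \<in> {1..L}" "f s = f t" for s t
    using f_pm[OF w that(1)] f_pm[OF w that(2)] that(3) pm_cong_trans pm_cong_sym by metis
  have neg: "[?d i s = - ?d i (f s)] (mod int n)" if "i \<in> Q" "s \<in> {1..L}" "\<not> e s" for i s
    using f_pm[OF that(1,2)] e[OF that(1,2)] that(3) by (auto simp: pm_cong_def)
  have agree_f: "[?d i s = ?d j s] (mod int n)"
    if i: "i \<in> Q" and j: "j \<in> Q" and s: "s \<in> {1..L}" and a: "[?d i (f s) = ?d j (f s)] (mod int n)" for i j s
  proof (cases "e s")
    case True
    then have "[?d i s = ?d i (f s)] (mod int n)" "[?d j s = ?d j (f s)] (mod int n)"
      using e i j s by simp_all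
    then show ?thesis using a by (meson cong_sym cong_trans)
  next
    case False
    show ?thesis by (rule bstep_agree[OF neg[OF i s False] neg[OF j s False] a])
  qed
  define R where "R = f ` {1..L}"
  have Rfin: "finite R" by (simp add: R_def)
  define F where "F r = {s\<in>{1..L}. f s = r}" for r
  have Ffin: "finite (F r)" for r by (simp add: F_def)
  have two: "2 \<le> card (F r)" if rR: "r \<in> R" for r
  proof -
    obtain s where s: "s \<in> {1..L}" "r = f s" using rR by (auto simp: R_def)
    obtain t where t: "t \<in> {1..L}" "t \<noteq> s" "pm_cong n (?d w s) (?d w t)"
      using wp(1) s(1) unfolding no_lonely_step_def by blast
    have "{s, t} \<subseteq> F r" using s t f_eq[OF s(1) t(1,3)] by (auto simp: F_def)
    then have "card {s, t} \<le> card (F r)" using Ffin by (rule card_mono[rotated])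
    then show ?thesis using t(2) by simp
  qed
  have sumF: "(\<Sum>r\<in>R. card (F r)) = L"
  proof -
    have "(\<Sum>r\<in>R. \<Sum>s\<in>{s\<in>{1..L}. f s = r}. 1) = (\<Sum>s\<in>{1..L}. 1 :: nat)"
      using Rfin by (intro sum.group) (auto simp: R_def)
    then show ?thesis by (simp add: F_def)
  qed
  have cR: "2 * card R \<le> L"
  proof -
    have "(\<Sum>r\<in>R. 2) \<le> (\<Sum>r\<in>R. card (F r))" using two by (intro sum_mono)
    then show ?thesis using sumF by simp
  qed
  show ?thesis
  proof (cases "card R < h")
    case True
    have "card Q \<le> 2 * k ^ L * n ^ Suc (card R)"
    proof (rule card_walks_le[where g = "\<lambda>_. True"])
      fix i j s assume i: "i \<in> Q" and j: "j \<in> Q" and s: "s \<in> {1..L}"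
        and agree: "\<And>s. s \<in> R \<Longrightarrow> [?d i s = ?d j s] (mod int n)"
      have "f s \<in> R" using s by (simp add: R_def)
      then show "[?d i s = ?d j s] (mod int n)" by (rule agree_f[OF i j s agree])
    qed (use Q Rfin assms(3,4) L in auto)
    also have "\<dots> \<le> 2 * k ^ L * n ^ h"
      using True \<open>0 < n\<close> by (intro mult_le_mono2 power_increasing) auto
    finally show ?thesis .
  next
    case False
    then have cardR: "card R = h" using cR L by simp
    \<comment> \<open>With the maximal number of classes all of them have size two, and genericity can only fail
      through a class of two equal steps.\<close>
    have exact: "card (F r) = 2" if "r \<in> R" for r
    proof (rule ccontr)
      assume "card (F r) \<noteq> 2"
      then have "2 < card (F r)" using two[OF that] by simp
      then have "(\<Sum>r\<in>R. 2) < (\<Sum>r\<in>R. card (F r))"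
        using two Rfin that by (intro sum_strict_mono_ex1) auto
      then show False using sumF cardR L by simp
    qed
    obtain s where s: "s \<in> {1..L}" and s_bad: "\<not> (\<exists>t\<in>{1..L}. t \<noteq> s \<and> pm_cong n (?d w s) (?d w t) \<and>
        \<not> [?d w s = ?d w t] (mod int n) \<and>
        (\<forall>r\<in>{1..L}. r \<noteq> s \<longrightarrow> r \<noteq> t \<longrightarrow> \<not> pm_cong n (?d w s) (?d w r)))"
      using wp(2) unfolding generic_def by blast
    obtain t where t: "t \<in> {1..L}" "t \<noteq> s" "pm_cong n (?d w s) (?d w t)"
      using wp(1) s unfolding no_lonely_step_def by blast
    define r where "r = f s"
    have r: "r \<in> R" "r \<in> {1..L}" using s f_in by (auto simp: r_def R_def)
    have Fr: "F r = {s, t}"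
    proof -
      have "{s, t} \<subseteq> F r" using s t f_eq[OF s t(1,3)] by (auto simp: F_def r_def)
      moreover have "card {s, t} = card (F r)" using t(2) exact[OF r(1)] by simp
      ultimately show ?thesis using card_subset_eq[OF Ffin] by metis
    qed
    have "r \<in> F r" using r f_idem[OF s] by (simp add: F_def r_def)
    then have r_st: "r = s \<or> r = t" using Fr by blast
    have ft: "f t = r" using f_eq[OF s t(1,3)] by (simp add: r_def)
    have st: "[?d w s = ?d w t] (mod int n)"
    proof (rule ccontr)
      assume ns: "\<not> [?d w s = ?d w t] (mod int n)"
      have "\<not> pm_cong n (?d w s) (?d w q)" if "q \<in> {1..L}" "q \<noteq> s" "q \<noteq> t" for q
      proof
        assume "pm_cong n (?d w s) (?d w q)"
        then have "q \<in> F r" using f_eq[OF s that(1)] that(1) by (simp add: F_def r_def)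
        then show False using Fr that by blast
      qed
      then show False using s_bad t ns by blast
    qed
    have es: "e s" "e t"
    proof -
      have "[?d w s = ?d w r] (mod int n)" "[?d w t = ?d w r] (mod int n)"
        using r_st st cong_sym by auto
      then show "e s" "e t" using e[OF w s] e[OF w t(1)] ft by (simp_all add: r_def)
    qed
    have dr: "[?d i s = ?d i r] (mod int n)" "[?d i t = ?d i r] (mod int n)" if "i \<in> Q" for i
      using e[OF that s] e[OF that t(1)] es ft by (simp_all add: r_def)
    \<comment> \<open>The other classes determine twice the step at \<open>r\<close>, because all steps sum to zero; the bit tells
      in which half of the interval from \<open>0\<close> to \<open>n\<close> the step lies.\<close>
    have "card Q \<le> 2 * k ^ L * n ^ Suc (card (R - {r}))"
    proof (rule card_walks_le[where g = "\<lambda>i. 2 * (?d i r mod int n) < int n"])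
      fix i j q
      assume i: "i \<in> Q" and j: "j \<in> Q" and q: "q \<in> {1..L}"
        and agree: "\<And>s. s \<in> R - {r} \<Longrightarrow> [?d i s = ?d j s] (mod int n)"
        and half: "(2 * (?d i r mod int n) < int n) = (2 * (?d j r mod int n) < int n)"
      define W where "W = {1..L} - {s, t}"
      have agreeW: "[?d i q = ?d j q] (mod int n)" if "q \<in> W" for q
      proof (rule agree_f[OF i j])
        show qL: "q \<in> {1..L}" using that by (simp add: W_def)
        have "f q \<noteq> r" using that Fr by (auto simp: F_def W_def)
        then show "[?d i (f q) = ?d j (f q)] (mod int n)" using qL by (intro agree) (auto simp: R_def)
      qed
      have sum0: "?d x s + ?d x t + (\<Sum>q\<in>W. ?d x q) = 0" for x
      proof -
        have "finite W" "s \<notin> W" "t \<notin> W" by (simp_all add: W_def)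
        have "{1..L} = insert s (insert t W)" using s t(1) by (auto simp: W_def)
        then have "(\<Sum>q\<in>{1..L}. ?d x q) = ?d x s + (?d x t + (\<Sum>q\<in>W. ?d x q))"
          using t(2) \<open>finite W\<close> \<open>s \<notin> W\<close> \<open>t \<notin> W\<close> by (simp only:) simp
        then show ?thesis using sum_step[of L k x] L by simp
      qed
      have dbl: "[2 * ?d x r = - (\<Sum>q\<in>W. ?d x q)] (mod int n)" if "x \<in> Q" for x
      proof -
        have "[?d x s + ?d x t = ?d x r + ?d x r] (mod int n)" using dr[OF that] by (rule cong_add)
        moreover have "?d x s + ?d x t = - (\<Sum>q\<in>W. ?d x q)" using sum0[of x] by linarith
        ultimately have "[- (\<Sum>q\<in>W. ?d x q) = 2 * ?d x r] (mod int n)" by simp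
        then show ?thesis by (rule cong_sym)
      qed
      have "[(\<Sum>q\<in>W. ?d i q) = (\<Sum>q\<in>W. ?d j q)] (mod int n)" using agreeW by (rule cong_sum)
      then have "[- (\<Sum>q\<in>W. ?d i q) = - (\<Sum>q\<in>W. ?d j q)] (mod int n)" by (simp add: cong_minus_minus_iff)
      then have "[2 * ?d i r = 2 * ?d j r] (mod int n)"
        using dbl[OF i] dbl[OF j] by (meson cong_sym cong_trans)
      then have ar: "[?d i r = ?d j r] (mod int n)" using half by (rule cong_halve[OF \<open>0 < n\<close>])
      show "[?d i q = ?d j q] (mod int n)"
      proof (cases "q \<in> W")
        case True
        then show ?thesis by (rule agreeW)
      next
        case False
        then have "f q = r" using q ft by (auto simp: W_def r_def)
        then show ?thesis using agree_f[OF i j q] ar by simp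
      qed
    qed (use Q Rfin assms(3,4) L in auto)
    also have "Suc (card (R - {r})) = h"
      using card_Suc_Diff1[OF Rfin r(1)] cardR by simp
    finally show ?thesis .
  qed
qed simp

lemma card_degenerate_le:
  assumes L: "L = 2 * h" "1 \<le> h" and "0 < k" "0 < n"
  shows "card {i \<in> walks L (k * n). no_lonely_step k n L i \<and> \<not> generic k n L i} \<le>
    L ^ L * 2 ^ L * (2 * k ^ L * n ^ h)"
proof -
  define B where "B = {i \<in> walks L (k * n). no_lonely_step k n L i \<and> \<not> generic k n L i}"
  \<comment> \<open>The pattern of a walk; the number of patterns depends on \<open>L\<close> only.\<close>
  define code where "code i = (\<lambda>s\<in>{1..L}. class_rep k n L i s,
    \<lambda>s\<in>{1..L}. [bstep k L i s = bstep k L i (class_rep k n L i s)] (mod int n))" for i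
  define T where "T = ({1..L} \<rightarrow>\<^sub>E {1..L}) \<times> ({1..L} \<rightarrow>\<^sub>E (UNIV :: bool set))"
  have T: "finite T" "card T = L ^ L * 2 ^ L"
    unfolding T_def by (auto simp: card_cartesian_product card_PiE intro!: finite_cartesian_product finite_PiE)
  have code_T: "code i \<in> T" for i
  proof -
    have "(\<lambda>s\<in>{1..L}. class_rep k n L i s) \<in> {1..L} \<rightarrow>\<^sub>E {1..L}"
      using class_rep_prop(1) by (intro restrict_PiE_iff[THEN iffD2]) blast
    then show ?thesis by (simp add: code_def T_def)
  qed
  have "(\<Union>c\<in>T. {i\<in>B. code i = c}) = B" using code_T by blast
  moreover have "card (\<Union>c\<in>T. {i\<in>B. code i = c}) \<le> (\<Sum>c\<in>T. card {i\<in>B. code i = c})"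
    by (rule card_UN_le[OF T(1)])
  ultimately have "card B \<le> (\<Sum>c\<in>T. card {i\<in>B. code i = c})" by (simp only:)
  also have "\<dots> \<le> (\<Sum>c\<in>T. 2 * k ^ L * n ^ h)"
  proof (rule sum_mono)
    fix c assume "c \<in> T"
    obtain f e where c: "c = (f, e)" by (cases c)
    have fe: "class_rep k n L i s = f s" "[bstep k L i s = bstep k L i (f s)] (mod int n) \<longleftrightarrow> e s"
      if "i \<in> {i\<in>B. code i = c}" "s \<in> {1..L}" for i s
    proof -
      have eq: "(\<lambda>s\<in>{1..L}. class_rep k n L i s) = f"
        "(\<lambda>s\<in>{1..L}. [bstep k L i s = bstep k L i (class_rep k n L i s)] (mod int n)) = e"
        using that(1) c by (auto simp: code_def)
      show 1: "class_rep k n L i s = f s" using fun_cong[OF eq(1), of s] that(2) by simp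
      show "[bstep k L i s = bstep k L i (f s)] (mod int n) \<longleftrightarrow> e s"
        using fun_cong[OF eq(2), of s] that(2) 1 by simp
    qed
    show "card {i\<in>B. code i = c} \<le> 2 * k ^ L * n ^ h"
    proof (rule card_pattern_le[OF L assms(3,4), where f = f and e = e])
      show "{i\<in>B. code i = c} \<subseteq> {i \<in> walks L (k * n). no_lonely_step k n L i \<and> \<not> generic k n L i}"
        by (auto simp: B_def)
    qed (rule fe; assumption)+
  qed
  also have "\<dots> = L ^ L * 2 ^ L * (2 * k ^ L * n ^ h)" using T(2) by simp
  finally show ?thesis by (simp add: B_def)
qed

section \<open>The contribution of a word\<close>

text \<open>
  Walks in which the entries at the two positions of every block of \<open>P\<close> are identified in opposite
  orientation, where \<open>mt l\<close> is the identification in the ensemble that the letter \<open>l\<close> stands for.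
\<close>

definition matched :: "nat \<Rightarrow> nat \<Rightarrow> nat \<Rightarrow> (letter \<Rightarrow> nat \<times> nat \<Rightarrow> nat \<times> nat \<Rightarrow> bool) \<Rightarrow>
    (nat \<Rightarrow> letter) \<Rightarrow> nat set set \<Rightarrow> (nat \<Rightarrow> nat) set" where
  "matched k n L mt C P =
     {i \<in> walks L (k * n). \<forall>s\<in>{1..L}. mt (C s) (edge L i s) (edge L i (pairing_perm P s))}"

text \<open>
  The expectation of the product of the entries along the walk, when \<open>X La\<close> and \<open>X Lb\<close> are
  independent.
\<close>

definition walk_value :: "'w measure \<Rightarrow> (letter \<Rightarrow> 'w \<Rightarrow> real mat) \<Rightarrow> nat \<Rightarrow> (nat \<Rightarrow> letter) \<Rightarrow>
    (nat \<Rightarrow> nat) \<Rightarrow> real" where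
  "walk_value M X L C i = walk_moment M (X La) (positions L C La) (edge L i) *
     walk_moment M (X Lb) (positions L C Lb) (edge L i)"

lemma opp_entry_imp_opp_block: "opp_entry x y \<Longrightarrow> opp_block k n x y"
  by (simp add: opp_entry_def opp_block_def bdiff_def)

lemma edge_in: "i \<in> walks L N \<Longrightarrow> s \<in> {1..L} \<Longrightarrow> edge L i s \<in> {..<N} \<times> {..<N}"
  using walks_less[of i L N s] walks_less[of i L N "cnext L s"] cnext_in[of s L] by (simp add: edge_def)

lemma wick_walk:
  fixes C :: "nat \<Rightarrow> letter" and l :: letter
  assumes w: "wick M k n L K mt A" and i: "i \<in> walks L (k * n)"
  defines "S \<equiv> positions L C l"
  shows "integrable M (\<lambda>\<omega>. \<Prod>s\<in>S. A \<omega> $$ edge L i s)"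
    and "\<bar>walk_moment M A S (edge L i)\<bar> \<le> K"
    and "s \<in> S \<Longrightarrow> (\<And>t. t \<in> S \<Longrightarrow> t \<noteq> s \<Longrightarrow> \<not> mt (edge L i s) (edge L i t) \<and>
        \<not> mt (edge L i s) (prod.swap (edge L i t))) \<Longrightarrow> walk_moment M A S (edge L i) = 0"
    and "(\<And>s. s \<in> S \<Longrightarrow> \<tau> s \<in> S \<and> \<tau> s \<noteq> s \<and> mt (edge L i s) (edge L i (\<tau> s)) \<and>
               \<not> [2 * bstep k L i s = 0] (mod int n) \<and>
               (\<forall>t\<in>S. t \<noteq> s \<and> t \<noteq> \<tau> s \<longrightarrow> \<not> mt (edge L i s) (edge L i t) \<and>
                  \<not> mt (edge L i s) (prod.swap (edge L i t)))) \<Longrightarrow> walk_moment M A S (edge L i) = 1"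
proof -
  have S: "S \<subseteq> {1..L}" by (auto simp: S_def positions_def)
  then have "finite S" "card S \<le> L" using card_mono[of "{1..L}" S] finite_subset by auto
  moreover have "\<forall>s\<in>S. edge L i s \<in> {..<k * n} \<times> {..<k * n}"
    using S edge_in[OF i] by blast
  ultimately have c: "finite S \<and> card S \<le> L \<and> (\<forall>s\<in>S. edge L i s \<in> {..<k * n} \<times> {..<k * n})"
    by (intro conjI)
  note * = w[unfolded wick_def, rule_format, OF c, folded walk_moment_def]
  show "integrable M (\<lambda>\<omega>. \<Prod>s\<in>S. A \<omega> $$ edge L i s)" "\<bar>walk_moment M A S (edge L i)\<bar> \<le> K"
    by (rule *[THEN conjunct1], rule *[THEN conjunct2, THEN conjunct1])
  show "walk_moment M A S (edge L i) = 0" if "s \<in> S" "\<And>t. t \<in> S \<Longrightarrow> t \<noteq> s \<Longrightarrow>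
      \<not> mt (edge L i s) (edge L i t) \<and> \<not> mt (edge L i s) (prod.swap (edge L i t))"
  proof -
    have "\<exists>s\<in>S. \<forall>t\<in>S. t \<noteq> s \<longrightarrow> \<not> mt (edge L i s) (edge L i t) \<and> \<not> mt (edge L i s) (prod.swap (edge L i t))"
      using that by (intro bexI[of _ s] ballI impI) auto
    then show ?thesis by (rule *[THEN conjunct2, THEN conjunct2, THEN conjunct1, THEN mp])
  qed
  show "walk_moment M A S (edge L i) = 1" if "\<And>s. s \<in> S \<Longrightarrow> \<tau> s \<in> S \<and> \<tau> s \<noteq> s \<and> mt (edge L i s) (edge L i (\<tau> s)) \<and>
               \<not> [2 * bstep k L i s = 0] (mod int n) \<and>
               (\<forall>t\<in>S. t \<noteq> s \<and> t \<noteq> \<tau> s \<longrightarrow> \<not> mt (edge L i s) (edge L i t) \<and>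
                  \<not> mt (edge L i s) (prod.swap (edge L i t)))"
  proof -
    have "\<forall>s\<in>S. \<tau> s \<in> S \<and> \<tau> s \<noteq> s \<and> mt (edge L i s) (edge L i (\<tau> s)) \<and>
               \<not> [2 * bdiff k (edge L i s) = 0] (mod int n) \<and>
               (\<forall>t\<in>S. t \<noteq> s \<and> t \<noteq> \<tau> s \<longrightarrow> \<not> mt (edge L i s) (edge L i t) \<and>
                  \<not> mt (edge L i s) (prod.swap (edge L i t)))"
      using that unfolding bstep_def by (rule ballI)
    then show ?thesis by (rule *[THEN conjunct2, THEN conjunct2, THEN conjunct2, THEN spec, THEN mp])
  qed
qed

lemma walk_value_bound:
  assumes w: "\<And>l. wick M k n L (K l) (mt l) (X l)" and i: "i \<in> walks L (k * n)"
  shows "\<bar>walk_value M X L C i\<bar> \<le> K La * K Lb"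
  unfolding walk_value_def abs_mult
  using wick_walk(2)[OF w[of La] i, of C La] wick_walk(2)[OF w[of Lb] i, of C Lb] by (intro mult_mono) auto

lemma walk_value_eq_0:
  assumes w: "\<And>l. wick M k n L (K l) (mt l) (X l)" and i: "i \<in> walks L (k * n)"
    and s: "s \<in> {1..L}" and lonely: "\<And>t. t \<in> {1..L} \<Longrightarrow> t \<noteq> s \<Longrightarrow> C t = C s \<Longrightarrow>
      \<not> mt (C s) (edge L i s) (edge L i t) \<and> \<not> mt (C s) (edge L i s) (prod.swap (edge L i t))"
  shows "walk_value M X L C i = 0"
proof -
  have "walk_moment M (X (C s)) (positions L C (C s)) (edge L i) = 0"
  proof (rule wick_walk(3)[OF w[of "C s"] i])
    show "s \<in> positions L C (C s)" using s by (simp add: positions_def)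
    fix t assume "t \<in> positions L C (C s)" "t \<noteq> s"
    then show "\<not> mt (C s) (edge L i s) (edge L i t) \<and> \<not> mt (C s) (edge L i s) (prod.swap (edge L i t))"
      by (intro lonely) (auto simp: positions_def)
  qed
  then show ?thesis by (cases "C s") (simp_all add: walk_value_def)
qed

lemma relation_pm_cong:
  assumes "mt = opp_block k n \<or> mt = opp_entry"
  shows "mt (edge L i s) (edge L i t) \<Longrightarrow> [bstep k L i s = - bstep k L i t] (mod int n)"
    and "mt (edge L i s) (prod.swap (edge L i t)) \<Longrightarrow> [bstep k L i s = bstep k L i t] (mod int n)"
    and "mt (edge L i s) (edge L i t) \<or> mt (edge L i s) (prod.swap (edge L i t)) \<Longrightarrow>
      pm_cong n (bstep k L i s) (bstep k L i t)"
proof -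
  have ob: "opp_block k n x y" if "mt x y" for x y
    using assms that opp_entry_imp_opp_block by blast
  show 1: "[bstep k L i s = - bstep k L i t] (mod int n)" if "mt (edge L i s) (edge L i t)"
    using ob[OF that] cong_neg_swap by (simp add: opp_block_edge)
  show 2: "[bstep k L i s = bstep k L i t] (mod int n)" if "mt (edge L i s) (prod.swap (edge L i t))"
  proof -
    have "[- bdiff k (edge L i t) = - bdiff k (edge L i s)] (mod int n)"
      using ob[OF that] by (simp add: opp_block_def bdiff_def)
    then show ?thesis by (simp add: bstep_def cong_minus_minus_iff cong_sym)
  qed
  show "pm_cong n (bstep k L i s) (bstep k L i t)"
    if "mt (edge L i s) (edge L i t) \<or> mt (edge L i s) (prod.swap (edge L i t))"
    using that 1 2 by (auto simp: pm_cong_def)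
qed

lemma generic_partner:
  assumes g: "generic k n L i" and s: "s \<in> {1..L}"
    and a: "a \<in> {1..L}" "a \<noteq> s" "pm_cong n (bstep k L i s) (bstep k L i a)"
  shows "\<not> [bstep k L i s = bstep k L i a] (mod int n)"
    and "b \<in> {1..L} \<Longrightarrow> b \<noteq> s \<Longrightarrow> pm_cong n (bstep k L i s) (bstep k L i b) \<Longrightarrow> b = a"
proof -
  obtain t where t: "\<not> [bstep k L i s = bstep k L i t] (mod int n)"
    "\<And>r. r \<in> {1..L} \<Longrightarrow> r \<noteq> s \<Longrightarrow> r \<noteq> t \<Longrightarrow> \<not> pm_cong n (bstep k L i s) (bstep k L i r)"
    using bspec[OF g[unfolded generic_def] s] by blast
  have at: "a = t" using t(2)[OF a(1,2)] a(3) by blast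
  then show "\<not> [bstep k L i s = bstep k L i a] (mod int n)" using t(1) by simp
  show "b = a" if "b \<in> {1..L}" "b \<noteq> s" "pm_cong n (bstep k L i s) (bstep k L i b)"
    using t(2)[OF that(1,2)] that(3) at by blast
qed

lemma config_pairing_letter:
  assumes "P \<in> config_pairings m C" "s \<in> {1..4 * m}"
  shows "C (pairing_perm P s) = C s"
proof -
  have "P \<in> pairings (4 * m)" using assms(1) by (simp add: config_pairings_def)
  then have "{s, pairing_perm P s} \<in> P" using assms(2) by (rule pairing_perm_block)
  then show ?thesis using assms(1) by (auto simp: config_pairings_def monochromatic_def)
qed

text \<open>
  For a generic walk the partner of each position is unique, so at most one pairing can match the walk;
  if there is none, then some entry occurs only once.
\<close>

lemma walk_value_generic:
  fixes m :: nat
  defines "L \<equiv> 4 * m"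
  assumes w: "\<And>l. wick M k n L (K l) (mt l) (X l)" and i: "i \<in> walks L (k * n)"
    and mt: "\<And>l. mt l = opp_block k n \<or> mt l = opp_entry"
    and g: "generic k n L i"
  shows "walk_value M X L C i = real (card {P \<in> config_pairings m C. i \<in> matched k n L mt C P})"
proof (cases "\<exists>P \<in> config_pairings m C. i \<in> matched k n L mt C P")
  case True
  then obtain P where P: "P \<in> config_pairings m C" and iP: "i \<in> matched k n L mt C P" by blast
  have pair: "Q \<in> pairings L" if "Q \<in> config_pairings m C" for Q
    using that by (simp add: config_pairings_def L_def)
  note \<tau> = matchingD[OF matching_pairing_perm[OF pair]]
  let ?\<tau> = "pairing_perm P"
  have mm: "mt (C s) (edge L i s) (edge L i (pairing_perm Q s))"
    if "s \<in> {1..L}" "i \<in> matched k n L mt C Q" for Q s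
    using that by (simp add: matched_def)
  have pm: "pm_cong n (bstep k L i s) (bstep k L i (pairing_perm Q s))"
    if "s \<in> {1..L}" "i \<in> matched k n L mt C Q" for Q s
    using mm[OF that] by (intro relation_pm_cong(3)[OF mt]) blast
  have "Q = P" if Q: "Q \<in> config_pairings m C" "i \<in> matched k n L mt C Q" for Q
  proof (rule pairing_eqI[OF pair[OF Q(1)] pair[OF P]])
    fix s assume s: "s \<in> {1..L}"
    show "pairing_perm Q s = ?\<tau> s"
      by (rule generic_partner(2)[OF g s \<tau>(1)[OF P s] \<tau>(2)[OF P s] pm[OF s iP]
            \<tau>(1)[OF Q(1) s] \<tau>(2)[OF Q(1) s] pm[OF s Q(2)]])
  qed
  then have "{P \<in> config_pairings m C. i \<in> matched k n L mt C P} = {P}" using P iP by blast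
  moreover have "walk_moment M (X l) (positions L C l) (edge L i) = 1" for l
  proof (rule wick_walk(4)[OF w[of l] i, where \<tau> = ?\<tau>], intro conjI ballI impI)
    fix s assume "s \<in> positions L C l"
    then have s: "s \<in> {1..L}" "C s = l" by (simp_all add: positions_def)
    note t = \<tau>(1)[OF P s(1)] \<tau>(2)[OF P s(1)]
    show "?\<tau> s \<in> positions L C l"
      using t config_pairing_letter[OF P, of s] s by (simp add: positions_def L_def)
    show "?\<tau> s \<noteq> s" by (rule t)
    show ms: "mt l (edge L i s) (edge L i (?\<tau> s))" using mm[OF s(1) iP] s(2) by simp
    show "\<not> [2 * bstep k L i s = 0] (mod int n)"
    proof
      assume "[2 * bstep k L i s = 0] (mod int n)"
      then have "[bstep k L i s = - bstep k L i s] (mod int n)" by (simp add: cong_iff_dvd_diff)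
      moreover have "[- bstep k L i s = bstep k L i (?\<tau> s)] (mod int n)"
        using relation_pm_cong(1)[OF mt ms] cong_neg_swap by (metis cong_sym)
      ultimately have "[bstep k L i s = bstep k L i (?\<tau> s)] (mod int n)" by (rule cong_trans)
      then show False using generic_partner(1)[OF g s(1) t pm[OF s(1) iP]] by blast
    qed
    fix r assume "r \<in> positions L C l" and r: "r \<noteq> s \<and> r \<noteq> ?\<tau> s"
    then have rL: "r \<in> {1..L}" by (simp add: positions_def)
    have "\<not> pm_cong n (bstep k L i s) (bstep k L i r)"
      using generic_partner(2)[OF g s(1) t pm[OF s(1) iP] rL] r by blast
    then show "\<not> mt l (edge L i s) (edge L i r)" "\<not> mt l (edge L i s) (prod.swap (edge L i r))"
      using relation_pm_cong(3)[OF mt] by blast+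
  qed
  ultimately show ?thesis by (simp add: walk_value_def)
next
  case False
  then have empty: "{P \<in> config_pairings m C. i \<in> matched k n L mt C P} = {}" by blast
  have "walk_value M X L C i = 0"
  proof (rule ccontr)
    assume nz: "walk_value M X L C i \<noteq> 0"
    have "\<exists>t\<in>{1..L}. t \<noteq> s \<and> C t = C s \<and> mt (C s) (edge L i s) (edge L i t)" if s: "s \<in> {1..L}" for s
    proof -
      obtain t where t: "t \<in> {1..L}" "t \<noteq> s" "C t = C s"
        "mt (C s) (edge L i s) (edge L i t) \<or> mt (C s) (edge L i s) (prod.swap (edge L i t))"
      proof (rule ccontr)
        assume no: "\<not> thesis"
        have "walk_value M X L C i = 0"
          by (rule walk_value_eq_0[of M k n L K mt X, OF w i s]) (use no that in blast)
        with nz show False by simp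
      qed
      have "\<not> [bstep k L i s = bstep k L i t] (mod int n)"
        by (rule generic_partner(1)[OF g s t(1,2) relation_pm_cong(3)[OF mt t(4)]])
      then have "\<not> mt (C s) (edge L i s) (prod.swap (edge L i t))"
        using relation_pm_cong(2)[OF mt] by blast
      then show ?thesis using t by blast
    qed
    then obtain \<tau> where \<tau>: "\<And>s. s \<in> {1..L} \<Longrightarrow> \<tau> s \<in> {1..L}" "\<And>s. s \<in> {1..L} \<Longrightarrow> \<tau> s \<noteq> s"
      "\<And>s. s \<in> {1..L} \<Longrightarrow> C (\<tau> s) = C s" "\<And>s. s \<in> {1..L} \<Longrightarrow> mt (C s) (edge L i s) (edge L i (\<tau> s))"
      by metis
    have pm: "pm_cong n (bstep k L i s) (bstep k L i (\<tau> s))" if "s \<in> {1..L}" for s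
      using \<tau>(4)[OF that] by (intro relation_pm_cong(3)[OF mt]) blast
    have invol: "\<tau> (\<tau> s) = s" if s: "s \<in> {1..L}" for s
    proof (rule generic_partner(2)[OF g \<tau>(1)[OF s] s])
      show "s \<noteq> \<tau> s" using \<tau>(2)[OF s] by simp
      show "pm_cong n (bstep k L i (\<tau> s)) (bstep k L i s)" using pm[OF s] pm_cong_sym by blast
    qed (use \<tau>(1,2)[OF \<tau>(1)[OF s]] pm[OF \<tau>(1)[OF s]] in blast)+
    have match: "matching L \<tau>" unfolding matching_def by (intro ballI conjI \<tau> invol)
    define P where "P = (\<lambda>s. {s, \<tau> s}) ` {1..L}"
    have P: "P \<in> pairings L" "\<And>s. s \<in> {1..L} \<Longrightarrow> pairing_perm P s = \<tau> s"
      unfolding P_def by (rule pairing_of_matching[OF match], rule pairing_of_matching(2)[OF match])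
    have "monochromatic C La V \<or> monochromatic C Lb V" if V: "V \<in> P" for V
    proof -
      obtain s where s: "s \<in> {1..L}" "V = {s, \<tau> s}" using V unfolding P_def by blast
      have "monochromatic C (C s) V" using \<tau>(3)[OF s(1)] s(2) by (simp add: monochromatic_def)
      then show ?thesis by (cases "C s") simp_all
    qed
    then have "P \<in> config_pairings m C" using P(1) by (simp add: config_pairings_def L_def)
    moreover have "i \<in> matched k n L mt C P" using i \<tau>(4) P(2) by (simp add: matched_def)
    ultimately show False using False by blast
  qed
  then show ?thesis unfolding empty by simp
qed

lemma finite_config_pairings: "finite (config_pairings m C)"
  by (rule finite_subset[OF _ finite_pairings[of "4 * m"]]) (auto simp: config_pairings_def)

lemma lonely_value:
  fixes m :: nat
  defines "L \<equiv> 4 * m"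
  assumes w: "\<And>l. wick M k n L (K l) (mt l) (X l)" and i: "i \<in> walks L (k * n)"
    and mt: "\<And>l. mt l = opp_block k n \<or> mt l = opp_entry"
    and ln: "\<not> no_lonely_step k n L i"
  shows "walk_value M X L C i = 0" "P \<in> config_pairings m C \<Longrightarrow> i \<notin> matched k n L mt C P"
proof -
  obtain s where s: "s \<in> {1..L}"
    "\<And>t. t \<in> {1..L} \<Longrightarrow> t \<noteq> s \<Longrightarrow> \<not> pm_cong n (bstep k L i s) (bstep k L i t)"
    using ln unfolding no_lonely_step_def by blast
  show "walk_value M X L C i = 0"
  proof (rule walk_value_eq_0[OF w i s(1)])
    fix t assume "t \<in> {1..L}" "t \<noteq> s"
    then have "\<not> pm_cong n (bstep k L i s) (bstep k L i t)" by (rule s(2))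
    then show "\<not> mt (C s) (edge L i s) (edge L i t) \<and> \<not> mt (C s) (edge L i s) (prod.swap (edge L i t))"
      using relation_pm_cong(3)[OF mt] by blast
  qed
  show "i \<notin> matched k n L mt C P" if P: "P \<in> config_pairings m C"
  proof
    assume "i \<in> matched k n L mt C P"
    then have "mt (C s) (edge L i s) (edge L i (pairing_perm P s))" using s(1) by (simp add: matched_def)
    then have "pm_cong n (bstep k L i s) (bstep k L i (pairing_perm P s))"
      by (intro relation_pm_cong(3)[OF mt]) blast
    moreover have "P \<in> pairings L" using P by (simp add: config_pairings_def L_def)
    then have "pairing_perm P s \<in> {1..L}" "pairing_perm P s \<noteq> s"
      using matchingD[OF matching_pairing_perm s(1)] by blast+
    ultimately show False using s(2) by blast
  qed
qed

text \<open>
  Only walks without lonely steps that are not generic contribute to the difference, and there are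
  few of them.
\<close>

lemma sum_walk_value_approx:
  fixes m :: nat
  defines "L \<equiv> 4 * m"
  assumes w: "\<And>l. wick M k n L (K l) (mt l) (X l)"
    and mt: "\<And>l. mt l = opp_block k n \<or> mt l = opp_entry"
    and pos: "1 \<le> m" "0 < k" "0 < n"
  shows "\<bar>(\<Sum>i\<in>walks L (k * n). walk_value M X L C i) -
      (\<Sum>P\<in>config_pairings m C. real (card (matched k n L mt C P)))\<bar> \<le>
    (K La * K Lb + real (card (config_pairings m C))) * real (L ^ L * 2 ^ L * (2 * k ^ L)) * real n ^ (2 * m)"
proof -
  let ?W = "walks L (k * n)" and ?CP = "config_pairings m C"
  let ?B = "{i \<in> ?W. no_lonely_step k n L i \<and> \<not> generic k n L i}"
  let ?c = "K La * K Lb + real (card ?CP)"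
  define N where "N i = real (card {P \<in> ?CP. i \<in> matched k n L mt C P})" for i
  have c0: "0 \<le> ?c"
  proof -
    have "0 \<le> K l" for l
    proof -
      \<comment> \<open>The bound applies to the constant walk, hence is not negative.\<close>
      have "(\<lambda>s\<in>{1..L}. 0) \<in> ?W" using pos by (auto simp: walks_def)
      from wick_walk(2)[OF w[of l] this, of "\<lambda>_. l" l] show ?thesis by linarith
    qed
    then show ?thesis by simp
  qed
  \<comment> \<open>Counting the pairs of a pairing and a walk matched by it in both orders.\<close>
  have swap: "(\<Sum>P\<in>?CP. real (card (matched k n L mt C P))) = (\<Sum>i\<in>?W. N i)"
  proof -
    have "real (card (matched k n L mt C P)) = (\<Sum>i\<in>?W. of_bool (i \<in> matched k n L mt C P))" for P
    proof -
      have "matched k n L mt C P = {i \<in> ?W. i \<in> matched k n L mt C P}" by (auto simp: matched_def)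
      then show ?thesis by (simp add: sum.If_cases of_bool_def Int_def)
    qed
    then have "(\<Sum>P\<in>?CP. real (card (matched k n L mt C P))) =
        (\<Sum>P\<in>?CP. \<Sum>i\<in>?W. of_bool (i \<in> matched k n L mt C P))" by simp
    also have "\<dots> = (\<Sum>i\<in>?W. \<Sum>P\<in>?CP. of_bool (i \<in> matched k n L mt C P))" by (rule sum.swap)
    also have "\<dots> = (\<Sum>i\<in>?W. N i)"
      by (simp add: N_def of_bool_def sum.If_cases finite_config_pairings Int_def)
    finally show ?thesis .
  qed
  have N_le: "N i \<le> real (card ?CP)" for i
    unfolding N_def by (intro of_nat_mono card_mono finite_config_pairings) auto
  have "\<bar>(\<Sum>i\<in>?W. walk_value M X L C i) - (\<Sum>i\<in>?W. N i)\<bar> \<le> (\<Sum>i\<in>?W. \<bar>walk_value M X L C i - N i\<bar>)"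
    unfolding sum_subtractf[symmetric] by (rule sum_abs)
  also have "\<dots> \<le> (\<Sum>i\<in>?W. if i \<in> ?B then ?c else 0)"
  proof (rule sum_mono)
    fix i assume i: "i \<in> ?W"
    consider "generic k n L i" | "\<not> no_lonely_step k n L i" | "i \<in> ?B" using i by blast
    then show "\<bar>walk_value M X L C i - N i\<bar> \<le> (if i \<in> ?B then ?c else 0)"
    proof cases
      case 1
      then show ?thesis
        using walk_value_generic[of M k n m K mt X i C] w mt i by (simp add: N_def L_def)
    next
      case 2
      have "walk_value M X L C i = 0" "\<And>P. P \<in> ?CP \<Longrightarrow> i \<notin> matched k n L mt C P"
        using lonely_value[of M k n m K mt X i] w mt i 2 by (simp_all add: L_def)
      then have "walk_value M X L C i = 0" and empty: "{P \<in> ?CP. i \<in> matched k n L mt C P} = {}" by blast+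
      moreover have "N i = 0" unfolding N_def empty by simp
      ultimately show ?thesis using c0 by simp
    next
      case 3
      have "\<bar>walk_value M X L C i\<bar> \<le> K La * K Lb" by (rule walk_value_bound[OF w i])
      moreover have "0 \<le> N i" by (simp add: N_def)
      ultimately have "\<bar>walk_value M X L C i - N i\<bar> \<le> ?c" using N_le[of i] by linarith
      then show ?thesis using 3 by simp
    qed
  qed
  also have "\<dots> = ?c * real (card ?B)"
    by (simp add: sum.If_cases Int_def conj_ac)
  also have "\<dots> \<le> ?c * real (L ^ L * 2 ^ L * (2 * k ^ L * n ^ (2 * m)))"
    using card_degenerate_le[of L "2 * m" k n] pos c0
    by (intro mult_left_mono of_nat_mono) (auto simp: L_def)
  finally show ?thesis unfolding swap by (simp add: mult_ac)
qed

section \<open>The limit\<close>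

lemma full_matched_count:
  assumes P: "P \<in> pairings (4 * m)" and "1 \<le> m" "0 < k" "0 < n"
  shows "card (block_matched k n (4 * m) (pairing_perm P)) =
    n ^ Suc (2 * m) * k ^ num_cycles (4 * m) (full_cycle (4 * m) \<circ> pairing_perm P)"
proof -
  let ?L = "4 * m" and ?\<tau> = "pairing_perm P"
  have \<tau>: "matching ?L ?\<tau>" by (rule matching_pairing_perm[OF P])
  have "{u \<in> {1..?L} \<rightarrow>\<^sub>E {..<k}. \<forall>s\<in>{1..?L}. u s = u (cnext ?L (?\<tau> s))} =
      {u \<in> {1..?L} \<rightarrow>\<^sub>E {..<k}. \<forall>s\<in>{1..?L}. u s = u ((full_cycle ?L \<circ> ?\<tau>) s)}"
  proof -
    have "cnext ?L (?\<tau> s) = (full_cycle ?L \<circ> ?\<tau>) s" if "s \<in> {1..?L}" for s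
      unfolding o_def by (rule full_cycle_eq(1)[OF matchingD(1)[OF \<tau> that], symmetric])
    then show ?thesis by (intro Collect_cong conj_cong ball_cong refl) simp
  qed
  then show ?thesis
    using card_block_matched[OF \<tau>, of "2 * m" k n] assms(2-4)
      card_invariant_functions[OF permutes_cycle_matching[OF P], of k]
    by (simp add: num_cycles_def)
qed

lemma matched_block:
  "(\<And>l. mt l = opp_block k n) \<Longrightarrow> matched k n L mt C P = block_matched k n L (pairing_perm P)"
  by (simp add: matched_def block_matched_def)

text \<open>
  The identifications when \<open>a\<close> stands for the GOE and \<open>b\<close> for the block circulant ensemble.
\<close>

abbreviation goe_relation :: "nat \<Rightarrow> nat \<Rightarrow> letter \<Rightarrow> nat \<times> nat \<Rightarrow> nat \<times> nat \<Rightarrow> bool" where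
  "goe_relation k n \<equiv> case_letter opp_entry (opp_block k n)"

lemma goe_relation_block: "goe_relation k n l x y \<Longrightarrow> opp_block k n x y"
  by (cases l) (auto intro: opp_entry_imp_opp_block)

lemma matched_goe_sub: "matched k n L (goe_relation k n) C P \<subseteq> block_matched k n L (pairing_perm P)"
  unfolding matched_def block_matched_def using goe_relation_block by fast

text \<open>
  A non-crossing block \<open>{s, \<pi> s}\<close> of GOE positions encloses whole blocks.
\<close>

lemma nc_interval_closed:
  assumes P: "P \<in> nc_config_pairings m C" and s: "s \<in> {1..4 * m}" "C s = La" "s < pairing_perm P s"
    and r: "r \<in> {s..pairing_perm P s}"
  shows "pairing_perm P r \<in> {s..pairing_perm P s}"
proof (rule ccontr)
  assume out: "pairing_perm P r \<notin> {s..pairing_perm P s}"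
  have cp: "P \<in> config_pairings m C" and pr: "P \<in> pairings (4 * m)"
    using P by (auto simp: nc_config_pairings_def config_pairings_def)
  let ?\<tau> = "pairing_perm P"
  note m = matchingD[OF matching_pairing_perm[OF pr]]
  have rL: "r \<in> {1..4 * m}" using r s(1) m(1)[OF s(1)] by auto
  have ne: "r \<noteq> s" "r \<noteq> ?\<tau> s" using out s m(3)[OF s(1)] by auto
  let ?V = "{r, ?\<tau> r}" and ?W = "{s, ?\<tau> s}"
  have VW: "?V \<in> P" "?W \<in> P" using pairing_perm_block[OF pr] rL s(1) by auto
  have mW: "monochromatic C La ?W"
    using config_pairing_letter[OF cp s(1)] s(2) by (simp add: monochromatic_def)
  have mV: "monochromatic C La ?V \<or> monochromatic C Lb ?V"
    using cp VW(1) unfolding config_pairings_def by blast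
  have "\<not> crosses ?V ?W" using P VW mW mV unfolding nc_config_pairings_def by blast
  moreover have "crosses ?V ?W"
  proof (cases "?\<tau> r < s")
    case True
    have "?\<tau> r < s \<and> s < r \<and> r < ?\<tau> s" using True r ne by auto
    then show ?thesis unfolding crosses_def by blast
  next
    case False
    then have "s < r \<and> r < ?\<tau> s \<and> ?\<tau> s < ?\<tau> r" using out r ne by auto
    then show ?thesis unfolding crosses_def by blast
  qed
  ultimately show False by blast
qed

lemma matched_goe_nc:
  assumes P: "P \<in> nc_config_pairings m C"
  shows "matched k n (4 * m) (goe_relation k n) C P = block_matched k n (4 * m) (pairing_perm P)"
proof (rule equalityI[OF matched_goe_sub subsetI])
  let ?L = "4 * m" and ?\<tau> = "pairing_perm P"
  have cp: "P \<in> config_pairings m C" and pr: "P \<in> pairings ?L"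
    using P by (auto simp: nc_config_pairings_def config_pairings_def)
  have \<tau>: "matching ?L ?\<tau>" by (rule matching_pairing_perm[OF pr])
  note m = matchingD[OF \<tau>]
  fix i assume i: "i \<in> block_matched k n ?L ?\<tau>"
  have entry: "i s = i (cnext ?L (?\<tau> s)) \<and> i (cnext ?L s) = i (?\<tau> s)"
    if s: "s \<in> {1..?L}" "C s = La" "s < ?\<tau> s" for s
    using block_matched_opp_entry[OF \<tau> i s(1,3) nc_interval_closed[OF P s]] by blast
  have "goe_relation k n (C s) (edge ?L i s) (edge ?L i (?\<tau> s))" if s: "s \<in> {1..?L}" for s
  proof (cases "C s")
    case La
    have "i s = i (cnext ?L (?\<tau> s)) \<and> i (cnext ?L s) = i (?\<tau> s)"
    proof (cases "s < ?\<tau> s")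
      case True
      then show ?thesis by (rule entry[OF s La])
    next
      case False
      then have "?\<tau> s < ?\<tau> (?\<tau> s)" using m(2,3)[OF s] by simp
      moreover have "C (?\<tau> s) = La" using config_pairing_letter[OF cp s] La by simp
      ultimately show ?thesis using entry[OF m(1)[OF s]] m(3)[OF s] by auto
    qed
    then show ?thesis using La by (simp add: opp_entry_def edge_def)
  next
    case Lb
    then show ?thesis using i s by (simp add: block_matched_def)
  qed
  then show "i \<in> matched k n ?L (goe_relation k n) C P"
    using i by (simp add: matched_def block_matched_def)
qed

lemma crossing_witness:
  assumes cp: "P \<in> config_pairings m C" and nnc: "P \<notin> nc_config_pairings m C"
  obtains s v where "s \<in> {1..4 * m}" "C s = La" "s < v" "v < pairing_perm P s"
    "pairing_perm P v \<notin> {s..pairing_perm P s}"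
proof -
  have pr: "P \<in> pairings (4 * m)" using cp by (simp add: config_pairings_def)
  obtain V W where VW: "V \<in> P" "W \<in> P" "monochromatic C La W" "crosses V W"
    using cp nnc unfolding nc_config_pairings_def by blast
  have other: "pairing_perm P x = y" if "U \<in> P" "x \<in> U" "y \<in> U" "x \<noteq> y" for U x y
    using pairing_block_eq(1)[OF pr that(1,2)] that(3,4) by blast
  have in_L: "x \<in> {1..4 * m}" if "x \<in> W" for x
    using pairing_block_eq(2)[OF pr VW(2) that] .
  from VW(4) consider
    (left) i j l' l where "i \<in> V" "j \<in> W" "l' \<in> V" "l \<in> W" "i < j" "j < l'" "l' < l"
    | (right) i j l' l where "i \<in> W" "j \<in> V" "l' \<in> W" "l \<in> V" "i < j" "j < l'" "l' < l"
    unfolding crosses_def by blast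
  then show ?thesis
  proof cases
    case left
    have "pairing_perm P j = l" using other[OF VW(2)] left by simp
    moreover have "pairing_perm P l' = i" using other[OF VW(1)] left by simp
    moreover have "C j = La" using VW(3) left by (simp add: monochromatic_def)
    ultimately show ?thesis using left in_L[of j] by (intro that[of j l']) auto
  next
    case right
    have "pairing_perm P i = l'" using other[OF VW(2)] right by simp
    moreover have "pairing_perm P j = l" using other[OF VW(1)] right by simp
    moreover have "C i = La" using VW(3) right by (simp add: monochromatic_def)
    ultimately show ?thesis using right in_L[of i] by (intro that[of i j]) auto
  qed
qed

lemma card_matched_crossing:
  assumes cp: "P \<in> config_pairings m C" and nnc: "P \<notin> nc_config_pairings m C"
    and "1 \<le> m" "0 < k" "0 < n"
  shows "card (matched k n (4 * m) (goe_relation k n) C P) \<le> 2 * k ^ (4 * m) * n ^ (2 * m)"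
proof -
  obtain s v where sv: "s \<in> {1..4 * m}" "C s = La" "s < v" "v < pairing_perm P s"
    "pairing_perm P v \<notin> {s..pairing_perm P s}"
    using crossing_witness[OF cp nnc] .
  have pr: "P \<in> pairings (4 * m)" using cp by (simp add: config_pairings_def)
  show ?thesis
  proof (rule card_crossing_le[OF matching_pairing_perm[OF pr] _ _ assms(4,5) sv(1,3-5) matched_goe_sub])
    fix i assume "i \<in> matched k n (4 * m) (goe_relation k n) C P"
    then have "goe_relation k n (C s) (edge (4 * m) i s) (edge (4 * m) i (pairing_perm P s))"
      using sv(1) by (simp add: matched_def)
    then show "i s = i (cnext (4 * m) (pairing_perm P s))"
      using sv(2) by (simp add: opp_entry_def edge_def)
  qed (use assms(3) in auto)
qed

lemma anticomm_moment_eq: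
  assumes "prob_space M" and ind: "indep_matrices M (k * n) (X La) (X Lb)"
    and car: "\<And>l \<omega>. \<omega> \<in> space M \<Longrightarrow> X l \<omega> \<in> carrier_mat (k * n) (k * n)"
    and w: "\<And>l. wick M k n (2 * j) (K l) (mt l) (X l)" and "1 \<le> j"
  shows "anticomm_moment M (k * n) j (X La) (X Lb) =
    (\<Sum>C\<in>words j. \<Sum>i\<in>walks (2 * j) (k * n). walk_value M X (2 * j) C i) / real (k * n) ^ Suc j"
proof -
  interpret prob_space M by fact
  let ?L = "2 * j"
  let ?p = "\<lambda>C i \<omega>. \<Prod>s\<in>{1..?L}. case_letter (X La \<omega>) (X Lb \<omega>) (C s) $$ edge ?L i s"
  have ex: "integrable M (?p C i)" "expectation (?p C i) = walk_value M X ?L C i"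
    if i: "i \<in> walks ?L (k * n)" for C i
    unfolding walk_value_def
    by (rule expectation_walk[OF \<open>prob_space M\<close> ind edge_in[OF i] wick_walk(1)[OF w[of La] i]
          wick_walk(1)[OF w[of Lb] i]]; assumption)+
  have "expectation (\<lambda>\<omega>. mat_trace (anticommutator (X La \<omega>) (X Lb \<omega>) ^\<^sub>m j)) =
      expectation (\<lambda>\<omega>. \<Sum>C\<in>words j. \<Sum>i\<in>walks ?L (k * n). ?p C i \<omega>)"
    using car \<open>1 \<le> j\<close> by (intro Bochner_Integration.integral_cong refl trace_anticommutator_power) auto
  also have "\<dots> = (\<Sum>C\<in>words j. \<Sum>i\<in>walks ?L (k * n). expectation (?p C i))"
    using ex(1) by (simp add: Bochner_Integration.integral_sum)
  also have "\<dots> = (\<Sum>C\<in>words j. \<Sum>i\<in>walks ?L (k * n). walk_value M X ?L C i)"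
    by (intro sum.cong refl ex(2))
  finally show ?thesis by (simp add: anticomm_moment_def)
qed

lemma pairing_weight_eq:
  assumes "0 < k" "0 < n"
  shows "real (n ^ Suc (2 * m) * k ^ num_cycles (4 * m) (full_cycle (4 * m) \<circ> pairing_perm P)) /
    real (k * n) ^ Suc (2 * m) = pairing_weight k m P"
proof -
  let ?c = "num_cycles (4 * m) (full_cycle (4 * m) \<circ> pairing_perm P)"
  have "pairing_weight k m P = real k powi (int ?c - int (Suc (2 * m)))"
    by (simp add: pairing_weight_def add.commute)
  also have "\<dots> = real k ^ ?c / real k ^ Suc (2 * m)"
    using assms(1) by (subst power_int_diff) (simp_all del: power_Suc of_nat_Suc)
  also have "\<dots> = real n ^ Suc (2 * m) * real k ^ ?c / (real k ^ Suc (2 * m) * real n ^ Suc (2 * m))"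
    using assms(2) by (simp del: power_Suc)
  finally show ?thesis by (simp add: power_mult_distrib del: power_Suc)
qed

text \<open>
  The constant in the \<open>O(1/n)\<close> error term of the moment; \<open>K l\<close> bounds the mixed moments of the ensemble of letter \<open>l\<close>.
\<close>

definition moment_error :: "nat \<Rightarrow> nat \<Rightarrow> (letter \<Rightarrow> real) \<Rightarrow> real" where
  "moment_error k m K = (\<Sum>C\<in>configs m.
     (K La * K Lb + real (card (config_pairings m C))) *
       real ((4 * m) ^ (4 * m) * 2 ^ (4 * m) * (2 * k ^ (4 * m))) +
     real (card (config_pairings m C)) * real (2 * k ^ (4 * m)))"

text \<open>
  The set \<open>G C\<close> consists of the pairings that survive in the limit: for these the identification of
  blocks already implies all identifications required by \<open>mt\<close>, and for all others a power of \<open>n\<close> is lost.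
\<close>

lemma moment_approx:
  assumes "prob_space M" and ind: "indep_matrices M (k * n) (X La) (X Lb)"
    and car: "\<And>l \<omega>. \<omega> \<in> space M \<Longrightarrow> X l \<omega> \<in> carrier_mat (k * n) (k * n)"
    and w: "\<And>l. wick M k n (4 * m) (K l) (mt l) (X l)"
    and mt: "\<And>l. mt l = opp_block k n \<or> mt l = opp_entry"
    and pos: "1 \<le> m" "0 < k" "0 < n"
    and G: "\<And>C. G C \<subseteq> config_pairings m C"
    and G_eq: "\<And>C P. P \<in> G C \<Longrightarrow>
      matched k n (4 * m) mt C P = block_matched k n (4 * m) (pairing_perm P)"
    and G_le: "\<And>C P. P \<in> config_pairings m C \<Longrightarrow> P \<notin> G C \<Longrightarrow>
      card (matched k n (4 * m) mt C P) \<le> 2 * k ^ (4 * m) * n ^ (2 * m)"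
  shows "\<bar>anticomm_moment M (k * n) (2 * m) (X La) (X Lb) - (\<Sum>C\<in>configs m. \<Sum>P\<in>G C. pairing_weight k m P)\<bar> \<le>
    moment_error k m K / real n"
proof -
  let ?L = "4 * m"
  let ?cp = "\<lambda>C. real (card (config_pairings m C))"
  let ?D = "real (k * n) ^ Suc (2 * m)"
  have D: "0 < ?D" using pos by simp
  define S where "S C = (\<Sum>i\<in>walks ?L (k * n). walk_value M X ?L C i)" for C
  define T where "T C = (\<Sum>P\<in>G C. real (card (matched k n ?L mt C P)))" for C
  define c where "c C = (K La * K Lb + ?cp C) * real (?L ^ ?L * 2 ^ ?L * (2 * k ^ ?L)) +
     ?cp C * real (2 * k ^ ?L)" for C
  have mom: "anticomm_moment M (k * n) (2 * m) (X La) (X Lb) = (\<Sum>C\<in>configs m. S C) / ?D"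
    using anticomm_moment_eq[of M k n X "2 * m" K mt] assms(1) ind car w pos(1)
    by (simp add: configs_words S_def)
  have wt: "(\<Sum>P\<in>G C. pairing_weight k m P) = T C / ?D" for C
  proof -
    have "pairing_weight k m P = real (card (matched k n ?L mt C P)) / ?D" if P: "P \<in> G C" for P
    proof -
      have "P \<in> pairings ?L" using P G[of C] by (auto simp: config_pairings_def)
      show ?thesis
        unfolding G_eq[OF P] full_matched_count[OF \<open>P \<in> pairings ?L\<close> pos]
        by (rule pairing_weight_eq[OF pos(2,3), symmetric])
    qed
    then show ?thesis unfolding T_def sum_divide_distrib by (intro sum.cong refl)
  qed
  have bound: "\<bar>S C - T C\<bar> \<le> c C * real n ^ (2 * m)" for C
  proof -
    define U where "U = (\<Sum>P\<in>config_pairings m C - G C. real (card (matched k n ?L mt C P)))"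
    have TU: "(\<Sum>P\<in>config_pairings m C. real (card (matched k n ?L mt C P))) = T C + U"
      unfolding T_def U_def using G[of C] finite_config_pairings[of m C] by (simp add: sum.subset_diff add.commute)
    have "0 \<le> U" by (simp add: U_def sum_nonneg)
    have "U \<le> (\<Sum>P\<in>config_pairings m C - G C. real (2 * k ^ ?L * n ^ (2 * m)))"
      unfolding U_def using G_le by (intro sum_mono of_nat_mono) blast
    also have "\<dots> \<le> ?cp C * real (2 * k ^ ?L * n ^ (2 * m))"
    proof -
      have "card (config_pairings m C - G C) \<le> card (config_pairings m C)"
        by (intro card_mono finite_config_pairings) auto
      then show ?thesis by (simp add: mult_right_mono)
    qed
    finally have U: "U \<le> ?cp C * real (2 * k ^ ?L) * real n ^ (2 * m)" by (simp add: mult_ac)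
    have "\<bar>S C - (T C + U)\<bar> \<le>
        (K La * K Lb + ?cp C) * real (?L ^ ?L * 2 ^ ?L * (2 * k ^ ?L)) * real n ^ (2 * m)"
      unfolding S_def TU[symmetric] by (rule sum_walk_value_approx[OF w mt pos])
    then have "\<bar>S C - T C\<bar> \<le>
        (K La * K Lb + ?cp C) * real (?L ^ ?L * 2 ^ ?L * (2 * k ^ ?L)) * real n ^ (2 * m) +
        ?cp C * real (2 * k ^ ?L) * real n ^ (2 * m)"
      using U \<open>0 \<le> U\<close> by linarith
    then show ?thesis by (simp only: c_def distrib_right)
  qed
  have "\<bar>(\<Sum>C\<in>configs m. S C) / ?D - (\<Sum>C\<in>configs m. T C / ?D)\<bar> = \<bar>\<Sum>C\<in>configs m. S C - T C\<bar> / ?D"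
    using D by (simp add: sum_divide_distrib[symmetric] diff_divide_distrib[symmetric] sum_subtractf del: power_Suc)
  also have "\<dots> \<le> (\<Sum>C\<in>configs m. c C * real n ^ (2 * m)) / ?D"
    using D bound by (intro divide_right_mono order_trans[OF sum_abs] sum_mono) (auto intro: less_imp_le)
  also have "\<dots> = moment_error k m K * real n ^ (2 * m) / ?D"
    by (simp add: moment_error_def c_def sum_distrib_right)
  also have "\<dots> \<le> moment_error k m K * real n ^ (2 * m) / real n ^ Suc (2 * m)"
  proof (rule divide_left_mono)
    have "real n \<le> real (k * n)" using pos by simp
    then show "real n ^ Suc (2 * m) \<le> ?D" by (intro power_mono) auto
    have "0 \<le> (\<Sum>C\<in>configs m. c C * real n ^ (2 * m))"
      using bound by (intro sum_nonneg) (meson abs_ge_zero order_trans)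
    then show "0 \<le> moment_error k m K * real n ^ (2 * m)"
      by (simp add: moment_error_def c_def sum_distrib_right)
  qed (use D pos in auto)
  also have "\<dots> = moment_error k m K / real n" using pos by simp
  finally show ?thesis unfolding mom wt .
qed

lemma tendsto_of_error:
  fixes f :: "nat \<Rightarrow> real"
  assumes "\<And>n. 0 < n \<Longrightarrow> \<bar>f n - l\<bar> \<le> c / real n"
  shows "f \<longlonglongrightarrow> l"
proof -
  have "(\<lambda>n. c / real n) \<longlonglongrightarrow> 0" by (rule lim_const_over_n)
  then have "(\<lambda>n. f n - l) \<longlonglongrightarrow> 0"
    by (rule Lim_null_comparison[rotated]) (use assms in \<open>auto intro!: eventually_sequentiallyI[of 1]\<close>)
  then show ?thesis by (simp add: LIM_zero_iff)
qed

theorem theorem1p15: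
  fixes k m :: nat
    and \<Omega> :: "nat \<Rightarrow> 'w measure"
    and A B :: "nat \<Rightarrow> 'w \<Rightarrow> real mat"
    and \<mu> \<nu> :: "real measure"
  assumes "0 < k" and "0 < m"
    and "\<And>N. 0 < N \<Longrightarrow> k dvd N \<Longrightarrow> prob_space (\<Omega> N)"
    and "\<And>N. 0 < N \<Longrightarrow> k dvd N \<Longrightarrow> is_kBCE (\<Omega> N) \<mu> k N (B N)"
    and "\<And>N. 0 < N \<Longrightarrow> k dvd N \<Longrightarrow> indep_matrices (\<Omega> N) N (A N) (B N)"
  shows
    "((\<forall>N. 0 < N \<and> k dvd N \<longrightarrow> is_GOE (\<Omega> N) N (A N)) \<longrightarrow>
       (\<lambda>n. anticomm_moment (\<Omega> (k * n)) (k * n) (2 * m) (A (k * n)) (B (k * n)))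
         \<longlonglongrightarrow> (\<Sum>C\<in>configs m. \<Sum>P\<in>nc_config_pairings m C. pairing_weight k m P)) \<and>
     ((\<forall>N. 0 < N \<and> k dvd N \<longrightarrow> is_kBCE (\<Omega> N) \<nu> k N (A N)) \<longrightarrow>
       (\<lambda>n. anticomm_moment (\<Omega> (k * n)) (k * n) (2 * m) (A (k * n)) (B (k * n)))
         \<longlonglongrightarrow> (\<Sum>C\<in>configs m. \<Sum>P\<in>config_pairings m C. pairing_weight k m P))"
proof (intro conjI impI)
  have kn: "0 < k * n" "k dvd k * n" if "0 < n" for n using assms(1) that by simp_all
  let ?X = "\<lambda>n. case_letter (A (k * n)) (B (k * n))"
  have prob: "prob_space (\<Omega> (k * n))" and ind: "indep_matrices (\<Omega> (k * n)) (k * n) (A (k * n)) (B (k * n))"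
    and bce: "is_kBCE (\<Omega> (k * n)) \<mu> k (k * n) (B (k * n))" if "0 < n" for n
    using assms(3-5)[OF kn[OF that]] by blast+
  {
    assume GOE: "\<forall>N. 0 < N \<and> k dvd N \<longrightarrow> is_GOE (\<Omega> N) N (A N)"
    let ?K = "case_letter (moment_bound (4 * m) (normal_law 1) (normal_law (sqrt 2))) (moment_bound (4 * m) \<mu> \<mu>)"
    show "(\<lambda>n. anticomm_moment (\<Omega> (k * n)) (k * n) (2 * m) (A (k * n)) (B (k * n)))
         \<longlonglongrightarrow> (\<Sum>C\<in>configs m. \<Sum>P\<in>nc_config_pairings m C. pairing_weight k m P)"
    proof (rule tendsto_of_error)
      fix n :: nat assume n: "0 < n"
      have goe: "is_GOE (\<Omega> (k * n)) (k * n) (A (k * n))" using GOE kn[OF n] by blast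
      have "\<bar>anticomm_moment (\<Omega> (k * n)) (k * n) (2 * m) (?X n La) (?X n Lb) -
          (\<Sum>C\<in>configs m. \<Sum>P\<in>nc_config_pairings m C. pairing_weight k m P)\<bar> \<le> moment_error k m ?K / real n"
      proof (rule moment_approx[OF prob[OF n], where mt = "goe_relation k n"])
        show "indep_matrices (\<Omega> (k * n)) (k * n) (?X n La) (?X n Lb)" using ind[OF n] by simp
        show "?X n l \<omega> \<in> carrier_mat (k * n) (k * n)" if "\<omega> \<in> space (\<Omega> (k * n))" for l \<omega>
          using goe bce[OF n] that by (cases l) (simp_all add: is_GOE_def is_kBCE_def)
        show "wick (\<Omega> (k * n)) k n (4 * m) (?K l) (goe_relation k n l) (?X n l)" for l
          using wick_GOE[OF prob[OF n] goe] wick_kBCE[OF prob[OF n] assms(1) n bce[OF n]]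
          by (cases l) simp_all
        show "goe_relation k n l = opp_block k n \<or> goe_relation k n l = opp_entry" for l
          by (cases l) simp_all
        show "nc_config_pairings m C \<subseteq> config_pairings m C" for C
          by (auto simp: nc_config_pairings_def)
      qed (use assms(1,2) n matched_goe_nc card_matched_crossing in auto)
      then show "\<bar>anticomm_moment (\<Omega> (k * n)) (k * n) (2 * m) (A (k * n)) (B (k * n)) -
          (\<Sum>C\<in>configs m. \<Sum>P\<in>nc_config_pairings m C. pairing_weight k m P)\<bar> \<le> moment_error k m ?K / real n"
        by simp
    qed
  }
  {
    assume BCE: "\<forall>N. 0 < N \<and> k dvd N \<longrightarrow> is_kBCE (\<Omega> N) \<nu> k N (A N)"
    let ?K = "case_letter (moment_bound (4 * m) \<nu> \<nu>) (moment_bound (4 * m) \<mu> \<mu>)"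
    show "(\<lambda>n. anticomm_moment (\<Omega> (k * n)) (k * n) (2 * m) (A (k * n)) (B (k * n)))
         \<longlonglongrightarrow> (\<Sum>C\<in>configs m. \<Sum>P\<in>config_pairings m C. pairing_weight k m P)"
    proof (rule tendsto_of_error)
      fix n :: nat assume n: "0 < n"
      have bceA: "is_kBCE (\<Omega> (k * n)) \<nu> k (k * n) (A (k * n))" using BCE kn[OF n] by blast
      have "\<bar>anticomm_moment (\<Omega> (k * n)) (k * n) (2 * m) (?X n La) (?X n Lb) -
          (\<Sum>C\<in>configs m. \<Sum>P\<in>config_pairings m C. pairing_weight k m P)\<bar> \<le> moment_error k m ?K / real n"
      proof (rule moment_approx[OF prob[OF n], where mt = "\<lambda>_. opp_block k n"])
        show "indep_matrices (\<Omega> (k * n)) (k * n) (?X n La) (?X n Lb)" using ind[OF n] by simp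
        show "?X n l \<omega> \<in> carrier_mat (k * n) (k * n)" if "\<omega> \<in> space (\<Omega> (k * n))" for l \<omega>
          using bceA bce[OF n] that by (cases l) (simp_all add: is_kBCE_def)
        show "wick (\<Omega> (k * n)) k n (4 * m) (?K l) (opp_block k n) (?X n l)" for l
          using wick_kBCE[OF prob[OF n] assms(1) n bceA] wick_kBCE[OF prob[OF n] assms(1) n bce[OF n]]
          by (cases l) simp_all
        show "matched k n (4 * m) (\<lambda>_. opp_block k n) C P = block_matched k n (4 * m) (pairing_perm P)" for C P
          by (rule matched_block) simp
      qed (use assms(1,2) n in auto)
      then show "\<bar>anticomm_moment (\<Omega> (k * n)) (k * n) (2 * m) (A (k * n)) (B (k * n)) -
          (\<Sum>C\<in>configs m. \<Sum>P\<in>config_pairings m C. pairing_weight k m P)\<bar> \<le> moment_error k m ?K / real n"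
        by simp
    qed
  }
qed

end
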